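(* Let $k\ge2$ be fixed, $k_X=\lfloor k/2\rfloor$, $k_Y=\lceil k/2\rceil$, and let $n\to\infty$ range over multiples of $k$. Let $p=p(n)$ and $\epsilon=\epsilon(n)$ satisfy $\epsilon\to0$ and $\epsilon n^{1/2}p^2/\log^5n\to\infty$. Let $H=([n],\mathcal E)$ be a $k$-uniform hypergraph with $m$ edges, $p=m/\binom nk$, satisfying: (R_a) $d_H(S)\ge\lceil(1-\epsilon)\binom{n-k_X}{k_Y}p\rceil$ for all $S\in\binom{[n]}{k_X}$; (R_b) $d_H(S)\ge\lceil(1-\epsilon)\binom{n-k_Y}{k_X}p\rceil$ for all $S\in\binom{[n]}{k_Y}$; (R_c) $d_H(S)\le\lceil(1+\epsilon)\binom{n-k_X-1}{k_Y-1}p\rceil$ for all $S\in\binom{[n]}{k_X+1}$; (R_d) $d_H(S)\le\lceil(1+\epsilon)\binom{n-k_Y-1}{k_X-1}p\rceil$ for all $S\in\binom{[n]}{k_Y+1}$; (R_e) $|N_H(S_1)\cap N_H(S_2)|\le\lfloor(1+\epsilon)\binom{n-2k_X}{k_Y}p^2\rfloor$ for all disjoint $S_1,S_2\in\binom{[n]}{k_X}$; (R_f) $|N_H(S_1)\cap N_H(S_2)|\le\lfloor(1+\epsilon)\binom{n-2k_Y}{k_X}p^2\rfloor$ for all disjoint $S_1,S_2\in\binom{[n]}{k_Y}$. Then, for $n$ sufficiently large, $H$ contains at least $(1-4\epsilon^{1/3})m/\nu_k$ pairwise edge-disjoint perfect matchings, where $\nu_k=n/k$.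
   Context: For a $k$-uniform hypergraph $H=([n],\mathcal E)$ and $X\subseteq[n]$ with $|X|=a<k$, $N_H(X)=\{Y\in\binom{[n]}{k-a}: X\cup Y\in\mathcal E\}$ and $d_H(X)=|N_H(X)|$. A perfect matching is a set of $n/k$ pairwise disjoint edges covering $[n]$. *)

theory Defs
  imports "HOL-Analysis.Analysis"
begin

definition uniform_hypergraph :: "nat \<Rightarrow> nat \<Rightarrow> nat set set \<Rightarrow> bool" where
  "uniform_hypergraph n k E \<longleftrightarrow> (\<forall>e\<in>E. e \<subseteq> {1..n} \<and> card e = k)"

definition nbhd :: "nat \<Rightarrow> nat \<Rightarrow> nat set set \<Rightarrow> nat set \<Rightarrow> nat set set" where
  "nbhd n k E X = {Y. Y \<subseteq> {1..n} \<and> card Y = k - card X \<and> X \<union> Y \<in> E}"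

definition deg :: "nat \<Rightarrow> nat \<Rightarrow> nat set set \<Rightarrow> nat set \<Rightarrow> nat" where
  "deg n k E X = card (nbhd n k E X)"

definition perfect_matching :: "nat \<Rightarrow> nat \<Rightarrow> nat set set \<Rightarrow> nat set set \<Rightarrow> bool" where
  "perfect_matching n k E M \<longleftrightarrow> M \<subseteq> E \<and> card M = n div k \<and>
     (\<forall>e\<in>M. \<forall>f\<in>M. e \<noteq> f \<longrightarrow> e \<inter> f = {}) \<and> \<Union>M = {1..n}"

end

theory Submission
  imports Defs "HOL-Combinatorics.Permutations"
begin

text \<open>
  Fix a partition of \<open>[n]\<close> into \<open>\<nu> = n/k\<close> blocks of size \<open>\<lfloor>k/2\<rfloor>\<close> and \<open>\<nu>\<close> blocks of size \<open>\<lceil>k/2\<rceil>\<close>. A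
  permutation of \<open>[n]\<close> (a template) moves the blocks, and joining a small and a large block whose
  union is an edge of \<open>H\<close> gives a bipartite graph on \<open>\<nu> + \<nu>\<close> vertices whose perfect matchings are
  perfect matchings of \<open>H\<close>. For almost all templates this graph inherits the degree and codegree
  conditions (concentration by a factorial moment bound), so by Cauchy--Schwarz every cut of it
  carries at least the number of edges that an almost regular factor of degree
  \<open>(1 - \<epsilon>\<^sup>1\<^sup>/\<^sup>3) p \<nu>\<close> requires.

  Choose independent good templates so that each edge of \<open>H\<close> is covered at most \<open>\<Lambda>\<close> times, \<open>\<Lambda>\<close>
  close to the average, and hand each edge to at most one of the templates covering it, with
  probability \<open>1/\<Lambda>\<close> each. By Chernoff bounds all cut conditions survive in every thinned graph, up
  to a factor \<open>1 - \<eta>\<close>, so it has a regular factor (Gale--Ryser), which splits into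
  perfect matchings (Koenig). Summing over the templates gives the bound.
\<close>

section \<open>Hall, Gale--Ryser and Koenig\<close>

text \<open>Why the count comes out right: a template covers a fixed edge with probability \<rho>,
  about \<nu>^2 / (n choose k). With \<open>R\<close> templates, \<Lambda> is about \<rho> R, the
  thinned graphs have degree about p \<nu> / \<Lambda>, and the total R p \<nu> / \<Lambda> is about
  p \<nu> / \<rho> = m / \<nu>, whatever \<Lambda> is. So \<Lambda> may be as large as concentration
  of the covering numbers demands, namely of order log n divided by the square of the relative
  error. The growth hypothesis enters in two forms. Squared, it makes \<epsilon>^2 p^4 n dominate
  log n, the price of codegree concentration with absolute error \<epsilon> p^2. Linearly, it makes
  \<epsilon> p \<nu> dominate log n, and this explains the cube root: for relative errors of order
  x, \<Lambda> has order log n / x^2, and rounding p \<nu> / \<Lambda> down to an integer costs a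
  factor 1 - O(x) only once x^3 p \<nu> dominates log n. The cut estimate by itself would merely ask
  x^2 to exceed a multiple of \<epsilon>.\<close>

text \<open>Rado's argument: shrink the sets one element at a time, keeping the marriage condition,
  until all are singletons; the condition then makes these distinct. A set with two elements always
  has one that can be deleted, because obstructions to both deletions would contradict submodularity
  of the size of unions.\<close>

theorem Hall_marriage:
  fixes A :: "'i \<Rightarrow> 'b set"
  assumes "finite I" and "\<And>i. i \<in> I \<Longrightarrow> finite (A i)"
    and "\<And>K. K \<subseteq> I \<Longrightarrow> card K \<le> card (\<Union>i\<in>K. A i)"
  shows "\<exists>f. inj_on f I \<and> (\<forall>i\<in>I. f i \<in> A i)"
  using assms(2,3)
proof (induction "\<Sum>i\<in>I. card (A i)" arbitrary: A rule: less_induct)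
  case (less A)
  have fin: "finite (\<Union>i\<in>K. A i)" if "K \<subseteq> I" for K
    using that less.prems(1) assms(1) by (meson finite_UN_I finite_subset subsetD)
  show ?case
  proof (cases "\<exists>i\<in>I. \<exists>x\<in>A i. \<exists>y\<in>A i. x \<noteq> y")
    case False
    have ne: "A i \<noteq> {}" if "i \<in> I" for i
      using less.prems(2)[of "{i}"] that by auto
    define f where "f i = (SOME x. x \<in> A i)" for i
    have f: "f i \<in> A i" if "i \<in> I" for i
      using ne[OF that] unfolding f_def by (simp add: some_in_eq)
    have "i = j" if "i \<in> I" "j \<in> I" "f i = f j" for i j
    proof (rule ccontr)
      assume "i \<noteq> j"
      have "A l \<subseteq> {f l}" if "l \<in> I" for l using False f[OF that] that by blast
      then have "A i \<subseteq> {f i}" "A j \<subseteq> {f i}" using \<open>i \<in> I\<close> \<open>j \<in> I\<close> \<open>f i = f j\<close> by auto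
      then have "card (\<Union>l\<in>{i, j}. A l) \<le> card {f i}" by (intro card_mono) auto
      then show False using less.prems(2)[of "{i, j}"] that \<open>i \<noteq> j\<close> by simp
    qed
    then show ?thesis using f by (auto simp: inj_on_def)
  next
    case True
    then obtain i x y where ixy: "i \<in> I" "x \<in> A i" "y \<in> A i" "x \<noteq> y" by blast
    have step: ?thesis if z: "z \<in> A i"
      and hall: "\<And>K. K \<subseteq> I \<Longrightarrow> card K \<le> card (\<Union>l\<in>K. (A(i := A i - {z})) l)" for z
    proof -
      have "(\<Sum>l\<in>I. card ((A(i := A i - {z})) l)) < (\<Sum>l\<in>I. card (A l))"
        using assms(1) ixy(1) z less.prems(1)
        by (intro sum_strict_mono_ex1)
          (auto intro!: bexI[of _ i] card_Diff1_less card_mono simp del: card_Diff_insert card_Diff_singleton)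
      then have "\<exists>f. inj_on f I \<and> (\<forall>l\<in>I. f l \<in> (A(i := A i - {z})) l)"
        using less.prems(1) hall by (intro less.hyps) auto
      then obtain f where f: "inj_on f I" "\<forall>l\<in>I. f l \<in> (A(i := A i - {z})) l" by blast
      have "\<forall>l\<in>I. f l \<in> A l" using f(2) by (auto split: if_splits)
      then show ?thesis using f(1) by blast
    qed
    \<comment> \<open>Only \<open>A i\<close> changes, so a violating index set contains
      \<open>i\<close>; dropping \<open>i\<close> lowers its size by one and turns the strict
      inequality into a weak one.\<close>
    have viol: "\<exists>K \<subseteq> I - {i}. card ((\<Union>l\<in>K. A l) \<union> (A i - {z})) \<le> card K"
      if bad: "\<not> (\<forall>K \<subseteq> I. card K \<le> card (\<Union>l\<in>K. (A(i := A i - {z})) l))" for z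
    proof -
      obtain K where K: "K \<subseteq> I" "card (\<Union>l\<in>K. (A(i := A i - {z})) l) < card K"
        using bad not_le by blast
      have iK: "i \<in> K"
      proof (rule ccontr)
        assume "i \<notin> K"
        then have "(\<Union>l\<in>K. (A(i := A i - {z})) l) = (\<Union>l\<in>K. A l)" by auto
        then show False using K less.prems(2)[of K] by simp
      qed
      have eq: "(\<Union>l\<in>K. (A(i := A i - {z})) l) = (\<Union>l\<in>K-{i}. A l) \<union> (A i - {z})"
        using iK by (auto split: if_splits)
      have "card K = Suc (card (K - {i}))"
        using iK K(1) assms(1) by (metis card.remove finite_subset)
      then have "card ((\<Union>l\<in>K-{i}. A l) \<union> (A i - {z})) \<le> card (K - {i})"
        using K(2) eq by simp
      then show ?thesis using K(1) by (intro exI[of _ "K - {i}"]) auto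
    qed
    show ?thesis
    proof (rule ccontr)
      assume no: "\<not> ?thesis"
      obtain K where K: "K \<subseteq> I - {i}" "card ((\<Union>l\<in>K. A l) \<union> (A i - {x})) \<le> card K"
        using viol[of x] step[of x] no ixy by blast
      obtain L where L: "L \<subseteq> I - {i}" "card ((\<Union>l\<in>L. A l) \<union> (A i - {y})) \<le> card L"
        using viol[of y] step[of y] no ixy by blast
      let ?P = "(\<Union>l\<in>K. A l) \<union> (A i - {x})" and ?Q = "(\<Union>l\<in>L. A l) \<union> (A i - {y})"
      have KL: "finite K" "finite L" "K \<subseteq> I" "L \<subseteq> I"
        using K(1) L(1) assms(1) finite_subset[of _ "I - {i}"] by auto
      have fP: "finite ?P" and fQ: "finite ?Q"
        using fin[OF KL(3)] fin[OF KL(4)] less.prems(1)[OF ixy(1)] by auto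
      \<comment> \<open>As \<open>x \<noteq> y\<close>, the union recovers all of \<open>A i\<close>
        and so has at least |K \<union> L| + 1 elements, while the intersection has at least |K
        \<inter> L|. Together this exceeds |K| + |L|, the bound on the sum of both sizes.\<close>
      have "?P \<union> ?Q = (\<Union>l\<in>insert i (K \<union> L). A l)"
        using ixy by auto
      then have un: "card (insert i (K \<union> L)) \<le> card (?P \<union> ?Q)"
        using less.prems(2)[of "insert i (K \<union> L)"] KL ixy(1) by simp
      have "card (K \<inter> L) \<le> card (\<Union>l\<in>K\<inter>L. A l)"
        using KL by (intro less.prems(2)) auto
      also have "\<dots> \<le> card (?P \<inter> ?Q)"
        using fP by (intro card_mono) auto
      finally have inter: "card (K \<inter> L) \<le> card (?P \<inter> ?Q)" .
      have "card (insert i (K \<union> L)) = Suc (card (K \<union> L))"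
        using K(1) L(1) KL by (subst card_insert_disjoint) auto
      moreover have "card K + card L = card (K \<union> L) + card (K \<inter> L)"
        using KL by (intro card_Un_Int)
      moreover have "card ?P + card ?Q = card (?P \<union> ?Q) + card (?P \<inter> ?Q)"
        using fP fQ by (intro card_Un_Int)
      ultimately show False using un inter K(2) L(2) by linarith
    qed
  qed
qed

lemma card_edges_by_fst:
  assumes "finite G" "finite S" "\<And>e. e \<in> G \<Longrightarrow> fst e \<in> S"
  shows "card G = (\<Sum>a\<in>S. card {b. (a, b) \<in> G})"
proof -
  have eq: "G = (SIGMA a:S. {b. (a, b) \<in> G})" using assms(3) by force
  have "finite {b. (a, b) \<in> G}" for a
    by (rule finite_subset[of _ "snd ` G"]) (use assms(1) in \<open>force+\<close>)
  then show ?thesis by (subst eq, subst card_SigmaI) (use assms(2) in auto)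
qed

lemma card_edges_by_snd:
  assumes "finite G" "finite T" "\<And>e. e \<in> G \<Longrightarrow> snd e \<in> T"
  shows "card G = (\<Sum>b\<in>T. card {a. (a, b) \<in> G})"
proof -
  have "card G = card (G\<inverse>)" by simp
  also have "\<dots> = (\<Sum>b\<in>T. card {a. (b, a) \<in> G\<inverse>})"
    using assms by (intro card_edges_by_fst) auto
  finally show ?thesis by simp
qed

text \<open>Gale--Ryser by marriage: the people are \<open>r\<close> copies of every \<open>a \<in> A\<close> and
  \<open>d(b) - r\<close> copies of every \<open>b \<in> B\<close>, the jobs are the edges. The edges taken by copies
  of vertices of \<open>A\<close> form the factor; the copies of \<open>b\<close> absorb the edges that are not used.\<close>

theorem bipartite_factor:
  fixes A :: "'a set" and B :: "'b set"
  assumes fA: "finite A" and fB: "finite B" and G: "G \<subseteq> A \<times> B" and AB: "card A = card B"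
    and cut: "\<And>S T. S \<subseteq> A \<Longrightarrow> T \<subseteq> B \<Longrightarrow> r * card S \<le> card (G \<inter> S \<times> (B - T)) + r * card T"
  shows "\<exists>H\<subseteq>G. (\<forall>a\<in>A. card {b. (a, b) \<in> H} = r) \<and> (\<forall>b\<in>B. card {a. (a, b) \<in> H} = r)"
proof -
  have fG: "finite G" using G fA fB finite_subset by blast
  define d where "d b = card {a. (a, b) \<in> G}" for b
  \<comment> \<open>The cut \<open>S = A\<close>, \<open>T = B - {b}\<close> forces degree at least
    \<open>r\<close>, so the truncated subtraction \<open>d b - r\<close> is a genuine one.\<close>
  have dr: "r \<le> d b" if b: "b \<in> B" for b
  proof -
    have "B - (B - {b}) = {b}" using b by auto
    then have "r * card A \<le> card (G \<inter> A \<times> {b}) + r * (card B - 1)"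
      using cut[of A "B - {b}"] b fB by simp
    moreover have "card B \<ge> 1" using b fB by (auto simp: Suc_le_eq card_gt_0_iff)
    moreover have "card (G \<inter> A \<times> {b}) = d b"
    proof -
      have "G \<inter> A \<times> {b} = (\<lambda>a. (a, b)) ` {a. (a, b) \<in> G}" using G by auto
      then show ?thesis unfolding d_def by (simp add: card_image inj_on_def)
    qed
    moreover have "r * card B = r * (card B - 1) + r" if "card B \<ge> 1"
      using that by (metis Suc_diff_1 Suc_le_eq mult_Suc_right add.commute One_nat_def)
    ultimately show ?thesis using AB by simp
  qed
  define IA where "IA = A \<times> {..<r}"
  define IB where "IB U = (SIGMA b:U. {..<d b - r})" for U
  define I :: "('a \<times> nat + 'b \<times> nat) set" where "I = Inl ` IA \<union> Inr ` IB B"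
  define N where "N v = (case v of Inl (a, _) \<Rightarrow> {e \<in> G. fst e = a} | Inr (b, _) \<Rightarrow> {e \<in> G. snd e = b})"
    for v :: "'a \<times> nat + 'b \<times> nat"
  have fI: "finite I" unfolding I_def IA_def IB_def using fA fB by auto
  have fN: "finite (N v)" for v unfolding N_def using fG by (auto split: sum.splits)
  have hall: "card K \<le> card (\<Union>v\<in>K. N v)" if K: "K \<subseteq> I" for K
  proof -
    define S where "S = {a. \<exists>i. Inl (a, i) \<in> K}"
    define U where "U = {b. \<exists>i. Inr (b, i) \<in> K}"
    have S: "S \<subseteq> A" and U: "U \<subseteq> B" using K unfolding S_def U_def I_def IA_def IB_def by auto
    have fS: "finite S" and fU: "finite U" using S U fA fB finite_subset by auto
    have Ksub: "K \<subseteq> Inl ` (S \<times> {..<r}) \<union> Inr ` IB U"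
    proof
      fix v assume v: "v \<in> K"
      then show "v \<in> Inl ` (S \<times> {..<r}) \<union> Inr ` IB U"
        using K unfolding I_def IA_def IB_def S_def U_def by (cases v) auto
    qed
    have fIBU: "finite (IB U)" unfolding IB_def using fU by auto
    have "card K \<le> card (Inl ` (S \<times> {..<r}) \<union> Inr ` IB U :: ('a \<times> nat + 'b \<times> nat) set)"
      using Ksub fS fIBU by (intro card_mono) auto
    also have "\<dots> \<le> card (S \<times> {..<r}) + card (IB U)"
      by (rule order_trans[OF card_Un_le], intro add_mono card_image_le) (use fS fIBU in auto)
    also have "card (IB U) = (\<Sum>b\<in>U. d b - r)" unfolding IB_def using fU by (simp add: card_SigmaI)
    finally have 1: "card K \<le> r * card S + (\<Sum>b\<in>U. d b - r)" by (simp add: card_cartesian_product mult.commute)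
    have 2: "(\<Sum>b\<in>U. d b - r) + r * card U = (\<Sum>b\<in>U. d b)"
    proof -
      have "(\<Sum>b\<in>U. d b) = (\<Sum>b\<in>U. (d b - r) + r)" using dr U by (intro sum.cong) auto
      then show ?thesis by (simp add: sum.distrib mult.commute)
    qed
    have 3: "card (G \<inter> A \<times> U) = (\<Sum>b\<in>U. d b)"
    proof -
      have "card (G \<inter> A \<times> U) = (\<Sum>b\<in>U. card {a. (a, b) \<in> G \<inter> A \<times> U})"
        using fG fU by (intro card_edges_by_snd) auto
      also have "\<dots> = (\<Sum>b\<in>U. d b)"
        using G unfolding d_def by (intro sum.cong refl arg_cong[where f = card]) auto
      finally show ?thesis .
    qed
    \<comment> \<open>Every edge touching \<open>S\<close> or \<open>U\<close> is acceptable to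
      \<open>K\<close>; split these by whether the right end lies in \<open>U\<close>. The copies of
      \<open>U\<close> number d(U) - r |U|, so Hall's condition for \<open>K\<close> becomes the cut
      hypothesis with \<open>T = U\<close>.\<close>
    have "G \<inter> S \<times> (B - U) \<union> G \<inter> A \<times> U \<subseteq> (\<Union>v\<in>K. N v)"
    proof
      fix e assume e: "e \<in> G \<inter> S \<times> (B - U) \<union> G \<inter> A \<times> U"
      show "e \<in> (\<Union>v\<in>K. N v)"
      proof (cases "snd e \<in> U")
        case True
        then obtain i where "Inr (snd e, i) \<in> K" unfolding U_def by auto
        then show ?thesis using e by (intro UN_I[of "Inr (snd e, i)"]) (auto simp: N_def)
      next
        case False
        then obtain i where "Inl (fst e, i) \<in> K" using e unfolding S_def by auto
        then show ?thesis using e by (intro UN_I[of "Inl (fst e, i)"]) (auto simp: N_def)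
      qed
    qed
    then have "card (G \<inter> S \<times> (B - U) \<union> G \<inter> A \<times> U) \<le> card (\<Union>v\<in>K. N v)"
      using K fI finite_subset by (intro card_mono finite_UN_I fN) auto
    moreover have "card (G \<inter> S \<times> (B - U) \<union> G \<inter> A \<times> U) = card (G \<inter> S \<times> (B - U)) + card (G \<inter> A \<times> U)"
      using fG by (intro card_Un_disjoint) auto
    ultimately show ?thesis using 1 2 3 cut[OF S U] by linarith
  qed
  obtain f where f: "inj_on f I" "\<forall>v\<in>I. f v \<in> N v"
    using Hall_marriage[OF fI fN hall] by blast
  define H where "H = f ` Inl ` IA"
  have HG: "H \<subseteq> G" using f(2) unfolding H_def I_def N_def by (force split: sum.splits)
  have row: "card {b. (a, b) \<in> H} = r" if a: "a \<in> A" for a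
  proof -
    have "Pair a ` {b. (a, b) \<in> H} = f ` Inl ` ({a} \<times> {..<r})"
    proof (intro equalityI subsetI)
      fix e assume "e \<in> Pair a ` {b. (a, b) \<in> H}"
      then have "e \<in> H" "fst e = a" by auto
      then obtain a' i where e: "e = f (Inl (a', i))" "a' \<in> A" "i < r" "fst e = a"
        unfolding H_def IA_def by auto
      have "f (Inl (a', i)) \<in> N (Inl (a', i))" using f(2) e unfolding I_def IA_def by auto
      then have "a' = a" using e by (auto simp: N_def)
      then show "e \<in> f ` Inl ` ({a} \<times> {..<r})" using e by auto
    next
      fix e assume "e \<in> f ` Inl ` ({a} \<times> {..<r})"
      then obtain i where e: "e = f (Inl (a, i))" "i < r" by auto
      have "e \<in> N (Inl (a, i))" using f(2) e a unfolding I_def IA_def by auto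
      moreover have "e \<in> H" using e a unfolding H_def IA_def by auto
      ultimately show "e \<in> Pair a ` {b. (a, b) \<in> H}" by (cases e) (auto simp: N_def)
    qed
    moreover have "card (f ` Inl ` ({a} \<times> {..<r})) = r"
    proof -
      have "Inl ` ({a} \<times> {..<r}) \<subseteq> I" using a unfolding I_def IA_def by auto
      then have "card (f ` Inl ` ({a} \<times> {..<r})) = card (Inl ` ({a} \<times> {..<r}) :: ('a \<times> nat + 'b \<times> nat) set)"
        using f(1) by (intro card_image) (auto intro: inj_on_subset)
      also have "\<dots> = r" by (simp add: card_image)
      finally show ?thesis .
    qed
    ultimately show ?thesis by (metis card_image inj_on_def Pair_inject)
  qed
  \<comment> \<open>The copies of \<open>b\<close> hold \<open>d b - r\<close> distinct edges at
    \<open>b\<close> outside \<open>H\<close>, which leaves at most \<open>r\<close> for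
    \<open>H\<close>. Equality comes from counting \<open>H\<close> from the other side.\<close>
  have colle: "card {a. (a, b) \<in> H} \<le> r" if b: "b \<in> B" for b
  proof -
    let ?W = "f ` Inr ` ({b} \<times> {..<d b - r})"
    let ?G = "{e \<in> G. snd e = b}"
    have sub: "Inr ` ({b} \<times> {..<d b - r}) \<subseteq> I" using b unfolding I_def IB_def by auto
    have cW: "card ?W = d b - r"
    proof -
      have "card ?W = card (Inr ` ({b} \<times> {..<d b - r}) :: ('a \<times> nat + 'b \<times> nat) set)"
        using f(1) sub by (intro card_image) (auto intro: inj_on_subset)
      then show ?thesis by (simp add: card_image)
    qed
    have W: "?W \<subseteq> ?G" using f(2) sub by (force simp: N_def)
    have dis: "?W \<inter> H = {}"
    proof -
      have "Inr ` ({b} \<times> {..<d b - r}) \<inter> Inl ` IA = {}" by auto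
      moreover have "Inl ` IA \<subseteq> I" unfolding I_def by auto
      ultimately show ?thesis unfolding H_def
        using inj_on_image_Int[OF f(1) sub, of "Inl ` IA"] by auto
    qed
    have cG: "card ?G = d b"
    proof -
      have "?G = (\<lambda>a. (a, b)) ` {a. (a, b) \<in> G}" by force
      then show ?thesis unfolding d_def by (simp add: card_image inj_on_def)
    qed
    have "card {a. (a, b) \<in> H} = card ((\<lambda>a. (a, b)) ` {a. (a, b) \<in> H})"
      by (simp add: card_image inj_on_def)
    also have "\<dots> \<le> card (?G - ?W)"
      using fG HG dis by (intro card_mono) auto
    also have "\<dots> = d b - (d b - r)"
      using W fG cW cG by (subst card_Diff_subset) (auto intro: finite_subset)
    finally show ?thesis using dr[OF b] by simp
  qed
  have fH: "finite H" using HG fG finite_subset by blast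
  have "(\<Sum>b\<in>B. card {a. (a, b) \<in> H}) = card H"
    using fH HG G fB by (intro card_edges_by_snd[symmetric]) auto
  also have "\<dots> = (\<Sum>a\<in>A. card {b. (a, b) \<in> H})"
    using fH HG G fA by (intro card_edges_by_fst) auto
  also have "\<dots> = (\<Sum>b\<in>B. r)" using row AB by simp
  finally have eq: "(\<Sum>b\<in>B. card {a. (a, b) \<in> H}) = (\<Sum>b\<in>B. r)" .
  have "card {a. (a, b) \<in> H} = r" if b: "b \<in> B" for b
  proof (rule ccontr)
    assume "card {a. (a, b) \<in> H} \<noteq> r"
    then have "(\<Sum>b\<in>B. card {a. (a, b) \<in> H}) < (\<Sum>b\<in>B. r)"
      using colle b fB by (intro sum_strict_mono_ex1) (auto intro!: bexI[of _ b] simp: le_neq_implies_less)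
    then show False using eq by simp
  qed
  then show ?thesis using HG row by blast
qed

text \<open>Double counting gives Hall's condition in a regular graph of positive degree, and
  removing the matching found lowers the degree by one. The matchings are given as bijections
  \<open>f l\<close>, so edge-disjointness is injectivity in \<open>l\<close> at every
  vertex.\<close>

theorem bipartite_regular_decomposition:
  fixes A :: "'a set" and B :: "'b set"
  assumes fA: "finite A" and fB: "finite B" and AB: "card A = card B"
    and "H \<subseteq> A \<times> B"
    and "\<And>a. a \<in> A \<Longrightarrow> card {b. (a, b) \<in> H} = r" and "\<And>b. b \<in> B \<Longrightarrow> card {a. (a, b) \<in> H} = r"
  shows "\<exists>f. (\<forall>l<r. bij_betw (f l) A B \<and> (\<forall>a\<in>A. (a, f l a) \<in> H)) \<and>
    (\<forall>l<r. \<forall>l'<r. \<forall>a\<in>A. f l a = f l' a \<longrightarrow> l = l')"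
  using assms(4-6)
proof (induction r arbitrary: H)
  case 0
  then show ?case by auto
next
  case (Suc r H)
  have fH: "finite H" using Suc.prems(1) fA fB finite_subset by blast
  have finrow: "finite {b. (a, b) \<in> H}" for a
    by (rule finite_subset[of _ B]) (use Suc.prems(1) fB in auto)
  have fincol: "finite {a. (a, b) \<in> H}" for b
    by (rule finite_subset[of _ A]) (use Suc.prems(1) fA in auto)
  have "\<exists>g. inj_on g A \<and> (\<forall>a\<in>A. g a \<in> {b. (a, b) \<in> H})"
  proof (rule Hall_marriage[OF fA finrow])
    fix K assume K: "K \<subseteq> A"
    let ?M = "\<Union>a\<in>K. {b. (a, b) \<in> H}"
    have M: "?M \<subseteq> B" using Suc.prems(1) by auto
    have fK: "finite K" using K fA finite_subset by auto
    have fM: "finite ?M" using M fB by (rule finite_subset)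
    have "Suc r * card K = (\<Sum>a\<in>K. card {b. (a, b) \<in> H \<inter> K \<times> UNIV})"
    proof -
      have "(\<Sum>a\<in>K. card {b. (a, b) \<in> H \<inter> K \<times> UNIV}) = (\<Sum>a\<in>K. Suc r)"
        using Suc.prems(2) K by (intro sum.cong) auto
      then show ?thesis by simp
    qed
    also have "\<dots> = card (H \<inter> K \<times> UNIV)"
      using fH fK by (intro card_edges_by_fst[symmetric]) auto
    also have "\<dots> = (\<Sum>b\<in>?M. card {a. (a, b) \<in> H \<inter> K \<times> UNIV})"
      using fH fM by (intro card_edges_by_snd) auto
    also have "\<dots> \<le> (\<Sum>b\<in>?M. Suc r)"
    proof (rule sum_mono)
      fix b assume "b \<in> ?M"
      then have "card {a. (a, b) \<in> H} = Suc r" using M Suc.prems(3) by blast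
      moreover have "card {a. (a, b) \<in> H \<inter> K \<times> UNIV} \<le> card {a. (a, b) \<in> H}"
        using fincol by (intro card_mono) auto
      ultimately show "card {a. (a, b) \<in> H \<inter> K \<times> UNIV} \<le> Suc r" by simp
    qed
    finally have "Suc r * card K \<le> Suc r * card ?M" by (simp add: mult.commute)
    then show "card K \<le> card ?M" by (simp only: Suc_mult_le_cancel1)
  qed
  then obtain g where g: "inj_on g A" "\<And>a. a \<in> A \<Longrightarrow> (a, g a) \<in> H" by blast
  have gB: "g ` A = B"
    using g Suc.prems(1) AB fB by (intro card_subset_eq) (auto simp: card_image)
  define H' where "H' = H - (\<lambda>a. (a, g a)) ` A"
  have "\<exists>f. (\<forall>l<r. bij_betw (f l) A B \<and> (\<forall>a\<in>A. (a, f l a) \<in> H')) \<and>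
    (\<forall>l<r. \<forall>l'<r. \<forall>a\<in>A. f l a = f l' a \<longrightarrow> l = l')"
  proof (rule Suc.IH)
    show "H' \<subseteq> A \<times> B" using Suc.prems(1) unfolding H'_def by auto
    fix a assume a: "a \<in> A"
    have "{b. (a, b) \<in> H'} = {b. (a, b) \<in> H} - {g a}" using a unfolding H'_def by auto
    then show "card {b. (a, b) \<in> H'} = r"
      using g(2)[OF a] Suc.prems(2)[OF a] finrow by (simp add: card_Diff_singleton)
  next
    fix b assume b: "b \<in> B"
    then obtain a where a: "a \<in> A" "g a = b" using gB by auto
    have "{c. (c, b) \<in> H'} = {c. (c, b) \<in> H} - {a}"
      using a g(1) unfolding H'_def by (auto simp: inj_on_def)
    then show "card {c. (c, b) \<in> H'} = r"
      using g(2)[OF a(1)] a Suc.prems(3)[OF b] fincol by (simp add: card_Diff_singleton)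
  qed
  then obtain f where f: "\<And>l. l < r \<Longrightarrow> bij_betw (f l) A B"
      "\<And>l a. l < r \<Longrightarrow> a \<in> A \<Longrightarrow> (a, f l a) \<in> H'"
      "\<And>l l' a. l < r \<Longrightarrow> l' < r \<Longrightarrow> a \<in> A \<Longrightarrow> f l a = f l' a \<Longrightarrow> l = l'" by blast
  have ne: "f l a \<noteq> g a" if "l < r" "a \<in> A" for l a
    using f(2)[OF that] that unfolding H'_def by auto
  have H'H: "H' \<subseteq> H" unfolding H'_def by auto
  define f' where "f' l = (if l = r then g else f l)" for l
  have bg: "bij_betw g A B" using g(1) gB by (simp add: bij_betw_def)
  have "\<forall>l<Suc r. bij_betw (f' l) A B \<and> (\<forall>a\<in>A. (a, f' l a) \<in> H)"
    unfolding f'_def using f(1,2) g(2) bg H'H by (auto simp: less_Suc_eq)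
  moreover have "\<forall>l<Suc r. \<forall>l'<Suc r. \<forall>a\<in>A. f' l a = f' l' a \<longrightarrow> l = l'"
    unfolding f'_def using f(3) ne by (auto simp: less_Suc_eq) metis
  ultimately show ?case by blast
qed

section \<open>Cuts of pseudorandom bipartite graphs\<close>

text \<open>A random graph of density D / |B| has degrees about \<open>D\<close> and codegrees about
  D^2 / |B|. One inequality is imposed on each, matching a variance estimate that uses the first
  moment from below and the second from above. The conditions on the other side are the same
  predicate for the converse relation.\<close>

definition bip_pseudorandom :: "'a set \<Rightarrow> 'b set \<Rightarrow> ('a \<times> 'b) set \<Rightarrow> real \<Rightarrow> real \<Rightarrow> bool" where
  "bip_pseudorandom A B G D e \<longleftrightarrow> G \<subseteq> A \<times> B \<and>
    (\<forall>a\<in>A. (1 - e) * D \<le> real (card {b. (a, b) \<in> G})) \<and>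
    (\<forall>a\<in>A. \<forall>a'\<in>A. a \<noteq> a' \<longrightarrow>
      real (card {b. (a, b) \<in> G \<and> (a', b) \<in> G}) \<le> (1 + e) * D\<^sup>2 / real (card B))"

text \<open>Cauchy--Schwarz for the deviations of the degrees into \<open>S\<close>; the codegrees bound the
  second moment from above and the degrees bound the first moment from below.\<close>

lemma pseudorandom_discrepancy:
  fixes D e :: real
  assumes fA: "finite A" and fB: "finite B" and AB: "card A = \<nu>" "card B = \<nu>" "\<nu> > 0"
    and G: "bip_pseudorandom A B G D e" and D: "D \<ge> 0" and e: "e \<ge> 0"
    and S: "S \<subseteq> A" and T: "T \<subseteq> B"
  shows "(real (card (G \<inter> S \<times> T)) - card S * card T * D / \<nu>)\<^sup>2
    \<le> card T * (card S * \<nu> + 3 * e * (card S)\<^sup>2 * D\<^sup>2 / \<nu>)"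
proof -
  define g :: "'a \<Rightarrow> 'b \<Rightarrow> real" where "g a b = of_bool ((a, b) \<in> G)" for a b
  define s where "s = real (card S)"
  define d where "d b = (\<Sum>a\<in>S. g a b)" for b
  \<comment> \<open>The number of neighbours in \<open>S\<close> that a vertex of \<open>B\<close>
    would have if the edges were spread evenly.\<close>
  define y where "y = s * D / \<nu>"
  have fS: "finite S" and fT: "finite T" using S T fA fB finite_subset by auto
  have nu: "real \<nu> > 0" using AB by simp
  have Gsub: "G \<subseteq> A \<times> B" using G by (simp add: bip_pseudorandom_def)
  have row: "(\<Sum>b\<in>B. g a b) = card {b. (a, b) \<in> G}" for a
  proof -
    have "{b. (a, b) \<in> G} = {b\<in>B. (a, b) \<in> G}" using Gsub by auto
    then show ?thesis unfolding g_def using fB by (simp add: sum.If_cases of_bool_def Int_def)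
  qed
  have cod: "(\<Sum>b\<in>B. g a b * g a' b) = card {b. (a, b) \<in> G \<and> (a', b) \<in> G}" for a a'
  proof -
    have "{b. (a, b) \<in> G \<and> (a', b) \<in> G} = {b\<in>B. (a, b) \<in> G \<and> (a', b) \<in> G}" using Gsub by auto
    moreover have "g a b * g a' b = of_bool ((a, b) \<in> G \<and> (a', b) \<in> G)" for b
      unfolding g_def by auto
    ultimately show ?thesis using fB by (simp add: sum.If_cases of_bool_def Int_def)
  qed
  have eST: "real (card (G \<inter> S \<times> T)) = (\<Sum>b\<in>T. d b)"
  proof -
    have "(\<Sum>b\<in>T. d b) = (\<Sum>a\<in>S. \<Sum>b\<in>T. g a b)" unfolding d_def by (rule sum.swap)
    also have "\<dots> = (\<Sum>z\<in>S\<times>T. of_bool (z \<in> G))"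
      unfolding g_def by (simp add: sum.cartesian_product case_prod_unfold)
    also have "\<dots> = card (G \<inter> S \<times> T)"
      using fS fT by (simp add: sum.If_cases of_bool_def Int_def conj_commute)
    finally show ?thesis by simp
  qed
  have first: "(\<Sum>b\<in>B. d b) \<ge> s * (1 - e) * D"
  proof -
    have "(\<Sum>b\<in>B. d b) = (\<Sum>a\<in>S. \<Sum>b\<in>B. g a b)" unfolding d_def by (rule sum.swap)
    also have "\<dots> \<ge> (\<Sum>a\<in>S. (1 - e) * D)"
      unfolding row using G S by (intro sum_mono) (auto simp: bip_pseudorandom_def)
    finally show ?thesis by (simp add: s_def mult.assoc)
  qed
  have second: "(\<Sum>b\<in>B. (d b)\<^sup>2) \<le> s * \<nu> + s\<^sup>2 * ((1 + e) * D\<^sup>2 / \<nu>)"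
  proof -
    have "(\<Sum>b\<in>B. (d b)\<^sup>2) = (\<Sum>b\<in>B. \<Sum>a\<in>S. \<Sum>a'\<in>S. g a b * g a' b)"
      unfolding d_def by (simp add: power2_eq_square sum_product)
    also have "\<dots> = (\<Sum>a\<in>S. \<Sum>b\<in>B. \<Sum>a'\<in>S. g a b * g a' b)" by (rule sum.swap)
    also have "\<dots> = (\<Sum>a\<in>S. \<Sum>a'\<in>S. \<Sum>b\<in>B. g a b * g a' b)"
      by (intro sum.cong refl sum.swap)
    \<comment> \<open>A diagonal pair is a plain degree, bounded trivially by \<nu>; the resulting
      term |S| \<nu> becomes harmless once \<nu> is at most e D^2.\<close>
    also have "\<dots> \<le> (\<Sum>a\<in>S. \<Sum>a'\<in>S. (if a = a' then real \<nu> else 0) + (1 + e) * D\<^sup>2 / \<nu>)"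
    proof (intro sum_mono)
      fix a a' assume a: "a \<in> S" "a' \<in> S"
      show "(\<Sum>b\<in>B. g a b * g a' b) \<le> (if a = a' then real \<nu> else 0) + (1 + e) * D\<^sup>2 / \<nu>"
      proof (cases "a = a'")
        case True
        have "card {b. (a, b) \<in> G \<and> (a', b) \<in> G} \<le> card B"
          using Gsub fB by (intro card_mono) auto
        moreover have "(1 + e) * D\<^sup>2 / \<nu> \<ge> 0" using e by simp
        ultimately show ?thesis unfolding cod using True AB by simp
      next
        case False
        then show ?thesis unfolding cod using G a S AB unfolding bip_pseudorandom_def by (simp add: subset_iff)
      qed
    qed
    also have "\<dots> = s * \<nu> + s\<^sup>2 * ((1 + e) * D\<^sup>2 / \<nu>)"
      using fS by (simp add: sum.distrib s_def power2_eq_square distrib_left)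
    finally show ?thesis .
  qed
  have "(real (card (G \<inter> S \<times> T)) - card S * card T * D / \<nu>)\<^sup>2 = (\<Sum>b\<in>T. d b - y)\<^sup>2"
    unfolding eST by (simp add: sum_subtractf y_def s_def mult_ac)
  also have "\<dots> \<le> card T * (\<Sum>b\<in>T. (d b - y)\<^sup>2)"
    using Cauchy_Schwarz_ineq_sum[of "\<lambda>_. 1" "\<lambda>b. d b - y" T] by simp
  \<comment> \<open>Only moments over all of \<open>B\<close> are controlled, so the nonnegative
    terms outside \<open>T\<close> are added.\<close>
  also have "(\<Sum>b\<in>T. (d b - y)\<^sup>2) \<le> (\<Sum>b\<in>B. (d b - y)\<^sup>2)"
    using T fB by (intro sum_mono2) auto
  also have "\<dots> = (\<Sum>b\<in>B. (d b)\<^sup>2) - 2 * y * (\<Sum>b\<in>B. d b) + \<nu> * y\<^sup>2"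
    unfolding power2_diff sum.distrib sum_subtractf using AB
    by (simp add: sum_distrib_left[symmetric] sum_distrib_right[symmetric])
  also have "\<dots> \<le> (s * \<nu> + s\<^sup>2 * ((1 + e) * D\<^sup>2 / \<nu>)) - 2 * y * (s * (1 - e) * D) + \<nu> * y\<^sup>2"
  proof -
    have "2 * y \<ge> 0" unfolding y_def s_def using D by simp
    then have "2 * y * (s * (1 - e) * D) \<le> 2 * y * (\<Sum>b\<in>B. d b)"
      using first by (intro mult_left_mono) auto
    then show ?thesis using second by linarith
  qed
  also have "\<dots> = s * \<nu> + 3 * e * s\<^sup>2 * D\<^sup>2 / \<nu>"
    unfolding y_def using nu by (simp add: field_simps power2_eq_square)
  finally show ?thesis by (simp add: s_def mult_left_mono)
qed

text \<open>Subtract the edges into \<open>T\<close> from the degree sum of \<open>S\<close>. By |T|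
  \<le> |S| and \<nu> \<le> e D^2 the squared deviation is at most 4 e (s D)^2 = 64 e (s D / 4)^2,
  which explains the 64. The deviation costs \<delta> / 4 and the degree error \<open>e\<close>
  another \<delta> / 4.\<close>

lemma pseudorandom_cut_lower:
  fixes D e \<delta> :: real
  assumes fA: "finite A" and fB: "finite B" and AB: "card A = \<nu>" "card B = \<nu>" "\<nu> > 0"
    and G: "bip_pseudorandom A B G D e" and D: "D > 0" and e: "e \<ge> 0" "real \<nu> \<le> e * D\<^sup>2"
    and \<delta>: "64 * e \<le> \<delta>\<^sup>2" "0 < \<delta>" "\<delta> \<le> 1/8"
    and S: "S \<subseteq> A" and T: "T \<subseteq> B" and TS: "card T \<le> card S"
  shows "real (card (G \<inter> S \<times> (B - T))) \<ge> D * card S * (1 - \<delta> / 2 - card T / \<nu>)"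
proof -
  define s where "s = real (card S)"
  define t where "t = real (card T)"
  have fS: "finite S" and fT: "finite T" using S T fA fB finite_subset by auto
  have nu: "real \<nu> > 0" using AB by simp
  have "card S \<le> \<nu>" "card T \<le> \<nu>" using S T AB card_mono[OF fA S] card_mono[OF fB T] by auto
  then have st: "0 \<le> t" "t \<le> s" "s \<le> \<nu>" "t \<le> \<nu>" using TS by (auto simp: s_def t_def)
  have Gsub: "G \<subseteq> A \<times> B" using G by (simp add: bip_pseudorandom_def)
  have fG: "finite G" using Gsub fA fB finite_subset by blast
  have "(real (card (G \<inter> S \<times> T)) - s * t * D / \<nu>)\<^sup>2 \<le> t * (s * \<nu> + 3 * e * s\<^sup>2 * D\<^sup>2 / \<nu>)"
    using pseudorandom_discrepancy[OF fA fB AB G _ e(1) S T] D by (simp add: s_def t_def)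
  also have "\<dots> = t * s * \<nu> + 3 * e * s\<^sup>2 * D\<^sup>2 * (t / \<nu>)" by (simp add: algebra_simps)
  also have "\<dots> \<le> s\<^sup>2 * (e * D\<^sup>2) + 3 * e * s\<^sup>2 * D\<^sup>2 * 1"
  proof (intro add_mono mult_left_mono)
    have "t * s * \<nu> \<le> s * s * \<nu>" using st nu by (intro mult_right_mono) auto
    also have "\<dots> \<le> s * s * (e * D\<^sup>2)" using e st by (intro mult_left_mono) auto
    finally show "t * s * \<nu> \<le> s\<^sup>2 * (e * D\<^sup>2)" by (simp add: power2_eq_square)
  qed (use st nu e in auto)
  also have "\<dots> = (64 * e) * (s * D / 4)\<^sup>2" by (simp add: power2_eq_square)
  also have "\<dots> \<le> \<delta>\<^sup>2 * (s * D / 4)\<^sup>2" using \<delta> by (intro mult_right_mono) auto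
  also have "\<dots> = (\<delta> * s * D / 4)\<^sup>2" by (simp add: power2_eq_square)
  finally have "\<bar>real (card (G \<inter> S \<times> T)) - s * t * D / \<nu>\<bar> \<le> \<bar>\<delta> * s * D / 4\<bar>"
    by (simp only: abs_le_square_iff)
  then have 1: "real (card (G \<inter> S \<times> T)) \<le> s * t * D / \<nu> + \<delta> * s * D / 4"
    using \<delta> st D abs_of_nonneg[of "\<delta> * s * D / 4"] by (simp only: abs_le_iff) auto
  have "(\<Sum>a\<in>S. card {b. (a, b) \<in> G \<inter> S \<times> B}) = card (G \<inter> S \<times> B)"
  proof -
    have "G \<inter> S \<times> B = (SIGMA a:S. {b. (a, b) \<in> G \<inter> S \<times> B})" by auto
    moreover have "card (SIGMA a:S. {b. (a, b) \<in> G \<inter> S \<times> B}) = (\<Sum>a\<in>S. card {b. (a, b) \<in> G \<inter> S \<times> B})"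
      using fS fB by (intro card_SigmaI) (auto intro: finite_subset[of _ B])
    ultimately show ?thesis by metis
  qed
  moreover have "{b. (a, b) \<in> G \<inter> S \<times> B} = {b. (a, b) \<in> G}" if "a \<in> S" for a
    using that Gsub by auto
  ultimately have "real (card (G \<inter> S \<times> B)) = (\<Sum>a\<in>S. real (card {b. (a, b) \<in> G}))"
    by (metis (mono_tags, lifting) of_nat_sum sum.cong)
  also have "\<dots> \<ge> (\<Sum>a\<in>S. (1 - e) * D)"
    using G S by (intro sum_mono) (auto simp: bip_pseudorandom_def)
  finally have 2: "real (card (G \<inter> S \<times> B)) \<ge> s * ((1 - e) * D)" by (simp add: s_def)
  have "card (G \<inter> S \<times> B) = card (G \<inter> S \<times> (B - T)) + card (G \<inter> S \<times> T)"
    using fG T by (subst card_Un_disjoint[symmetric]) (auto intro!: arg_cong[where f = card])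
  then have 3: "real (card (G \<inter> S \<times> (B - T))) = real (card (G \<inter> S \<times> B)) - card (G \<inter> S \<times> T)"
    by simp
  have "\<delta>\<^sup>2 \<le> \<delta>" using \<delta> by (simp add: power2_eq_square mult_left_le_one_le)
  then have "e \<le> \<delta> / 4" using \<delta> by linarith
  then have "s * D * e \<le> s * D * (\<delta> / 4)" using st D by (intro mult_left_mono) auto
  then show ?thesis using 1 2 3 unfolding s_def[symmetric] t_def[symmetric]
    by (simp add: algebra_simps)
qed

text \<open>After multiplying out the previous bound, the first claim reduces to t (s / \<nu> - 1 +
  \<delta>) \<le> s \<delta> / 2. This can fail only when \<open>S\<close> is nearly everything and
  \<open>T\<close> is comparable to it, which \<open>alt\<close> excludes. \<open>T58\<close> keeps
  the factor 1 - \<delta> / 2 - t / \<nu> above 1/4 for the second claim.\<close>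

lemma pseudorandom_cut_oneside:
  fixes D e \<delta> :: real
  assumes fA: "finite A" and fB: "finite B" and AB: "card A = \<nu>" "card B = \<nu>" "\<nu> > 0"
    and G: "bip_pseudorandom A B G D e" and D: "D > 0" and e: "e \<ge> 0" "real \<nu> \<le> e * D\<^sup>2"
    and \<delta>: "64 * e \<le> \<delta>\<^sup>2" "0 < \<delta>" "\<delta> \<le> 1/8"
    and S: "S \<subseteq> A" and T: "T \<subseteq> B" and TS: "card T \<le> card S"
    and T58: "8 * card T \<le> 5 * \<nu>" and alt: "2 * card T \<le> card S \<or> 4 * card S \<le> 3 * \<nu>"
  shows "real (card (G \<inter> S \<times> (B - T))) \<ge> (1 - \<delta>) * D * (real (card S) - real (card T))"
    and "real (card (G \<inter> S \<times> (B - T))) \<ge> D * card S / 4"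
proof -
  define s where "s = real (card S)"
  define t where "t = real (card T)"
  have nu: "real \<nu> > 0" using AB by simp
  have "card S \<le> \<nu>" using S AB card_mono[OF fA S] by auto
  then have st: "0 \<le> t" "t \<le> s" "s \<le> \<nu>" using TS by (auto simp: s_def t_def)
  have main: "real (card (G \<inter> S \<times> (B - T))) \<ge> D * s * (1 - \<delta> / 2 - t / \<nu>)"
    using pseudorandom_cut_lower[OF assms(1-15)] by (simp add: s_def t_def)
  have "8 * t \<le> 5 * \<nu>" unfolding t_def using T58 by linarith
  then have "t / \<nu> \<le> 5/8" using nu by (simp add: field_simps)
  then have "D * s * (1/4) \<le> D * s * (1 - \<delta> / 2 - t / \<nu>)"
    using \<delta> D st by (intro mult_left_mono) auto
  then show "real (card (G \<inter> S \<times> (B - T))) \<ge> D * card S / 4" using main unfolding s_def by linarith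
  have "t * (s / \<nu> - 1 + \<delta>) \<le> s * (\<delta> / 2)"
  proof (cases "2 * card T \<le> card S")
    case True
    then have "2 * t \<le> s" unfolding s_def t_def by linarith
    moreover have "t * (s / \<nu> - 1 + \<delta>) \<le> t * \<delta>"
      using st nu by (intro mult_left_mono) (auto simp: field_simps)
    moreover have "2 * t * \<delta> \<le> s * \<delta>" using \<open>2 * t \<le> s\<close> \<delta> by (intro mult_right_mono) auto
    ultimately show ?thesis by linarith
  next
    case False
    then have "4 * s \<le> 3 * \<nu>" using alt unfolding s_def by linarith
    then have "s / \<nu> \<le> 3/4" using nu by (simp add: field_simps)
    then have "t * (s / \<nu> - 1 + \<delta>) \<le> t * 0" using st \<delta> by (intro mult_left_mono) auto
    moreover have "0 \<le> s * (\<delta> / 2)" using st \<delta> by auto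
    ultimately show ?thesis by linarith
  qed
  then have "(1 - \<delta>) * (s - t) \<le> s * (1 - \<delta> / 2 - t / \<nu>)"
    unfolding left_diff_distrib right_diff_distrib distrib_left by (simp add: mult_ac)
  then have "D * ((1 - \<delta>) * (s - t)) \<le> D * (s * (1 - \<delta> / 2 - t / \<nu>))"
    using D by (intro mult_left_mono) auto
  then show "real (card (G \<inter> S \<times> (B - T))) \<ge> (1 - \<delta>) * D * (real (card S) - real (card T))"
    using main unfolding s_def t_def by (simp add: mult_ac)
qed

text \<open>For large \<open>T\<close> the roles are exchanged: the same edges run from
  \<open>B - T\<close> to the complement of \<open>A - S\<close>, and the difference of sizes is
  unchanged. The threshold 3 \<nu> / 8 makes the side conditions hold in both cases. The first bound
  is what a regular factor demands; the second keeps cuts with small |S| - |T| large enough for a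
  union bound.\<close>

lemma pseudorandom_cut:
  fixes D e \<delta> :: real
  assumes fA: "finite A" and fB: "finite B" and AB: "card A = \<nu>" "card B = \<nu>" "\<nu> > 0"
    and G: "bip_pseudorandom A B G D e" and G': "bip_pseudorandom B A (G\<inverse>) D e"
    and D: "D > 0" and e: "e \<ge> 0" "real \<nu> \<le> e * D\<^sup>2"
    and \<delta>: "64 * e \<le> \<delta>\<^sup>2" "0 < \<delta>" "\<delta> \<le> 1/8"
    and S: "S \<subseteq> A" and T: "T \<subseteq> B" and TS: "card T < card S"
  shows "real (card (G \<inter> S \<times> (B - T))) \<ge> (1 - \<delta>) * D * (real (card S) - real (card T))"
    and "real (card (G \<inter> S \<times> (B - T))) \<ge> D * min (card S) (card (B - T)) / 4"
proof -
  have "card S \<le> \<nu>" "card T \<le> \<nu>" using S T AB card_mono[OF fA S] card_mono[OF fB T] by auto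
  have fS: "finite S" and fT: "finite T" using S T fA fB finite_subset by auto
  have cAS: "card (A - S) = \<nu> - card S" and cBT: "card (B - T) = \<nu> - card T"
    using fS fT S T AB by (auto simp: card_Diff_subset)
  have "real (card (G \<inter> S \<times> (B - T))) \<ge> (1 - \<delta>) * D * (real (card S) - real (card T)) \<and>
     (real (card (G \<inter> S \<times> (B - T))) \<ge> D * card S / 4 \<or> real (card (G \<inter> S \<times> (B - T))) \<ge> D * card (B - T) / 4)"
  proof (cases "8 * card T \<le> 3 * \<nu>")
    case True
    have "2 * card T \<le> card S \<or> 4 * card S \<le> 3 * \<nu>" using True by linarith
    then show ?thesis
      using pseudorandom_cut_oneside[OF fA fB AB G D e \<delta> S T] TS True by linarith
  next
    case False
    have "(G \<inter> S \<times> (B - T))\<inverse> = G\<inverse> \<inter> (B - T) \<times> (A - (A - S))" using S by auto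
    then have eq: "card (G\<inverse> \<inter> (B - T) \<times> (A - (A - S))) = card (G \<inter> S \<times> (B - T))"
      by (metis card_inverse)
    have le: "card (A - S) \<le> card (B - T)" "8 * card (A - S) \<le> 5 * \<nu>" "4 * card (B - T) \<le> 3 * \<nu>"
      using cAS cBT False TS \<open>card S \<le> \<nu>\<close> by linarith+
    have "real (card (B - T)) - real (card (A - S)) = real (card S) - real (card T)"
      using cAS cBT \<open>card S \<le> \<nu>\<close> \<open>card T \<le> \<nu>\<close> by simp
    then show ?thesis
      using pseudorandom_cut_oneside[OF fB fA AB(2,1,3) G' D e \<delta>, of "B - T" "A - S"] le eq by simp
  qed
  moreover have "D * min (card S) (card (B - T)) \<le> D * card S" "D * min (card S) (card (B - T)) \<le> D * card (B - T)"
    using D by (auto intro!: mult_left_mono)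
  ultimately show "real (card (G \<inter> S \<times> (B - T))) \<ge> (1 - \<delta>) * D * (real (card S) - real (card T))"
    "real (card (G \<inter> S \<times> (B - T))) \<ge> D * min (card S) (card (B - T)) / 4" by linarith+
qed

section \<open>Random permutations of blocks\<close>

lemma ex_permutes_image:
  assumes W: "finite W" and J: "J \<subseteq> W" "J' \<subseteq> W" "card J = card J'"
  shows "\<exists>\<sigma>. \<sigma> permutes W \<and> \<sigma> ` J = J'"
proof -
  have fin: "finite J" "finite J'" using J W finite_subset by auto
  obtain f where f: "bij_betw f J J'" using finite_same_card_bij[OF fin J(3)] by blast
  have "card (W - J) = card (W - J')" using fin J by (simp add: card_Diff_subset)
  then obtain g where g: "bij_betw g (W - J) (W - J')"
    using finite_same_card_bij[of "W - J" "W - J'"] W by blast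
  define \<sigma> where "\<sigma> x = (if x \<in> J then f x else if x \<in> W then g x else x)" for x
  have s1: "bij_betw \<sigma> J J'" using f by (rule bij_betw_cong[THEN iffD1, rotated]) (simp add: \<sigma>_def)
  have s2: "bij_betw \<sigma> (W - J) (W - J')" using g by (rule bij_betw_cong[THEN iffD1, rotated]) (simp add: \<sigma>_def)
  have "bij_betw \<sigma> (J \<union> (W - J)) (J' \<union> (W - J'))" using s1 s2 by (rule bij_betw_combine) auto
  then have "bij_betw \<sigma> W W" using J by (simp add: Un_absorb1)
  then have "\<sigma> permutes W" using J(1) by (intro bij_imp_permutes) (auto simp: \<sigma>_def)
  then show ?thesis using s1 by (auto simp: bij_betw_def)
qed

text \<open>Given the restriction of a random permutation \<open>\<pi>\<close> to \<open>X\<close>, the image of a \<open>b\<close>-set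
  \<open>J\<close> outside \<open>X\<close> is uniform among the \<open>b\<close>-sets outside \<open>\<pi>(X)\<close>. The invariance hypotheses
  say that \<open>Q\<close> and \<open>F\<close> depend only on that restriction.\<close>

lemma permutation_block_average:
  assumes U: "finite U" and X: "X \<subseteq> U" and J: "J \<subseteq> U - X" "card J = b"
    and Q: "\<And>\<pi> \<sigma>. \<pi> permutes U \<Longrightarrow> \<sigma> permutes (U - X) \<Longrightarrow> Q (\<pi> \<circ> \<sigma>) = Q \<pi>"
    and F: "\<And>\<pi> \<sigma>. \<pi> permutes U \<Longrightarrow> \<sigma> permutes (U - X) \<Longrightarrow> F (\<pi> \<circ> \<sigma>) = F \<pi>"
    and M: "\<And>\<pi>. \<pi> permutes U \<Longrightarrow> card {T. T \<subseteq> U - \<pi> ` X \<and> card T = b \<and> T \<in> F \<pi>} \<le> M"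
  shows "card {\<pi>. \<pi> permutes U \<and> Q \<pi> \<and> \<pi> ` J \<in> F \<pi>} * (card (U - X) choose b)
    \<le> M * card {\<pi>. \<pi> permutes U \<and> Q \<pi>}"
proof -
  define P where "P J' = {\<pi>. \<pi> permutes U \<and> Q \<pi> \<and> \<pi> ` J' \<in> F \<pi>}" for J'
  define JJ where "JJ = {J'. J' \<subseteq> U - X \<and> card J' = b}"
  define QQ where "QQ = {\<pi>. \<pi> permutes U \<and> Q \<pi>}"
  have finP: "finite (P J')" for J'
    unfolding P_def by (rule finite_subset[OF _ finite_permutations[OF U]]) auto
  have finQ: "finite QQ"
    unfolding QQ_def by (rule finite_subset[OF _ finite_permutations[OF U]]) auto
  have finJ: "finite JJ" unfolding JJ_def by (rule finite_subset[of _ "Pow U"]) (use U in auto)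
  have cJ: "card JJ = card (U - X) choose b" unfolding JJ_def using U by (simp add: n_subsets)
  \<comment> \<open>Composing on the right with a permutation that fixes \<open>X\<close> pointwise
    and takes \<open>J'\<close> to \<open>J\<close> embeds \<open>P J\<close> into
    \<open>P J'\<close>. Averaging over all \<open>J'\<close> then turns the position of
    \<open>J\<close> into a count of subsets.\<close>
  have PJ: "card (P J) \<le> card (P J')" if J': "J' \<in> JJ" for J'
  proof -
    obtain \<sigma> where \<sigma>: "\<sigma> permutes (U - X)" "\<sigma> ` J' = J"
      using ex_permutes_image[of "U - X" J' J] J J' U unfolding JJ_def by auto
    have \<sigma>U: "\<sigma> permutes U" using \<sigma>(1) by (rule permutes_subset) auto
    have "(\<lambda>\<pi>. \<pi> \<circ> \<sigma>) ` P J \<subseteq> P J'"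
    proof (intro image_subsetI)
      fix \<pi> assume \<pi>: "\<pi> \<in> P J"
      then have \<pi>U: "\<pi> permutes U" unfolding P_def by simp
      have "(\<pi> \<circ> \<sigma>) ` J' = \<pi> ` J" using \<sigma>(2) by (metis image_comp)
      then show "\<pi> \<circ> \<sigma> \<in> P J'"
        using \<pi> Q[OF \<pi>U \<sigma>(1)] F[OF \<pi>U \<sigma>(1)] permutes_compose[OF \<sigma>U \<pi>U] unfolding P_def by simp
    qed
    moreover have "inj_on (\<lambda>\<pi>. \<pi> \<circ> \<sigma>) (P J)"
    proof (rule inj_onI)
      fix \<pi> \<pi>' assume "\<pi> \<circ> \<sigma> = \<pi>' \<circ> \<sigma>"
      then have "(\<pi> \<circ> \<sigma>) \<circ> inv \<sigma> = (\<pi>' \<circ> \<sigma>) \<circ> inv \<sigma>" by simp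
      then show "\<pi> = \<pi>'" using permutes_inv_o(1)[OF \<sigma>U] by (simp add: comp_assoc)
    qed
    ultimately show ?thesis using finP by (intro card_inj_on_le[of "\<lambda>\<pi>. \<pi> \<circ> \<sigma>"])
  qed
  have "card (P J) * card JJ = (\<Sum>J'\<in>JJ. card (P J))" by simp
  also have "\<dots> \<le> (\<Sum>J'\<in>JJ. card (P J'))" using PJ by (intro sum_mono)
  also have "\<dots> = (\<Sum>J'\<in>JJ. \<Sum>\<pi>\<in>{\<pi>\<in>QQ. \<pi> ` J' \<in> F \<pi>}. 1)"
    unfolding P_def QQ_def by (simp add: conj_assoc)
  also have "\<dots> = (\<Sum>\<pi>\<in>QQ. \<Sum>J'\<in>{J'\<in>JJ. \<pi> ` J' \<in> F \<pi>}. 1)"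
    using finJ finQ by (rule sum.swap_restrict)
  also have "\<dots> \<le> (\<Sum>\<pi>\<in>QQ. M)"
  proof (intro sum_mono)
    fix \<pi> assume "\<pi> \<in> QQ"
    then have \<pi>: "\<pi> permutes U" unfolding QQ_def by simp
    have inj: "inj \<pi>" using \<pi> permutes_inj by blast
    have "(`) \<pi> ` {J'\<in>JJ. \<pi> ` J' \<in> F \<pi>} \<subseteq> {T. T \<subseteq> U - \<pi> ` X \<and> card T = b \<and> T \<in> F \<pi>}"
    proof (intro image_subsetI)
      fix J' assume J': "J' \<in> {J'\<in>JJ. \<pi> ` J' \<in> F \<pi>}"
      then have "\<pi> ` J' \<subseteq> \<pi> ` (U - X)" "card (\<pi> ` J') = b"
        using inj unfolding JJ_def by (auto simp: card_image inj_on_subset)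
      moreover have "\<pi> ` (U - X) = U - \<pi> ` X"
        using image_set_diff[OF inj] permutes_image[OF \<pi>] by simp
      ultimately show "\<pi> ` J' \<in> {T. T \<subseteq> U - \<pi> ` X \<and> card T = b \<and> T \<in> F \<pi>}" using J' by simp
    qed
    moreover have "inj_on ((`) \<pi>) {J'\<in>JJ. \<pi> ` J' \<in> F \<pi>}"
      using inj by (meson inj_image_eq_iff inj_onI)
    moreover have "finite {T. T \<subseteq> U - \<pi> ` X \<and> card T = b \<and> T \<in> F \<pi>}"
      by (rule finite_subset[of _ "Pow U"]) (use U in auto)
    ultimately have "card {J'\<in>JJ. \<pi> ` J' \<in> F \<pi>} \<le> card {T. T \<subseteq> U - \<pi> ` X \<and> card T = b \<and> T \<in> F \<pi>}"
      by (intro card_inj_on_le[of "(`) \<pi>"])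
    then show "(\<Sum>J'\<in>{J'\<in>JJ. \<pi> ` J' \<in> F \<pi>}. 1) \<le> M" using M[OF \<pi>] by simp
  qed
  also have "\<dots> = M * card QQ" by simp
  finally show ?thesis unfolding cJ P_def QQ_def .
qed

text \<open>The chain rule: expose the blocks one after the other. After \<open>i\<close> of them, b
  * i points are gone, the next block is uniform among the remaining \<open>b\<close>-sets, and at
  most \<open>M\<close> of these are hits; the last hypothesis bounds each conditional probability
  by \<beta>. As \<open>F\<close> depends on \<pi> only through its values on \<open>X\<close>,
  exposure does not change it.\<close>

lemma permutation_blocks_bound:
  fixes \<beta> :: real and Jb :: "'i \<Rightarrow> 'a set"
  assumes U: "finite U" and X: "X \<subseteq> U" and \<beta>: "\<beta> \<ge> 0"
    and F: "\<And>\<pi> \<sigma>. \<pi> permutes U \<Longrightarrow> \<sigma> permutes (U - X) \<Longrightarrow> F (\<pi> \<circ> \<sigma>) = F \<pi>"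
    and M: "\<And>\<pi>. \<pi> permutes U \<Longrightarrow> card {T. T \<subseteq> U - \<pi> ` X \<and> card T = b \<and> T \<in> F \<pi>} \<le> M"
    and "finite K" and "\<And>j. j \<in> K \<Longrightarrow> Jb j \<subseteq> U - X \<and> card (Jb j) = b"
    and "\<And>j j'. j \<in> K \<Longrightarrow> j' \<in> K \<Longrightarrow> j \<noteq> j' \<Longrightarrow> Jb j \<inter> Jb j' = {}"
    and "\<And>i. i < card K \<Longrightarrow> real M \<le> \<beta> * real ((card (U - X) - b * i) choose b)"
  shows "real (card {\<pi>. \<pi> permutes U \<and> (\<forall>j\<in>K. \<pi> ` Jb j \<in> F \<pi>)}) \<le> \<beta> ^ card K * fact (card U)"
  using assms(6-)
proof (induction K rule: finite_induct)
  case empty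
  then show ?case using U by (simp add: card_permutations)
next
  case (insert j K)
  define Y where "Y = X \<union> (\<Union>l\<in>K. Jb l)"
  define Q where "Q \<pi> \<longleftrightarrow> (\<forall>l\<in>K. \<pi> ` Jb l \<in> F \<pi>)" for \<pi>
  have Y: "Y \<subseteq> U" unfolding Y_def using X insert.prems(1) by auto
  have jY: "Jb j \<subseteq> U - Y"
    unfolding Y_def using insert.prems(1)[of j] insert.prems(2)[of j] insert.hyps by auto
  have cUY: "card (U - Y) = card (U - X) - b * card K"
  proof -
    have "card (\<Union>l\<in>K. Jb l) = (\<Sum>l\<in>K. card (Jb l))"
      using insert.hyps insert.prems(1,2) U
      by (intro card_UN_disjoint) (auto intro: finite_subset)
    also have "\<dots> = b * card K" using insert.prems(1) by simp
    finally have c: "card (\<Union>l\<in>K. Jb l) = b * card K" .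
    have "U - Y = (U - X) - (\<Union>l\<in>K. Jb l)" unfolding Y_def by auto
    moreover have sub: "(\<Union>l\<in>K. Jb l) \<subseteq> U - X" using insert.prems(1) by auto
    moreover have "finite (\<Union>l\<in>K. Jb l)" by (rule finite_subset[OF sub]) (use U in simp)
    ultimately show ?thesis using c by (simp add: card_Diff_subset)
  qed
  have sub: "\<sigma> permutes (U - X)" if "\<sigma> permutes (U - Y)" for \<sigma>
    using that by (rule permutes_subset) (auto simp: Y_def)
  have F': "F (\<pi> \<circ> \<sigma>) = F \<pi>" if "\<pi> permutes U" "\<sigma> permutes (U - Y)" for \<pi> \<sigma>
    using F[OF that(1) sub[OF that(2)]] .
  have Q: "Q (\<pi> \<circ> \<sigma>) = Q \<pi>" if "\<pi> permutes U" "\<sigma> permutes (U - Y)" for \<pi> \<sigma>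
  proof -
    have "(\<pi> \<circ> \<sigma>) ` Jb l = \<pi> ` Jb l" if l: "l \<in> K" for l
    proof -
      have "\<sigma> x = x" if "x \<in> Jb l" for x
        using \<open>\<sigma> permutes (U - Y)\<close> l that permutes_not_in[of \<sigma> "U - Y" x] unfolding Y_def by auto
      then show ?thesis by auto
    qed
    then show ?thesis unfolding Q_def using F'[OF that] by auto
  qed
  have M': "card {T. T \<subseteq> U - \<pi> ` Y \<and> card T = b \<and> T \<in> F \<pi>} \<le> M" if "\<pi> permutes U" for \<pi>
  proof -
    have "card {T. T \<subseteq> U - \<pi> ` Y \<and> card T = b \<and> T \<in> F \<pi>} \<le> card {T. T \<subseteq> U - \<pi> ` X \<and> card T = b \<and> T \<in> F \<pi>}"
      using U by (intro card_mono finite_subset[of "{T. T \<subseteq> U - \<pi> ` X \<and> card T = b \<and> T \<in> F \<pi>}" "Pow U"])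
        (auto simp: Y_def)
    then show ?thesis using M[OF that] by simp
  qed
  let ?C = "card (U - Y) choose b"
  let ?new = "{\<pi>. \<pi> permutes U \<and> (\<forall>l\<in>insert j K. \<pi> ` Jb l \<in> F \<pi>)}"
  let ?old = "{\<pi>. \<pi> permutes U \<and> (\<forall>l\<in>K. \<pi> ` Jb l \<in> F \<pi>)}"
  have "b \<le> card (U - Y)" using card_mono[OF _ jY] U insert.prems(1)[of j] by simp
  then have C: "?C > 0" by simp
  have "card {\<pi>. \<pi> permutes U \<and> Q \<pi> \<and> \<pi> ` Jb j \<in> F \<pi>} * ?C \<le> M * card {\<pi>. \<pi> permutes U \<and> Q \<pi>}"
    using insert.prems(1)[of j] by (intro permutation_block_average U Y jY Q F' M') auto
  moreover have "{\<pi>. \<pi> permutes U \<and> Q \<pi> \<and> \<pi> ` Jb j \<in> F \<pi>} = ?new" unfolding Q_def by auto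
  ultimately have "card ?new * ?C \<le> M * card ?old" unfolding Q_def by simp
  then have "real (card ?new * ?C) \<le> real (M * card ?old)" by (simp only: of_nat_le_iff)
  then have "real (card ?new) * real ?C \<le> real M * real (card ?old)" by (simp only: of_nat_mult)
  also have "\<dots> \<le> (\<beta> * real ?C) * (\<beta> ^ card K * fact (card U))"
  proof (intro mult_mono)
    show "real M \<le> \<beta> * real ?C"
      using insert.prems(3)[of "card K"] insert.hyps unfolding cUY by simp
    show "real (card ?old) \<le> \<beta> ^ card K * fact (card U)"
      using insert.prems insert.hyps by (intro insert.IH) auto
  qed (use \<beta> in auto)
  finally have "real (card ?new) * real ?C \<le> (\<beta> ^ card (insert j K) * fact (card U)) * real ?C"
    using insert.hyps by (simp add: mult_ac)
  then show ?case using C by (simp add: mult_le_cancel_right)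
qed

text \<open>A given point lies in a fraction b / N of the \<open>b\<close>-sets; delete
  \<open>d\<close> points and add up the losses.\<close>

lemma binomial_shrink:
  assumes "b > 0" "d \<le> N"
  shows "(1 - real d * real b / real N) * real (N choose b) \<le> real ((N - d) choose b)"
proof -
  have step: "N choose b \<le> ((N - d) choose b) + d * ((N - 1) choose (b - 1))" using assms(2)
  proof (induction d)
    case (Suc d)
    have "(N - d) choose b = ((N - Suc d) choose (b - 1)) + ((N - Suc d) choose b)"
      using choose_reduce_nat[of "N - d" b] Suc.prems assms(1) by simp
    moreover have "(N - Suc d) choose (b - 1) \<le> (N - 1) choose (b - 1)"
      by (intro binomial_right_mono) auto
    ultimately show ?case using Suc by simp
  qed simp
  show ?thesis
  proof (cases "N = 0")
    case False
    have "real b * real (N choose b) = real N * real ((N - 1) choose (b - 1))"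
      using arg_cong[OF times_binomial_minus1_eq[OF assms(1), of N], of real] by simp
    then have "real d * real ((N - 1) choose (b - 1)) = real d * real b / real N * real (N choose b)"
      using False by (simp add: field_simps)
    moreover have "real (N choose b) \<le> real ((N - d) choose b) + real d * real ((N - 1) choose (b - 1))"
      using of_nat_mono[OF step, where 'a = real] by simp
    ultimately show ?thesis by (simp add: algebra_simps)
  qed (use assms in simp)
qed

text \<open>The right-hand side is the product of z, z - 1, ..., z - r + 1, each factor being at
  least z - r. For r > z the left-hand side is 0 because then r > 0.\<close>

lemma falling_power_le_binomial: "(z - r) ^ r \<le> (z choose r) * fact r" for z r :: nat
proof (cases "r \<le> z")
  case True
  have "(z - r) ^ i \<le> (z choose i) * fact i" if "i \<le> r" for i
    using that
  proof (induction i)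
    case (Suc i)
    have "(z - r) ^ Suc i \<le> (z - i) * ((z choose i) * fact i)"
      unfolding power_Suc using Suc by (intro mult_mono) auto
    also have "\<dots> = (z choose Suc i) * fact (Suc i)"
    proof -
      have "(z - i) * (z choose i) = Suc i * (z choose Suc i)"
        by (metis binomial_absorb_comp binomial_absorption)
      then show ?thesis by (simp add: algebra_simps)
    qed
    finally show ?case .
  qed simp
  then show ?thesis by blast
qed (auto simp: power_0_left)

text \<open>The concentration comes from the \<open>r\<close>-th factorial moment of the number of hits, with
  \<open>r\<close> a small multiple of \<open>\<tau>\<nu>\<close>: the events for \<open>r\<close> blocks are almost negatively correlated.\<close>

lemma permutation_blocks_tail:
  fixes \<alpha> \<tau> :: real and Jb :: "nat \<Rightarrow> 'a set"
  assumes U: "finite U" and X: "X \<subseteq> U" and \<alpha>: "0 \<le> \<alpha>" "\<alpha> \<le> 1" and \<tau>: "0 < \<tau>" "\<tau> \<le> 1" and b: "b > 0"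
    and F: "\<And>\<pi> \<sigma>. \<pi> permutes U \<Longrightarrow> \<sigma> permutes (U - X) \<Longrightarrow> F (\<pi> \<circ> \<sigma>) = F \<pi>"
    and M: "\<And>\<pi>. \<pi> permutes U \<Longrightarrow>
      real (card {T. T \<subseteq> U - \<pi> ` X \<and> card T = b \<and> T \<in> F \<pi>}) \<le> \<alpha> * real (card (U - X) choose b)"
    and J: "\<And>j. j < \<nu> \<Longrightarrow> Jb j \<subseteq> U - X \<and> card (Jb j) = b"
    and disj: "\<And>j j'. j < \<nu> \<Longrightarrow> j' < \<nu> \<Longrightarrow> j \<noteq> j' \<Longrightarrow> Jb j \<inter> Jb j' = {}"
    and \<nu>: "\<nu> > 0" and r: "2 * real r \<le> \<tau> * real \<nu>" "16 * (real b)\<^sup>2 * real r \<le> \<tau> * real (card (U - X))"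
  shows "real (card {\<pi>. \<pi> permutes U \<and> real (card {j. j < \<nu> \<and> \<pi> ` Jb j \<in> F \<pi>}) \<ge> (\<alpha> + \<tau>) * real \<nu>})
    \<le> (1 / (1 + \<tau> / 4)) ^ r * fact (card U)"
proof -
  define N where "N = card (U - X)"
  \<comment> \<open>A hit has probability at most \<alpha> at first. Fewer than b * r points are
    gone when a block is exposed, so by the bound on \<open>r\<close> the number of available
    \<open>b\<close>-sets keeps at least the fraction 1 - \<tau> / 16.\<close>
  define \<beta> where "\<beta> = \<alpha> / (1 - \<tau> / 16)"
  define Z where "Z \<pi> = {j. j < \<nu> \<and> \<pi> ` Jb j \<in> F \<pi>}" for \<pi>
  define PP where "PP = {\<pi>. \<pi> permutes U}"
  define Bad where "Bad = {\<pi>\<in>PP. real (card (Z \<pi>)) \<ge> (\<alpha> + \<tau>) * real \<nu>}"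
  define z where "z = nat \<lceil>(\<alpha> + \<tau>) * real \<nu>\<rceil>"
  have z: "real z \<ge> (\<alpha> + \<tau>) * real \<nu>" unfolding z_def by (simp add: real_nat_ceiling_ge)
  have finPP: "finite PP" unfolding PP_def using U by (rule finite_permutations)
  have finZ: "finite (Z \<pi>)" for \<pi> unfolding Z_def by simp
  have \<beta>0: "\<beta> \<ge> 0" unfolding \<beta>_def using \<alpha> \<tau> by simp
  have K: "real (card {\<pi>\<in>PP. K \<subseteq> Z \<pi>}) \<le> \<beta> ^ r * fact (card U)"
    if K: "K \<subseteq> {..<\<nu>}" "card K = r" for K
  proof -
    define M0 where "M0 = nat \<lfloor>\<alpha> * real (N choose b)\<rfloor>"
    have "card {T. T \<subseteq> U - \<pi> ` X \<and> card T = b \<and> T \<in> F \<pi>} \<le> M0" if "\<pi> permutes U" for \<pi>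
      using M[OF that] unfolding M0_def N_def by (simp add: le_nat_floor)
    moreover have "real M0 \<le> \<beta> * real ((N - b * i) choose b)" if i: "i < r" for i
    proof -
      have N: "real N > 0"
      proof -
        have "16 * (real b)\<^sup>2 * real r > 0" using b i by simp
        then have "0 < \<tau> * real N" using r(2) unfolding N_def by linarith
        then show ?thesis using \<tau> by (simp add: zero_less_mult_iff)
      qed
      have "real (b * i) * real b \<le> (real b)\<^sup>2 * real r"
        using i mult_left_mono[of "real i" "real r" "(real b)\<^sup>2"] by (simp add: power2_eq_square mult_ac)
      then have db: "real (b * i) * real b \<le> \<tau> / 16 * real N" using r(2) unfolding N_def by linarith
      have "real (b * i) \<le> real (b * i) * real b" using b mult_left_mono[of 1 "real b" "real (b * i)"] by simp
      also have "\<dots> \<le> 1 * real N" using db \<tau> N by (intro order_trans[OF db] mult_right_mono) auto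
      finally have le: "b * i \<le> N" by linarith
      have "1 - \<tau> / 16 \<le> 1 - real (b * i) * real b / real N"
        using db N by (simp add: field_simps)
      then have "(1 - \<tau> / 16) * real (N choose b) \<le> (1 - real (b * i) * real b / real N) * real (N choose b)"
        by (intro mult_right_mono) auto
      also have "\<dots> \<le> real ((N - b * i) choose b)" by (rule binomial_shrink[OF b le])
      finally have "\<beta> * ((1 - \<tau> / 16) * real (N choose b)) \<le> \<beta> * real ((N - b * i) choose b)"
        using \<beta>0 by (intro mult_left_mono) auto
      moreover have "\<beta> * ((1 - \<tau> / 16) * real (N choose b)) = \<alpha> * real (N choose b)"
        unfolding \<beta>_def using \<tau> by simp
      moreover have "real M0 \<le> \<alpha> * real (N choose b)"
        unfolding M0_def using \<alpha> by (intro of_nat_floor) auto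
      ultimately show ?thesis by linarith
    qed
    ultimately have "real (card {\<pi>. \<pi> permutes U \<and> (\<forall>j\<in>K. \<pi> ` Jb j \<in> F \<pi>)}) \<le> \<beta> ^ card K * fact (card U)"
      using K J disj finite_subset[OF K(1)]
      by (intro permutation_blocks_bound[OF U X \<beta>0 F, where M = M0 and b = b]) (auto simp: N_def subset_iff)
    moreover have "{\<pi>. \<pi> permutes U \<and> (\<forall>j\<in>K. \<pi> ` Jb j \<in> F \<pi>)} = {\<pi>\<in>PP. K \<subseteq> Z \<pi>}"
      using K(1) unfolding PP_def Z_def by auto
    ultimately show ?thesis using K(2) by simp
  qed
  \<comment> \<open>Markov's inequality for the number of \<open>r\<close>-sets of hits, which is
    afterwards counted by fixing the \<open>r\<close>-set first.\<close>
  have "real (z choose r) * real (card Bad) = (\<Sum>\<pi>\<in>Bad. real (z choose r))" by simp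
  also have "\<dots> \<le> (\<Sum>\<pi>\<in>Bad. real (card (Z \<pi>) choose r))"
  proof (intro sum_mono)
    fix \<pi> assume "\<pi> \<in> Bad"
    then have "(\<alpha> + \<tau>) * real \<nu> \<le> real (card (Z \<pi>))" unfolding Bad_def by simp
    then have "z \<le> card (Z \<pi>)" unfolding z_def by (simp add: ceiling_le_iff)
    then show "real (z choose r) \<le> real (card (Z \<pi>) choose r)" by (simp add: binomial_right_mono)
  qed
  also have "\<dots> \<le> (\<Sum>\<pi>\<in>PP. real (card (Z \<pi>) choose r))"
    using finPP unfolding Bad_def by (intro sum_mono2) auto
  also have "\<dots> = (\<Sum>\<pi>\<in>PP. \<Sum>K\<in>{K\<in>{K. K \<subseteq> {..<\<nu>} \<and> card K = r}. K \<subseteq> Z \<pi>}. 1)"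
  proof (intro sum.cong refl)
    fix \<pi>
    have "{K\<in>{K. K \<subseteq> {..<\<nu>} \<and> card K = r}. K \<subseteq> Z \<pi>} = {K. K \<subseteq> Z \<pi> \<and> card K = r}"
      unfolding Z_def by auto
    then show "real (card (Z \<pi>) choose r) = (\<Sum>K\<in>{K\<in>{K. K \<subseteq> {..<\<nu>} \<and> card K = r}. K \<subseteq> Z \<pi>}. 1)"
      using n_subsets[OF finZ, of \<pi> r] by simp
  qed
  also have "\<dots> = (\<Sum>K\<in>{K. K \<subseteq> {..<\<nu>} \<and> card K = r}. \<Sum>\<pi>\<in>{\<pi>\<in>PP. K \<subseteq> Z \<pi>}. 1)"
    using finPP by (intro sum.swap_restrict) auto
  also have "\<dots> \<le> (\<Sum>K\<in>{K. K \<subseteq> {..<\<nu>} \<and> card K = r}. \<beta> ^ r * fact (card U))"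
    using K by (intro sum_mono) auto
  also have "\<dots> = real (\<nu> choose r) * (\<beta> ^ r * fact (card U))"
    by (simp add: n_subsets)
  finally have 1: "real (z choose r) * real (card Bad) \<le> real (\<nu> choose r) * (\<beta> ^ r * fact (card U))" .
  \<comment> \<open>Half of the excess \<tau> \<nu> pays for replacing the falling factorial by a
    power, since r \<le> \<tau> \<nu> / 2; with the other half, \<open>w\<close> still exceeds
    \<beta> \<nu> by a factor of at least 1 + \<tau> / 4.\<close>
  define w where "w = (\<alpha> + \<tau> / 2) * real \<nu>"
  have w0: "w > 0" unfolding w_def using \<alpha> \<tau> \<nu> by (simp add: add_nonneg_pos)
  have wz: "w \<le> real (z - r)"
  proof -
    have "w \<le> (\<alpha> + \<tau>) * real \<nu> - real r" unfolding w_def using r(1) by (simp add: algebra_simps)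
    then show ?thesis using z by linarith
  qed
  have "w ^ r * real (card Bad) \<le> real (z choose r) * fact r * real (card Bad)"
  proof (intro mult_right_mono)
    have "w ^ r \<le> real (z - r) ^ r" using wz w0 by (intro power_mono) auto
    also have "\<dots> \<le> real ((z choose r) * fact r)"
      using of_nat_mono[OF falling_power_le_binomial[of z r], where 'a = real] by simp
    finally show "w ^ r \<le> real (z choose r) * fact r" by simp
  qed auto
  also have "\<dots> \<le> real (\<nu> choose r) * fact r * (\<beta> ^ r * fact (card U))"
    using mult_left_mono[OF 1, of "fact r"] by (simp add: mult_ac)
  also have "\<dots> \<le> real \<nu> ^ r * (\<beta> ^ r * fact (card U))"
  proof (intro mult_right_mono)
    have "real ((\<nu> choose r) * fact r) \<le> real (\<nu> ^ r)"
      using binomial_fact_pow[of \<nu> r] of_nat_le_iff by blast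
    then show "real (\<nu> choose r) * fact r \<le> real \<nu> ^ r" by simp
  qed (use \<beta>0 in auto)
  also have "\<dots> = (real \<nu> * \<beta>) ^ r * fact (card U)" by (simp add: power_mult_distrib)
  also have "\<dots> \<le> (w * (1 / (1 + \<tau> / 4))) ^ r * fact (card U)"
  proof (intro mult_right_mono power_mono)
    have "\<alpha> * \<tau> \<le> 1 * \<tau>" "\<tau> * \<tau> \<le> 1 * \<tau>" using \<alpha> \<tau> by (intro mult_right_mono; simp)+
    moreover have "(\<alpha> + \<tau> / 2) * (1 - \<tau> / 16) - \<alpha> * (1 + \<tau> / 4) = \<tau> / 2 - 5 / 16 * (\<alpha> * \<tau>) - \<tau> * \<tau> / 32"
      by (simp add: field_simps)
    ultimately have "\<alpha> * (1 + \<tau> / 4) \<le> (\<alpha> + \<tau> / 2) * (1 - \<tau> / 16)" using \<tau> by linarith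
    then have "\<beta> \<le> (\<alpha> + \<tau> / 2) * (1 / (1 + \<tau> / 4))" unfolding \<beta>_def using \<tau> by (simp add: field_simps)
    then have "real \<nu> * \<beta> \<le> real \<nu> * ((\<alpha> + \<tau> / 2) * (1 / (1 + \<tau> / 4)))" by (intro mult_left_mono) auto
    then show "real \<nu> * \<beta> \<le> w * (1 / (1 + \<tau> / 4))" unfolding w_def by (simp add: mult_ac)
  qed (use \<beta>0 in auto)
  also have "\<dots> = w ^ r * ((1 / (1 + \<tau> / 4)) ^ r * fact (card U))" by (simp only: power_mult_distrib mult_ac)
  finally have "real (card Bad) \<le> (1 / (1 + \<tau> / 4)) ^ r * fact (card U)"
    using w0 by (simp only: mult_le_cancel_left_pos zero_less_power)
  then show ?thesis unfolding Bad_def PP_def Z_def by simp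
qed

section \<open>First-moment arguments\<close>

lemma sum_less_imp_ex_less:
  fixes w :: "'a \<Rightarrow> real" and t :: real
  assumes "sum w X < t * card X"
  shows "\<exists>x\<in>X. w x < t"
proof (rule ccontr)
  assume "\<not> ?thesis"
  then have "(\<Sum>x\<in>X. t) \<le> sum w X" by (intro sum_mono) (auto simp: not_less)
  then show False using assms by (simp add: mult.commute)
qed

text \<open>Chernoff and union bound in one: draw \<open>R\<close> elements of \<Omega>
  independently, repetitions allowed, and average the sum over all edges of 1 + \<eta> raised to the
  number of covers. Each draw contributes a mean factor of at most 1 + \<eta> \<rho>, whereas an
  edge covered more than \<Lambda> times would alone contribute (1 + \<eta>)^(\<Lambda> +
  1).\<close>

lemma exists_sample_bounded_cover:
  fixes \<eta> \<rho> :: real and Cov :: "'e \<Rightarrow> 'w set"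
  assumes \<Omega>: "finite \<Omega>" "\<Omega> \<noteq> {}" and E: "finite E" and \<eta>: "\<eta> > 0" and \<rho>: "\<rho> \<ge> 0"
    and cov: "\<And>e. e \<in> E \<Longrightarrow> real (card (\<Omega> \<inter> Cov e)) \<le> \<rho> * real (card \<Omega>)"
    and small: "real (card E) * (1 + \<eta> * \<rho>) ^ R < (1 + \<eta>) ^ Suc \<Lambda>"
  shows "\<exists>g. (\<forall>i<R. g i \<in> \<Omega>) \<and> (\<forall>e\<in>E. card {i. i < R \<and> g i \<in> Cov e} \<le> \<Lambda>)"
proof -
  define h where "h e \<omega> = (if \<omega> \<in> Cov e then 1 + \<eta> else 1)" for e \<omega>
  define X where "X = (\<Pi>\<^sub>E i\<in>{..<R}. \<Omega>)"
  have cX: "real (card X) = real (card \<Omega>) ^ R" unfolding X_def by (simp add: card_PiE)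
  have O: "real (card \<Omega>) > 0" using \<Omega> by (simp add: card_gt_0_iff)
  have "(\<Sum>g\<in>X. \<Sum>e\<in>E. \<Prod>i<R. h e (g i)) = (\<Sum>e\<in>E. \<Sum>g\<in>X. \<Prod>i<R. h e (g i))"
    by (rule sum.swap)
  also have "\<dots> = (\<Sum>e\<in>E. \<Prod>i<R. \<Sum>\<omega>\<in>\<Omega>. h e \<omega>)"
    unfolding X_def using \<Omega> by (intro sum.cong refl prod_sum_PiE[symmetric]) auto
  also have "\<dots> \<le> (\<Sum>e\<in>E. (real (card \<Omega>) * (1 + \<eta> * \<rho>)) ^ R)"
  proof (intro sum_mono)
    fix e assume e: "e \<in> E"
    have "(\<Sum>\<omega>\<in>\<Omega>. h e \<omega>) = (\<Sum>\<omega>\<in>\<Omega>. 1 + (if \<omega> \<in> Cov e then \<eta> else 0))"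
      unfolding h_def by (intro sum.cong) auto
    also have "\<dots> = real (card \<Omega>) + \<eta> * real (card (\<Omega> \<inter> Cov e))"
      using \<Omega> by (simp add: sum.distrib sum.If_cases)
    also have "\<dots> \<le> real (card \<Omega>) + \<eta> * (\<rho> * real (card \<Omega>))"
      using cov[OF e] \<eta> by (intro add_left_mono mult_left_mono) auto
    finally have "(\<Sum>\<omega>\<in>\<Omega>. h e \<omega>) \<le> real (card \<Omega>) * (1 + \<eta> * \<rho>)" by (simp add: algebra_simps)
    moreover have "0 \<le> (\<Sum>\<omega>\<in>\<Omega>. h e \<omega>)" unfolding h_def using \<eta> by (intro sum_nonneg) auto
    ultimately show "(\<Prod>i<R. \<Sum>\<omega>\<in>\<Omega>. h e \<omega>) \<le> (real (card \<Omega>) * (1 + \<eta> * \<rho>)) ^ R"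
      by (simp add: power_mono)
  qed
  also have "\<dots> = real (card \<Omega>) ^ R * (real (card E) * (1 + \<eta> * \<rho>) ^ R)"
    by (simp add: power_mult_distrib mult_ac)
  also have "\<dots> < real (card \<Omega>) ^ R * (1 + \<eta>) ^ Suc \<Lambda>"
    using small O by (intro mult_strict_left_mono) auto
  finally have "\<exists>g\<in>X. (\<Sum>e\<in>E. \<Prod>i<R. h e (g i)) < (1 + \<eta>) ^ Suc \<Lambda>"
    by (intro sum_less_imp_ex_less) (simp only: cX mult.commute)
  then obtain g where g: "g \<in> X" "(\<Sum>e\<in>E. \<Prod>i<R. h e (g i)) < (1 + \<eta>) ^ Suc \<Lambda>" by blast
  have "card {i. i < R \<and> g i \<in> Cov e} \<le> \<Lambda>" if e: "e \<in> E" for e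
  proof -
    have "(1 + \<eta>) ^ card {i. i < R \<and> g i \<in> Cov e} = (\<Prod>i<R. h e (g i))"
      unfolding h_def by (simp add: prod.If_cases Int_def)
    also have "\<dots> \<le> (\<Sum>e\<in>E. \<Prod>i<R. h e (g i))"
      using e E \<eta> by (intro member_le_sum) (auto simp: h_def intro!: prod_nonneg)
    also have "\<dots> < (1 + \<eta>) ^ Suc \<Lambda>" by (rule g(2))
    finally have "card {i. i < R \<and> g i \<in> Cov e} < Suc \<Lambda>" using \<eta> by (intro power_less_imp_less_exp[of "1 + \<eta>"]) auto
    then show ?thesis by simp
  qed
  moreover have "g i \<in> \<Omega>" if "i < R" for i using g(1) that unfolding X_def by auto
  ultimately show ?thesis by blast
qed

section \<open>Lower tails for random colourings\<close>

text \<open>Multiplied by 1 + x + x^2 / 2, the right-hand side becomes 1 + x^4 / 4, and exp x is at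
  least that multiplier. It serves as 1 - exp (-\<eta>) \<ge> \<eta> - \<eta>^2 / 2 in the lower
  tail.\<close>

lemma exp_minus_le_quadratic:
  fixes x :: real
  assumes "x \<ge> 0"
  shows "exp (- x) \<le> 1 - x + x\<^sup>2 / 2"
proof -
  have pos: "0 < 1 + x + x\<^sup>2 / 2" using assms by (simp add: add_pos_nonneg)
  have "1 \<le> (1 - x + x\<^sup>2 / 2) * (1 + x + x\<^sup>2 / 2)"
  proof -
    have "(1 - x + x\<^sup>2 / 2) * (1 + x + x\<^sup>2 / 2) = 1 + (x\<^sup>2 / 2)\<^sup>2"
      by (simp add: algebra_simps power2_eq_square)
    then show ?thesis by simp
  qed
  then have "1 / (1 + x + x\<^sup>2 / 2) \<le> 1 - x + x\<^sup>2 / 2" using pos by (simp add: pos_divide_le_eq)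
  moreover have "exp (- x) \<le> 1 / (1 + x + x\<^sup>2 / 2)"
    unfolding exp_minus inverse_eq_divide
    using exp_lower_Taylor_quadratic[OF assms] pos by (intro divide_left_mono) auto
  ultimately show ?thesis by linarith
qed

text \<open>A uniform colour agrees with a prescribed one with probability 1 / \<Lambda>. Classes
  may overlap and prescribe different colours for the same element: each has its own exponential
  moment, and only the sum of these has to stay below 1.\<close>

lemma exists_colouring_large_classes:
  fixes \<eta> :: real and Fs :: "'k \<Rightarrow> 'e set" and col :: "'k \<Rightarrow> 'e \<Rightarrow> nat"
  assumes E: "finite E" and \<Lambda>: "\<Lambda> > 0" and \<eta>: "\<eta> > 0"
    and Fs: "\<And>\<kappa>. \<kappa> \<in> K \<Longrightarrow> Fs \<kappa> \<subseteq> E" and col: "\<And>\<kappa> e. \<kappa> \<in> K \<Longrightarrow> e \<in> Fs \<kappa> \<Longrightarrow> col \<kappa> e < \<Lambda>"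
    and K: "finite K"
    and small: "(\<Sum>\<kappa>\<in>K. exp (- (\<eta>\<^sup>2 * real (card (Fs \<kappa>)) / (2 * real \<Lambda>)))) < 1"
  shows "\<exists>c. \<forall>\<kappa>\<in>K. (1 - \<eta>) * real (card (Fs \<kappa>)) / real \<Lambda> \<le> real (card {e\<in>Fs \<kappa>. c e = col \<kappa> e})"
proof -
  define h where "h \<kappa> e l = (if e \<in> Fs \<kappa> \<and> l = col \<kappa> e then exp (- \<eta>) else 1)" for \<kappa> e l
  \<comment> \<open>Normalised so that a class with fewer than (1 - \<eta>) |F| / \<Lambda>
    agreements has weight above 1.\<close>
  define a where "a \<kappa> = exp (\<eta> * ((1 - \<eta>) * real (card (Fs \<kappa>)) / real \<Lambda>))" for \<kappa>
  define X where "X = (\<Pi>\<^sub>E e\<in>E. {..<\<Lambda>})"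
  have L: "real \<Lambda> > 0" using \<Lambda> by simp
  have cX: "real (card X) = real \<Lambda> ^ card E" unfolding X_def using E by (simp add: card_PiE)
  have each: "(\<Sum>c\<in>X. a \<kappa> * (\<Prod>e\<in>E. h \<kappa> e (c e)))
      \<le> exp (- (\<eta>\<^sup>2 * real (card (Fs \<kappa>)) / (2 * real \<Lambda>))) * real (card X)" if \<kappa>: "\<kappa> \<in> K" for \<kappa>
  proof -
    define f where "f = real (card (Fs \<kappa>))"
    define q where "q = (1 - exp (- \<eta>)) / real \<Lambda>"
    have "(\<Sum>c\<in>X. \<Prod>e\<in>E. h \<kappa> e (c e)) = (\<Prod>e\<in>E. \<Sum>l<\<Lambda>. h \<kappa> e l)"
      unfolding X_def using E by (intro prod_sum_PiE[symmetric]) auto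
    also have "\<dots> = (\<Prod>e\<in>E. real \<Lambda> * (if e \<in> Fs \<kappa> then 1 - q else 1))"
    proof (intro prod.cong refl)
      fix e
      show "(\<Sum>l<\<Lambda>. h \<kappa> e l) = real \<Lambda> * (if e \<in> Fs \<kappa> then 1 - q else 1)"
      proof (cases "e \<in> Fs \<kappa>")
        case True
        have "(\<Sum>l<\<Lambda>. h \<kappa> e l) = (\<Sum>l<\<Lambda>. 1 - (if l = col \<kappa> e then 1 - exp (- \<eta>) else 0))"
          unfolding h_def using True by (intro sum.cong) auto
        also have "\<dots> = real \<Lambda> - (1 - exp (- \<eta>))"
          using col[OF \<kappa> True] by (simp add: sum_subtractf)
        moreover have "real \<Lambda> * q = 1 - exp (- \<eta>)" using L by (simp add: q_def)
        ultimately show ?thesis using True by (simp add: right_diff_distrib)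
      qed (simp add: h_def)
    qed
    also have "\<dots> = real \<Lambda> ^ card E * (1 - q) ^ card (Fs \<kappa>)"
      using Fs[OF \<kappa>] E by (simp add: prod.distrib prod.If_cases Int_absorb1 del: mult_cancel_left)
    finally have 1: "(\<Sum>c\<in>X. \<Prod>e\<in>E. h \<kappa> e (c e)) = real (card X) * (1 - q) ^ card (Fs \<kappa>)"
      unfolding cX .
    have "q \<le> 1"
    proof -
      have "1 - exp (- \<eta>) \<le> real \<Lambda>" using \<Lambda> by (smt (verit) exp_gt_zero of_nat_1 of_nat_mono Suc_leI One_nat_def)
      then show ?thesis unfolding q_def using L by simp
    qed
    then have "(1 - q) ^ card (Fs \<kappa>) \<le> exp (- q) ^ card (Fs \<kappa>)"
      using exp_ge_add_one_self[of "- q"] by (intro power_mono) auto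
    also have "\<dots> = exp (- (q * f))" unfolding f_def by (simp add: exp_of_nat_mult[symmetric] mult.commute)
    finally have 2: "(1 - q) ^ card (Fs \<kappa>) \<le> exp (- (q * f))" .
    \<comment> \<open>The second-order loss \<eta>^2 / 2 uses up only half of the \<eta>^2 freed by
      the factor 1 - \<eta> in the target; the other half is the exponent of the tail.\<close>
    have "(\<eta> - \<eta>\<^sup>2 / 2) / real \<Lambda> \<le> q"
      unfolding q_def using exp_minus_le_quadratic[of \<eta>] \<eta> L by (intro divide_right_mono) auto
    then have "(\<eta> - \<eta>\<^sup>2 / 2) / real \<Lambda> * f \<le> q * f" by (intro mult_right_mono) (auto simp: f_def)
    moreover have "(\<eta> - \<eta>\<^sup>2 / 2) / real \<Lambda> * f = \<eta> * ((1 - \<eta>) * f / real \<Lambda>) + \<eta>\<^sup>2 * f / (2 * real \<Lambda>)"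
      using L by (simp add: field_simps power2_eq_square)
    ultimately have 3: "\<eta> * ((1 - \<eta>) * f / real \<Lambda>) + - (q * f) \<le> - (\<eta>\<^sup>2 * f / (2 * real \<Lambda>))" by linarith
    have "(\<Sum>c\<in>X. a \<kappa> * (\<Prod>e\<in>E. h \<kappa> e (c e))) = real (card X) * (a \<kappa> * (1 - q) ^ card (Fs \<kappa>))"
      by (simp add: sum_distrib_left[symmetric] 1)
    also have "\<dots> \<le> real (card X) * (a \<kappa> * exp (- (q * f)))"
      using 2 by (intro mult_left_mono) (auto simp: a_def)
    also have "\<dots> = real (card X) * exp (\<eta> * ((1 - \<eta>) * f / real \<Lambda>) + - (q * f))"
      unfolding a_def f_def exp_add ..
    also have "\<dots> \<le> real (card X) * exp (- (\<eta>\<^sup>2 * f / (2 * real \<Lambda>)))"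
      using 3 by (intro mult_left_mono) auto
    finally show ?thesis unfolding f_def by (simp add: mult.commute)
  qed
  have "(\<Sum>c\<in>X. \<Sum>\<kappa>\<in>K. a \<kappa> * (\<Prod>e\<in>E. h \<kappa> e (c e))) = (\<Sum>\<kappa>\<in>K. \<Sum>c\<in>X. a \<kappa> * (\<Prod>e\<in>E. h \<kappa> e (c e)))"
    by (rule sum.swap)
  also have "\<dots> \<le> (\<Sum>\<kappa>\<in>K. exp (- (\<eta>\<^sup>2 * real (card (Fs \<kappa>)) / (2 * real \<Lambda>))) * real (card X))"
    using each by (intro sum_mono)
  also have "\<dots> = (\<Sum>\<kappa>\<in>K. exp (- (\<eta>\<^sup>2 * real (card (Fs \<kappa>)) / (2 * real \<Lambda>)))) * real (card X)"
    by (simp add: sum_distrib_right)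
  also have "\<dots> < 1 * real (card X)"
    using small L cX by (intro mult_strict_right_mono) auto
  finally obtain c where c: "c \<in> X" "(\<Sum>\<kappa>\<in>K. a \<kappa> * (\<Prod>e\<in>E. h \<kappa> e (c e))) < 1"
    using sum_less_imp_ex_less by blast
  have "(1 - \<eta>) * real (card (Fs \<kappa>)) / real \<Lambda> \<le> real (card {e\<in>Fs \<kappa>. c e = col \<kappa> e})" if \<kappa>: "\<kappa> \<in> K" for \<kappa>
  proof -
    define y where "y = (1 - \<eta>) * real (card (Fs \<kappa>)) / real \<Lambda>"
    define x where "x = card {e\<in>Fs \<kappa>. c e = col \<kappa> e}"
    have "E \<inter> {e. e \<in> Fs \<kappa> \<and> c e = col \<kappa> e} = {e\<in>Fs \<kappa>. c e = col \<kappa> e}" using Fs[OF \<kappa>] by auto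
    then have "(\<Prod>e\<in>E. h \<kappa> e (c e)) = exp (- \<eta>) ^ x"
      unfolding h_def x_def using E by (simp add: prod.If_cases)
    also have "\<dots> = exp (- \<eta> * real x)" by (simp add: exp_of_nat_mult[symmetric] mult.commute)
    finally have "exp (\<eta> * (y - real x)) = a \<kappa> * (\<Prod>e\<in>E. h \<kappa> e (c e))"
      unfolding a_def y_def[symmetric] by (simp add: exp_add[symmetric] right_diff_distrib)
    also have "\<dots> \<le> (\<Sum>\<kappa>\<in>K. a \<kappa> * (\<Prod>e\<in>E. h \<kappa> e (c e)))"
      using \<kappa> K by (intro member_le_sum) (auto simp: h_def a_def intro!: mult_nonneg_nonneg prod_nonneg)
    also have "\<dots> < 1" by (rule c(2))
    finally have "\<eta> * (y - real x) < 0" by simp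
    then show ?thesis using \<eta> unfolding y_def x_def by (simp add: mult_less_0_iff)
  qed
  then show ?thesis by blast
qed

lemma sum_Pow_power_card:
  fixes u :: real
  assumes "finite A"
  shows "(\<Sum>S\<in>Pow A. u ^ card S) = (1 + u) ^ card A"
  using assms
proof (induction A rule: finite_induct)
  case (insert a A)
  have "(\<Sum>S\<in>Pow (insert a A). u ^ card S) = (\<Sum>S\<in>Pow A. u ^ card S) + (\<Sum>S\<in>insert a ` Pow A. u ^ card S)"
    unfolding Pow_insert using insert.hyps by (intro sum.union_disjoint) auto
  also have "(\<Sum>S\<in>insert a ` Pow A. u ^ card S) = (\<Sum>S\<in>Pow A. u ^ card (insert a S))"
    using insert.hyps by (subst sum.reindex) (auto simp: inj_on_def)
  also have "\<dots> = (\<Sum>S\<in>Pow A. u * u ^ card S)"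
    using insert.hyps finite_subset by (intro sum.cong refl) (subst card_insert_disjoint, auto)
  also have "\<dots> = u * (\<Sum>S\<in>Pow A. u ^ card S)" by (simp add: sum_distrib_left)
  finally show ?case using insert by (simp add: algebra_simps)
qed simp

section \<open>Templates\<close>

definition block_system :: "'a set \<Rightarrow> nat \<Rightarrow> nat \<Rightarrow> nat \<Rightarrow> (nat \<Rightarrow> 'a set) \<Rightarrow> (nat \<Rightarrow> 'a set) \<Rightarrow> bool" where
  "block_system U \<nu> a b I J \<longleftrightarrow>
    (\<forall>i<\<nu>. card (I i) = a \<and> card (J i) = b) \<and>
    (\<forall>i<\<nu>. \<forall>j<\<nu>. I i \<inter> J j = {} \<and> (i \<noteq> j \<longrightarrow> I i \<inter> I j = {} \<and> J i \<inter> J j = {})) \<and>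
    (\<Union>i<\<nu>. I i \<union> J i) = U"

text \<open>The vertices are block indices rather than blocks, so all templates share the vertex
  sets \<open>{..<\<nu>}\<close> and the permutation enters through the edges alone.\<close>

definition template_graph ::
  "'a set set \<Rightarrow> nat \<Rightarrow> (nat \<Rightarrow> 'a set) \<Rightarrow> (nat \<Rightarrow> 'a set) \<Rightarrow> ('a \<Rightarrow> 'a) \<Rightarrow> (nat \<times> nat) set" where
  "template_graph E \<nu> I J \<pi> = {(i, j). i < \<nu> \<and> j < \<nu> \<and> \<pi> ` I i \<union> \<pi> ` J j \<in> E}"

lemma block_system_swap: "block_system U \<nu> a b I J \<Longrightarrow> block_system U \<nu> b a J I"
  unfolding block_system_def by (simp add: Un_commute Int_commute)

lemma template_graph_converse: "(template_graph E \<nu> I J \<pi>)\<inverse> = template_graph E \<nu> J I \<pi>"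
  unfolding template_graph_def by (auto simp: Un_commute)

lemma block_system_exists:
  assumes "a > 0" "b > 0"
  shows "\<exists>I J. block_system {1..(a + b) * \<nu>} \<nu> a b I J"
proof -
  define I where "I i = {(a + b) * i + 1 .. (a + b) * i + a}" for i
  define J where "J i = {(a + b) * i + a + 1 .. (a + b) * i + (a + b)}" for i
  \<comment> \<open>The blocks with index \<open>i\<close> fill the \<open>i\<close>-th interval of
    length a + b; the shift by one is due to the ground set starting at 1.\<close>
  have IJ: "I i \<union> J i = {x. 1 \<le> x \<and> (x - 1) div (a + b) = i}" for i
  proof -
    have "x \<in> I i \<union> J i \<longleftrightarrow> 1 \<le> x \<and> (x - 1) div (a + b) = i" for x
    proof -
      have "x \<in> I i \<union> J i \<longleftrightarrow> (a + b) * i + 1 \<le> x \<and> x \<le> (a + b) * i + (a + b)"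
        unfolding I_def J_def by auto
      also have "\<dots> \<longleftrightarrow> 1 \<le> x \<and> (a + b) * i \<le> x - 1 \<and> x - 1 < (a + b) * Suc i"
        using assms by auto
      also have "\<dots> \<longleftrightarrow> 1 \<le> x \<and> (x - 1) div (a + b) = i"
        using assms div_nat_eqI[of "a + b" i "x - 1"] dividend_less_times_div[of "a + b" "x - 1"]
        by (auto simp: mult.commute)
      finally show ?thesis .
    qed
    then show ?thesis by blast
  qed
  have "(\<Union>i<\<nu>. I i \<union> J i) = {1..(a + b) * \<nu>}"
  proof -
    have "(x - 1) div (a + b) < \<nu> \<longleftrightarrow> x \<le> (a + b) * \<nu>" if "1 \<le> x" for x
      using that assms by (simp add: div_less_iff_less_mult mult.commute) linarith
    then show ?thesis unfolding IJ by auto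
  qed
  moreover have "card (I i) = a \<and> card (J i) = b" for i unfolding I_def J_def by auto
  moreover have "I i \<inter> J j = {} \<and> (i \<noteq> j \<longrightarrow> I i \<inter> I j = {} \<and> J i \<inter> J j = {})" for i j
  proof (cases "i = j")
    case True
    then show ?thesis unfolding I_def J_def by auto
  next
    case False
    then have "(I i \<union> J i) \<inter> (I j \<union> J j) = {}" unfolding IJ by auto
    then show ?thesis by blast
  qed
  ultimately have "block_system {1..(a + b) * \<nu>} \<nu> a b I J"
    unfolding block_system_def by blast
  then show ?thesis by blast
qed

text \<open>Symmetric under exchange of (\<open>a\<close>, \<open>I\<close>) with (\<open>b\<close>,
  \<open>J\<close>), so a second instance with swapped roles yields every statement for the other
  side of the bipartite graph.\<close>

locale template_setup =
  fixes n k \<nu> a b :: nat and I J :: "nat \<Rightarrow> nat set" and E :: "nat set set"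
  assumes bs: "block_system {1..n} \<nu> a b I J" and ab: "a + b = k" "a > 0" "b > 0" and n: "n = k * \<nu>"
    and E: "uniform_hypergraph n k E"
begin

lemma block_subset_card:
  assumes "i < \<nu>"
  shows "I i \<subseteq> {1..n}" "J i \<subseteq> {1..n}" "card (I i) = a" "card (J i) = b"
  using bs assms unfolding block_system_def by blast+

lemma block_disjoint:
  assumes "i < \<nu>" "j < \<nu>"
  shows "I i \<inter> J j = {}" "i \<noteq> j \<Longrightarrow> I i \<inter> I j = {}" "i \<noteq> j \<Longrightarrow> J i \<inter> J j = {}"
  using bs assms unfolding block_system_def by blast+

lemma permutes_block_image:
  assumes "\<pi> permutes {1..n}" "i < \<nu>"
  shows "\<pi> ` I i \<subseteq> {1..n}" "\<pi> ` J i \<subseteq> {1..n}" "card (\<pi> ` I i) = a" "card (\<pi> ` J i) = b"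
proof -
  show "\<pi> ` I i \<subseteq> {1..n}" "\<pi> ` J i \<subseteq> {1..n}"
    using block_subset_card[OF assms(2)] permutes_image[OF assms(1)] by blast+
  show "card (\<pi> ` I i) = a" "card (\<pi> ` J i) = b"
    using block_subset_card[OF assms(2)] permutes_inj_on[OF assms(1)] by (simp_all add: card_image)
qed

text \<open>The definition of a neighbour does not ask for disjointness from \<open>S\<close>; it is
  forced because the union is an edge and thus has k = a + b elements.\<close>

lemma nbhd_disjoint:
  assumes S: "S \<subseteq> {1..n}" "card S = a" and Y: "Y \<in> nbhd n k E S"
  shows "Y \<subseteq> {1..n} - S" "card Y = b" "S \<union> Y \<in> E"
proof -
  have Y': "Y \<subseteq> {1..n}" "card Y = k - card S" "S \<union> Y \<in> E" using Y by (auto simp: nbhd_def)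
  show cY: "card Y = b" using Y'(2) S ab by auto
  show "S \<union> Y \<in> E" by (rule Y')
  have fin: "finite S" "finite Y" using S Y' finite_subset[of _ "{1..n}"] by auto
  have "card (S \<union> Y) = k" using E Y'(3) by (auto simp: uniform_hypergraph_def)
  then have "card (S \<inter> Y) = 0" using card_Un_Int[OF fin] S cY ab by simp
  then have "S \<inter> Y = {}" using fin by simp
  then show "Y \<subseteq> {1..n} - S" using Y'(1) by auto
qed

text \<open>The tail bound for permutations concerns upper tails, so a lower bound on a degree is
  used as an upper bound on the number of non-neighbours.\<close>

lemma card_non_neighbours:
  assumes S: "S \<subseteq> {1..n}" "card S = a"
  shows "card {T. T \<subseteq> {1..n} - S \<and> card T = b \<and> S \<union> T \<notin> E} + deg n k E S = (n - a) choose b"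
proof -
  let ?A = "{T. T \<subseteq> {1..n} - S \<and> card T = b \<and> S \<union> T \<notin> E}"
  have finS: "finite S" using S finite_subset by blast
  have un: "?A \<union> nbhd n k E S = {T. T \<subseteq> {1..n} - S \<and> card T = b}"
  proof (intro equalityI subsetI)
    fix T assume "T \<in> ?A \<union> nbhd n k E S"
    then show "T \<in> {T. T \<subseteq> {1..n} - S \<and> card T = b}" using nbhd_disjoint[OF S] by auto
  next
    fix T assume "T \<in> {T. T \<subseteq> {1..n} - S \<and> card T = b}"
    then show "T \<in> ?A \<union> nbhd n k E S" using S ab unfolding nbhd_def by auto
  qed
  have dis: "?A \<inter> nbhd n k E S = {}" unfolding nbhd_def by auto
  have fin: "finite {T. T \<subseteq> {1..n} - S \<and> card T = b}" by (rule finite_subset[of _ "Pow {1..n}"]) auto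
  have fA: "finite ?A" and fN: "finite (nbhd n k E S)" using fin unfolding un[symmetric] by auto
  have "card ?A + deg n k E S = card {T. T \<subseteq> {1..n} - S \<and> card T = b}"
    unfolding deg_def card_Un_disjoint[OF fA fN dis, symmetric] un ..
  also have "\<dots> = (n - a) choose b"
    using S finS by (simp add: n_subsets card_Diff_subset)
  finally show ?thesis .
qed

lemma comp_permutes_image_fixed:
  assumes "\<sigma> permutes ({1..n} - X)" "Y \<subseteq> X"
  shows "(\<pi> \<circ> \<sigma>) ` Y = \<pi> ` Y"
proof -
  have "\<sigma> x = x" if "x \<in> Y" for x using assms that permutes_not_in[OF assms(1), of x] by auto
  then show ?thesis by auto
qed

text \<open>Union bound over the vertices and the pairs of one side. The deviation \<tau> =
  \<epsilon> p^2 is an \<epsilon>-fraction of the codegree density p^2 and at most an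
  \<epsilon>-fraction of the degree density \<open>p\<close>, so both conditions survive with 3
  \<epsilon> in place of \<epsilon>.\<close>

lemma card_not_pseudorandom:
  fixes \<epsilon> p :: real
  assumes \<epsilon>: "0 < \<epsilon>" "\<epsilon> \<le> 1" and p: "0 < p" "p \<le> 1"
    and degree: "\<And>S. S \<subseteq> {1..n} \<Longrightarrow> card S = a \<Longrightarrow>
      real (deg n k E S) \<ge> (1 - \<epsilon>) * real ((n - a) choose b) * p"
    and codegree: "\<And>S1 S2. S1 \<subseteq> {1..n} \<Longrightarrow> S2 \<subseteq> {1..n} \<Longrightarrow> card S1 = a \<Longrightarrow> card S2 = a \<Longrightarrow> S1 \<inter> S2 = {} \<Longrightarrow>
      real (card (nbhd n k E S1 \<inter> nbhd n k E S2)) \<le> (1 + \<epsilon>) * real ((n - 2 * a) choose b) * p\<^sup>2"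
    and r: "32 * real k * real r \<le> \<epsilon> * p\<^sup>2 * real \<nu>" and \<nu>: "\<nu> \<ge> 4"
  shows "real (card {\<pi>. \<pi> permutes {1..n} \<and>
      \<not> bip_pseudorandom {..<\<nu>} {..<\<nu>} (template_graph E \<nu> I J \<pi>) (p * \<nu>) (3 * \<epsilon>)})
    \<le> 2 * (real \<nu>)\<^sup>2 * ((1 / (1 + \<epsilon> * p\<^sup>2 / 4)) ^ r * fact n)"
proof -
  define U where "U = {1..n}"
  define \<tau> where "\<tau> = \<epsilon> * p\<^sup>2"
  define t where "t = (1 / (1 + \<tau> / 4)) ^ r * fact n"
  define G where "G = template_graph E \<nu> I J"
  have U: "finite U" "card U = n" by (auto simp: U_def)
  have p2: "p\<^sup>2 \<le> p" "p\<^sup>2 > 0" using p by (simp_all add: power2_eq_square mult_left_le)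
  have \<tau>: "0 < \<tau>" "\<tau> \<le> 1" unfolding \<tau>_def using \<epsilon> p p2 by (auto intro!: mult_le_one)
  have t0: "t \<ge> 0" unfolding t_def using \<tau> by simp
  have bk: "real b \<le> real k" "1 \<le> real k" using ab by auto
  have r2: "2 * real r \<le> \<tau> * real \<nu>"
  proof -
    have "2 * real r \<le> 32 * real k * real r" using bk by (intro mult_right_mono) auto
    then show ?thesis using r unfolding \<tau>_def by linarith
  qed
  \<comment> \<open>At most two blocks of size \<open>a\<close> are fixed, and 4 a \<le> n leaves at
    least half of the points free.\<close>
  have rN: "16 * (real b)\<^sup>2 * real r \<le> \<tau> * real N" if N: "n \<le> 2 * N" for N
  proof -
    have "16 * (real b)\<^sup>2 * real r \<le> 16 * (real k)\<^sup>2 * real r"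
      using bk by (intro mult_right_mono mult_left_mono power_mono) auto
    also have "\<dots> = real k / 2 * (32 * real k * real r)" by (simp add: power2_eq_square)
    also have "\<dots> \<le> real k / 2 * (\<tau> * real \<nu>)" using r unfolding \<tau>_def by (intro mult_left_mono) auto
    also have "\<dots> = \<tau> * (real n / 2)" unfolding n by simp
    also have "\<dots> \<le> \<tau> * real N" using N \<tau> by (intro mult_left_mono) auto
    finally show ?thesis .
  qed
  have n4: "4 * a \<le> n"
  proof -
    have "k * 4 \<le> k * \<nu>" using \<nu> by (intro mult_le_mono2)
    then show ?thesis using n ab by linarith
  qed
  define B1 where "B1 i = {\<pi>. \<pi> permutes U \<and> real (card {j. (i, j) \<in> G \<pi>}) < (1 - 3 * \<epsilon>) * (p * \<nu>)}" for i
  define B2 where "B2 i i' = {\<pi>. \<pi> permutes U \<and> (1 + 3 * \<epsilon>) * (p * \<nu>)\<^sup>2 / real \<nu> < real (card {j. (i, j) \<in> G \<pi> \<and> (i', j) \<in> G \<pi>})}" for i i'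
  have finperm: "finite {\<pi>. \<pi> permutes U}" using U finite_permutations by blast
  have B1: "real (card (B1 i)) \<le> t" if i: "i < \<nu>" for i
  proof -
    define \<alpha> where "\<alpha> = 1 - (1 - \<epsilon>) * p"
    define F where "F \<pi> = {T. \<pi> ` I i \<union> T \<notin> E}" for \<pi> :: "nat \<Rightarrow> nat"
    have "(1 - \<epsilon>) * p \<le> 1" using p \<epsilon> by (intro mult_le_one) auto
    then have \<alpha>: "0 \<le> \<alpha>" "\<alpha> \<le> 1" unfolding \<alpha>_def using p \<epsilon> by auto
    have cX: "card (U - I i) = n - a" using block_subset_card[OF i] U finite_subset[of "I i" U]
      by (simp add: card_Diff_subset U_def)
    have "real (card {\<pi>. \<pi> permutes U \<and> real (card {j. j < \<nu> \<and> \<pi> ` J j \<in> F \<pi>}) \<ge> (\<alpha> + \<tau>) * real \<nu>})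
        \<le> (1 / (1 + \<tau> / 4)) ^ r * fact (card U)"
    proof (rule permutation_blocks_tail[OF U(1) _ \<alpha> \<tau> ab(3), where X = "I i"])
      show "I i \<subseteq> U" using block_subset_card[OF i] by (simp add: U_def)
      show "F (\<pi> \<circ> \<sigma>) = F \<pi>" if "\<pi> permutes U" "\<sigma> permutes (U - I i)" for \<pi> \<sigma>
        using comp_permutes_image_fixed[OF that(2)[unfolded U_def], of "I i" \<pi>] unfolding F_def by simp
      show "real (card {T. T \<subseteq> U - \<pi> ` I i \<and> card T = b \<and> T \<in> F \<pi>}) \<le> \<alpha> * real (card (U - I i) choose b)"
        if "\<pi> permutes U" for \<pi>
      proof -
        note im = permutes_block_image[OF that[unfolded U_def] i]
        have "real (card {T. T \<subseteq> U - \<pi> ` I i \<and> card T = b \<and> T \<in> F \<pi>}) + real (deg n k E (\<pi> ` I i)) = real ((n - a) choose b)"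
          using card_non_neighbours[OF im(1,3)] unfolding F_def U_def by (simp flip: of_nat_add)
        then show ?thesis using degree[OF im(1,3)] unfolding cX \<alpha>_def by (simp add: algebra_simps)
      qed
      show "J j \<subseteq> U - I i \<and> card (J j) = b" if "j < \<nu>" for j
        using block_subset_card[OF that] block_disjoint(1)[OF i that] by (auto simp: U_def)
      show "J j \<inter> J j' = {}" if "j < \<nu>" "j' < \<nu>" "j \<noteq> j'" for j j'
        using block_disjoint(3)[OF that] .
      show "16 * (real b)\<^sup>2 * real r \<le> \<tau> * real (card (U - I i))"
        unfolding cX using n4 by (intro rN) auto
    qed (use r2 \<nu> in auto)
    moreover have "B1 i \<subseteq> {\<pi>. \<pi> permutes U \<and> real (card {j. j < \<nu> \<and> \<pi> ` J j \<in> F \<pi>}) \<ge> (\<alpha> + \<tau>) * real \<nu>}"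
    proof (intro subsetI CollectI conjI)
      fix \<pi> assume \<pi>: "\<pi> \<in> B1 i"
      then show "\<pi> permutes U" by (simp add: B1_def)
      have "{..<\<nu>} = {j. (i, j) \<in> G \<pi>} \<union> {j. j < \<nu> \<and> \<pi> ` J j \<in> F \<pi>}"
        using i unfolding G_def F_def template_graph_def by auto
      then have "card {..<\<nu>} \<le> card {j. (i, j) \<in> G \<pi>} + card {j. j < \<nu> \<and> \<pi> ` J j \<in> F \<pi>}"
        by (metis card_Un_le)
      then have "real \<nu> \<le> real (card {j. (i, j) \<in> G \<pi>}) + real (card {j. j < \<nu> \<and> \<pi> ` J j \<in> F \<pi>})"
        by simp
      moreover have "real (card {j. (i, j) \<in> G \<pi>}) < (1 - 3 * \<epsilon>) * (p * \<nu>)" using \<pi> by (simp add: B1_def)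
      moreover have "(\<alpha> + \<tau>) * real \<nu> \<le> (1 - (1 - 3 * \<epsilon>) * p) * real \<nu>"
      proof (intro mult_right_mono)
        have "\<epsilon> * p\<^sup>2 \<le> \<epsilon> * p" "0 \<le> \<epsilon> * p" using p2 \<epsilon> p by (auto intro: mult_left_mono)
        then show "\<alpha> + \<tau> \<le> 1 - (1 - 3 * \<epsilon>) * p" unfolding \<alpha>_def \<tau>_def by (simp add: algebra_simps)
      qed auto
      ultimately show "(\<alpha> + \<tau>) * real \<nu> \<le> real (card {j. j < \<nu> \<and> \<pi> ` J j \<in> F \<pi>})"
        by (simp add: algebra_simps)
    qed
    ultimately show ?thesis unfolding t_def U(2)
      using card_mono[of "{\<pi>. \<pi> permutes U \<and> real (card {j. j < \<nu> \<and> \<pi> ` J j \<in> F \<pi>}) \<ge> (\<alpha> + \<tau>) * real \<nu>}" "B1 i"]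
        finite_subset[OF _ finperm] by fastforce
  qed
  have B2: "real (card (B2 i i')) \<le> t" if i: "i < \<nu>" "i' < \<nu>" "i \<noteq> i'" for i i'
  proof (cases "(1 + \<epsilon>) * p\<^sup>2 \<le> 1")
    case True
    define \<alpha> where "\<alpha> = (1 + \<epsilon>) * p\<^sup>2"
    define F where "F \<pi> = nbhd n k E (\<pi> ` I i) \<inter> nbhd n k E (\<pi> ` I i')" for \<pi> :: "nat \<Rightarrow> nat"
    have \<alpha>: "0 \<le> \<alpha>" "\<alpha> \<le> 1" using True \<epsilon> unfolding \<alpha>_def by auto
    have fI: "finite (I i)" "finite (I i')" using block_subset_card[OF i(1)] block_subset_card[OF i(2)] finite_subset by blast+
    have cX: "card (U - (I i \<union> I i')) = n - 2 * a"
    proof -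
      have "card (I i \<union> I i') = 2 * a"
        using fI block_subset_card[OF i(1)] block_subset_card[OF i(2)] block_disjoint(2)[OF i] by (simp add: card_Un_disjoint)
      then show ?thesis using block_subset_card[OF i(1)] block_subset_card[OF i(2)] fI U
        by (subst card_Diff_subset) (auto simp: U_def)
    qed
    have "real (card {\<pi>. \<pi> permutes U \<and> real (card {j. j < \<nu> \<and> \<pi> ` J j \<in> F \<pi>}) \<ge> (\<alpha> + \<tau>) * real \<nu>})
        \<le> (1 / (1 + \<tau> / 4)) ^ r * fact (card U)"
    proof (rule permutation_blocks_tail[OF U(1) _ \<alpha> \<tau> ab(3), where X = "I i \<union> I i'"])
      show "I i \<union> I i' \<subseteq> U" using block_subset_card[OF i(1)] block_subset_card[OF i(2)] by (simp add: U_def)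
      show "F (\<pi> \<circ> \<sigma>) = F \<pi>" if "\<pi> permutes U" "\<sigma> permutes (U - (I i \<union> I i'))" for \<pi> \<sigma>
        using comp_permutes_image_fixed[OF that(2)[unfolded U_def], of "I i" \<pi>]
          comp_permutes_image_fixed[OF that(2)[unfolded U_def], of "I i'" \<pi>] unfolding F_def by simp
      show "real (card {T. T \<subseteq> U - \<pi> ` (I i \<union> I i') \<and> card T = b \<and> T \<in> F \<pi>}) \<le> \<alpha> * real (card (U - (I i \<union> I i')) choose b)"
        if "\<pi> permutes U" for \<pi>
      proof -
        note im = permutes_block_image[OF that[unfolded U_def] i(1)]
        note im' = permutes_block_image[OF that[unfolded U_def] i(2)]
        have dis: "\<pi> ` I i \<inter> \<pi> ` I i' = {}"
          using block_disjoint(2)[OF i] permutes_inj[OF that] by (metis image_Int image_empty)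
        have "finite (F \<pi>)" unfolding F_def nbhd_def by (rule finite_subset[of _ "Pow {1..n}"]) auto
        then have "card {T. T \<subseteq> U - \<pi> ` (I i \<union> I i') \<and> card T = b \<and> T \<in> F \<pi>} \<le> card (F \<pi>)"
          by (intro card_mono) auto
        moreover have "real (card (F \<pi>)) \<le> (1 + \<epsilon>) * real ((n - 2 * a) choose b) * p\<^sup>2"
          unfolding F_def by (rule codegree[OF im(1) im'(1) im(3) im'(3) dis])
        ultimately show ?thesis unfolding cX \<alpha>_def by (simp add: mult_ac)
      qed
      show "J j \<subseteq> U - (I i \<union> I i') \<and> card (J j) = b" if "j < \<nu>" for j
        using block_subset_card[OF that] block_disjoint(1)[OF i(1) that] block_disjoint(1)[OF i(2) that] by (auto simp: U_def)
      show "J j \<inter> J j' = {}" if "j < \<nu>" "j' < \<nu>" "j \<noteq> j'" for j j'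
        using block_disjoint(3)[OF that] .
      show "16 * (real b)\<^sup>2 * real r \<le> \<tau> * real (card (U - (I i \<union> I i')))"
        unfolding cX using n4 by (intro rN) auto
    qed (use r2 \<nu> in auto)
    moreover have "B2 i i' \<subseteq> {\<pi>. \<pi> permutes U \<and> real (card {j. j < \<nu> \<and> \<pi> ` J j \<in> F \<pi>}) \<ge> (\<alpha> + \<tau>) * real \<nu>}"
    proof (intro subsetI CollectI conjI)
      fix \<pi> assume \<pi>: "\<pi> \<in> B2 i i'"
      then show \<pi>U: "\<pi> permutes U" by (simp add: B2_def)
      note im = permutes_block_image[OF \<pi>U[unfolded U_def]]
      have "\<pi> ` J j \<in> nbhd n k E (\<pi> ` I l) \<longleftrightarrow> \<pi> ` I l \<union> \<pi> ` J j \<in> E" if "l < \<nu>" "j < \<nu>" for l j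
        unfolding nbhd_def ab(1)[symmetric] using im[OF that(1)] im[OF that(2)] by simp
      then have "{j. (i, j) \<in> G \<pi> \<and> (i', j) \<in> G \<pi>} = {j. j < \<nu> \<and> \<pi> ` J j \<in> F \<pi>}"
        using i unfolding G_def F_def template_graph_def by auto
      then have "(1 + 3 * \<epsilon>) * (p * \<nu>)\<^sup>2 / real \<nu> < real (card {j. j < \<nu> \<and> \<pi> ` J j \<in> F \<pi>})"
        using \<pi> by (simp add: B2_def)
      moreover have "(1 + 3 * \<epsilon>) * (p * \<nu>)\<^sup>2 / real \<nu> = (1 + 3 * \<epsilon>) * p\<^sup>2 * real \<nu>"
        using \<nu> by (simp add: power2_eq_square)
      moreover have "(\<alpha> + \<tau>) * real \<nu> \<le> (1 + 3 * \<epsilon>) * p\<^sup>2 * real \<nu>"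
        unfolding \<alpha>_def \<tau>_def using \<epsilon> by (intro mult_right_mono) (auto simp: algebra_simps)
      ultimately show "(\<alpha> + \<tau>) * real \<nu> \<le> real (card {j. j < \<nu> \<and> \<pi> ` J j \<in> F \<pi>})" by linarith
    qed
    ultimately show ?thesis unfolding t_def U(2)
      using card_mono[of "{\<pi>. \<pi> permutes U \<and> real (card {j. j < \<nu> \<and> \<pi> ` J j \<in> F \<pi>}) \<ge> (\<alpha> + \<tau>) * real \<nu>}" "B2 i i'"]
        finite_subset[OF _ finperm] by fastforce
  next
    case False
    \<comment> \<open>Here the codegree target is at least \<nu> and holds trivially, whereas the
      hit probability required by the tail bound would exceed 1.\<close>
    have "\<pi> \<notin> B2 i i'" for \<pi>
    proof
      assume "\<pi> \<in> B2 i i'"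
      then have "(1 + 3 * \<epsilon>) * (p * \<nu>)\<^sup>2 / real \<nu> < real (card {j. (i, j) \<in> G \<pi> \<and> (i', j) \<in> G \<pi>})"
        by (simp add: B2_def)
      moreover have "card {j. (i, j) \<in> G \<pi> \<and> (i', j) \<in> G \<pi>} \<le> card {..<\<nu>}"
        unfolding G_def template_graph_def by (intro card_mono) auto
      moreover have "(1 + 3 * \<epsilon>) * (p * \<nu>)\<^sup>2 / real \<nu> = (1 + 3 * \<epsilon>) * p\<^sup>2 * real \<nu>"
        using \<nu> by (simp add: power2_eq_square)
      moreover have "1 * real \<nu> \<le> (1 + 3 * \<epsilon>) * p\<^sup>2 * real \<nu>"
      proof (intro mult_right_mono)
        have "(1 + \<epsilon>) * p\<^sup>2 \<le> (1 + 3 * \<epsilon>) * p\<^sup>2" using \<epsilon> by (intro mult_right_mono) auto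
        then show "1 \<le> (1 + 3 * \<epsilon>) * p\<^sup>2" using False by linarith
      qed auto
      ultimately show False by simp
    qed
    then have "B2 i i' = {}" by blast
    then show ?thesis using t0 by simp
  qed
  have sub: "{\<pi>. \<pi> permutes U \<and> \<not> bip_pseudorandom {..<\<nu>} {..<\<nu>} (G \<pi>) (p * \<nu>) (3 * \<epsilon>)}
      \<subseteq> (\<Union>i<\<nu>. B1 i) \<union> (\<Union>(i, i')\<in>{(i, i'). i < \<nu> \<and> i' < \<nu> \<and> i \<noteq> i'}. B2 i i')"
  proof
    fix \<pi> assume \<pi>: "\<pi> \<in> {\<pi>. \<pi> permutes U \<and> \<not> bip_pseudorandom {..<\<nu>} {..<\<nu>} (G \<pi>) (p * \<nu>) (3 * \<epsilon>)}"
    have "G \<pi> \<subseteq> {..<\<nu>} \<times> {..<\<nu>}" unfolding G_def template_graph_def by auto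
    then show "\<pi> \<in> (\<Union>i<\<nu>. B1 i) \<union> (\<Union>(i, i')\<in>{(i, i'). i < \<nu> \<and> i' < \<nu> \<and> i \<noteq> i'}. B2 i i')"
      using \<pi> unfolding bip_pseudorandom_def B1_def B2_def by (auto simp: not_le)
  qed
  let ?P = "{(i, i'). i < \<nu> \<and> i' < \<nu> \<and> i \<noteq> i'}"
  have Psub: "?P \<subseteq> {..<\<nu>} \<times> {..<\<nu>}" by auto
  have finP: "finite ?P" by (rule finite_subset[OF Psub]) simp
  have cP: "card ?P \<le> \<nu> * \<nu>" using card_mono[OF _ Psub] by (simp add: card_cartesian_product)
  have fB: "finite (B1 i)" "finite (B2 i i')" for i i'
    unfolding B1_def B2_def using finite_subset[OF _ finperm] by auto
  have "card {\<pi>. \<pi> permutes U \<and> \<not> bip_pseudorandom {..<\<nu>} {..<\<nu>} (G \<pi>) (p * \<nu>) (3 * \<epsilon>)}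
      \<le> card ((\<Union>i<\<nu>. B1 i) \<union> (\<Union>(i, i')\<in>?P. B2 i i'))"
    using fB finP by (intro card_mono[OF _ sub]) auto
  also have "\<dots> \<le> card (\<Union>i<\<nu>. B1 i) + card (\<Union>(i, i')\<in>?P. B2 i i')" by (rule card_Un_le)
  also have "\<dots> \<le> (\<Sum>i<\<nu>. card (B1 i)) + (\<Sum>(i, i')\<in>?P. card (B2 i i'))"
    using card_UN_le[of "{..<\<nu>}" B1] card_UN_le[OF finP, of "\<lambda>(i, i'). B2 i i'"]
    by (simp add: case_prod_unfold)
  finally have "real (card {\<pi>. \<pi> permutes U \<and> \<not> bip_pseudorandom {..<\<nu>} {..<\<nu>} (G \<pi>) (p * \<nu>) (3 * \<epsilon>)})
      \<le> (\<Sum>i<\<nu>. real (card (B1 i))) + (\<Sum>(i, i')\<in>?P. real (card (B2 i i')))"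
    by (simp add: case_prod_unfold flip: of_nat_sum of_nat_add)
  also have "\<dots> \<le> (\<Sum>i<\<nu>. t) + (\<Sum>(i, i')\<in>?P. t)"
    using B1 B2 by (intro add_mono sum_mono) auto
  also have "\<dots> = real \<nu> * t + real (card ?P) * t" by (simp add: case_prod_unfold)
  also have "\<dots> \<le> real \<nu> * real \<nu> * t + real (\<nu> * \<nu>) * t"
    using \<nu> t0 cP by (intro add_mono mult_right_mono) (auto simp del: of_nat_mult)
  also have "\<dots> = 2 * (real \<nu>)\<^sup>2 * t" by (simp add: power2_eq_square)
  finally show ?thesis unfolding t_def \<tau>_def G_def U_def .
qed

text \<open>With nothing fixed, the image of the union of a small and a large block is a uniform
  \<open>k\<close>-set, and there are \<nu>^2 such unions.\<close>

lemma card_covering_templates: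
  assumes e: "e \<subseteq> {1..n}" "card e = k"
  shows "real (card {\<pi>. \<pi> permutes {1..n} \<and> (\<exists>i<\<nu>. \<exists>j<\<nu>. \<pi> ` I i \<union> \<pi> ` J j = e)}) * real (n choose k)
    \<le> (real \<nu>)\<^sup>2 * fact n"
proof -
  define C where "C x = {\<pi>. \<pi> permutes {1..n} \<and> True \<and> \<pi> ` (I (fst x) \<union> J (snd x)) \<in> {e}}" for x
  have C: "card (C x) * (n choose k) \<le> fact n" if x: "x \<in> {..<\<nu>} \<times> {..<\<nu>}" for x
  proof -
    have x': "fst x < \<nu>" "snd x < \<nu>" using x by auto
    have sub: "I (fst x) \<union> J (snd x) \<subseteq> {1..n} - {}" using block_subset_card[OF x'(1)] block_subset_card[OF x'(2)] by auto
    have "card (I (fst x) \<union> J (snd x)) = k"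
      using block_subset_card[OF x'(1)] block_subset_card[OF x'(2)] block_disjoint(1)[OF x'] ab finite_subset[of _ "{1..n}"]
      by (subst card_Un_disjoint) auto
    then have "card (C x) * (card ({1..n} - {}) choose k) \<le> 1 * card {\<pi>. \<pi> permutes {1..n} \<and> True}"
      unfolding C_def using sub
    proof (intro permutation_block_average)
      fix \<pi> :: "nat \<Rightarrow> nat"
      have "{T. T \<subseteq> {1..n} - \<pi> ` {} \<and> card T = k \<and> T \<in> {e}} \<subseteq> {e}" by auto
      then show "card {T. T \<subseteq> {1..n} - \<pi> ` {} \<and> card T = k \<and> T \<in> {e}} \<le> 1"
        using card_mono[of "{e}"] by fastforce
    qed auto
    then show ?thesis by (simp add: card_permutations)
  qed
  have "{\<pi>. \<pi> permutes {1..n} \<and> (\<exists>i<\<nu>. \<exists>j<\<nu>. \<pi> ` I i \<union> \<pi> ` J j = e)} = (\<Union>x\<in>{..<\<nu>}\<times>{..<\<nu>}. C x)"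
    unfolding C_def by (force simp: image_Un)
  then have "card {\<pi>. \<pi> permutes {1..n} \<and> (\<exists>i<\<nu>. \<exists>j<\<nu>. \<pi> ` I i \<union> \<pi> ` J j = e)} \<le> (\<Sum>x\<in>{..<\<nu>}\<times>{..<\<nu>}. card (C x))"
    using card_UN_le[of "{..<\<nu>}\<times>{..<\<nu>}" C] by simp
  then have "card {\<pi>. \<pi> permutes {1..n} \<and> (\<exists>i<\<nu>. \<exists>j<\<nu>. \<pi> ` I i \<union> \<pi> ` J j = e)} * (n choose k)
      \<le> (\<Sum>x\<in>{..<\<nu>}\<times>{..<\<nu>}. card (C x) * (n choose k))"
    unfolding sum_distrib_right[symmetric] by (rule mult_le_mono1)
  also have "\<dots> \<le> (\<Sum>x\<in>{..<\<nu>}\<times>{..<\<nu>}. fact n)" using C by (intro sum_mono)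
  also have "\<dots> = \<nu> * \<nu> * fact n" by (simp add: card_cartesian_product)
  finally have "real (card {\<pi>. \<pi> permutes {1..n} \<and> (\<exists>i<\<nu>. \<exists>j<\<nu>. \<pi> ` I i \<union> \<pi> ` J j = e)} * (n choose k)) \<le> real (\<nu> * \<nu> * fact n)"
    by (simp only: of_nat_le_iff)
  then show ?thesis by (simp add: power2_eq_square)
qed

end

section \<open>From good templates to edge-disjoint perfect matchings\<close>

text \<open>The failure probability of a cut is bounded by one of the two weights, depending on
  whether \<open>S\<close> or the complement of \<open>T\<close> is smaller. Since |T| < |S|
  excludes \<open>S = {}\<close> and \<open>T = A\<close>, one factor in each product of sums loses
  its term 1; for small u \<nu> the total then has order u \<nu> instead of a constant.\<close>

lemma sum_cut_weights:
  fixes u :: real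
  assumes u: "u \<ge> 0" and A: "finite A" "card A = \<nu>"
  shows "(\<Sum>(S, T)\<in>{(S, T). S \<subseteq> A \<and> T \<subseteq> A \<and> card T < card S}.
      u ^ card S * u ^ card T + u ^ card (A - T) * u ^ card (A - S))
    \<le> 2 * (((1 + u) ^ \<nu> - 1) * (1 + u) ^ \<nu>)"
proof -
  let ?P = "{(S, T). S \<subseteq> A \<and> T \<subseteq> A \<and> card T < card S}"
  have compl: "(\<Sum>S\<in>Pow A. f (A - S)) = (\<Sum>S\<in>Pow A. f S)" for f :: "'a set \<Rightarrow> real"
    by (rule sum.reindex_bij_witness[of _ "\<lambda>S. A - S" "\<lambda>S. A - S"]) auto
  have ne: "(\<Sum>S\<in>Pow A - {{}}. u ^ card S) = (1 + u) ^ \<nu> - 1"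
    using sum_Pow_power_card[OF A(1), of u] A by (simp add: sum_diff1)
  have ne': "(\<Sum>T\<in>Pow A - {A}. u ^ card (A - T)) = (1 + u) ^ \<nu> - 1"
    using sum_Pow_power_card[OF A(1), of u] A compl[of "\<lambda>S. u ^ card S"] by (simp add: sum_diff1)
  have 1: "(\<Sum>(S, T)\<in>?P. u ^ card S * u ^ card T) \<le> ((1 + u) ^ \<nu> - 1) * (1 + u) ^ \<nu>"
  proof -
    have "(\<Sum>(S, T)\<in>?P. u ^ card S * u ^ card T) \<le> (\<Sum>(S, T)\<in>(Pow A - {{}}) \<times> Pow A. u ^ card S * u ^ card T)"
      using A u by (intro sum_mono2) auto
    also have "\<dots> = (\<Sum>S\<in>Pow A - {{}}. u ^ card S) * (\<Sum>T\<in>Pow A. u ^ card T)"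
      by (simp add: sum_product sum.cartesian_product)
    finally show ?thesis unfolding ne sum_Pow_power_card[OF A(1)] A(2) .
  qed
  have 2: "(\<Sum>(S, T)\<in>?P. u ^ card (A - T) * u ^ card (A - S)) \<le> ((1 + u) ^ \<nu> - 1) * (1 + u) ^ \<nu>"
  proof -
    have "T \<noteq> A" if "S \<subseteq> A" "card T < card S" for S T using that card_mono[OF A(1) that(1)] by auto
    then have "(\<Sum>(S, T)\<in>?P. u ^ card (A - T) * u ^ card (A - S))
        \<le> (\<Sum>(S, T)\<in>Pow A \<times> (Pow A - {A}). u ^ card (A - T) * u ^ card (A - S))"
      using A u by (intro sum_mono2) auto
    also have "\<dots> = (\<Sum>S\<in>Pow A. u ^ card (A - S)) * (\<Sum>T\<in>Pow A - {A}. u ^ card (A - T))"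
      by (simp add: sum_product sum.cartesian_product mult.commute)
    also have "\<dots> = (1 + u) ^ \<nu> * ((1 + u) ^ \<nu> - 1)"
      unfolding ne' compl[of "\<lambda>S. u ^ card S"] sum_Pow_power_card[OF A(1)] A(2) ..
    finally show ?thesis by (simp add: mult.commute)
  qed
  show ?thesis using 1 2 by (simp add: case_prod_unfold sum.distrib)
qed

context template_setup
begin

text \<open>Blocks are nonempty and disjoint, so an edge remembers its index pair; within a
  template, counting index pairs is counting edges of the hypergraph.\<close>

lemma template_edge_inj:
  assumes "\<pi> permutes {1..n}"
  shows "inj_on (\<lambda>(x, y). \<pi> ` I x \<union> \<pi> ` J y) ({..<\<nu>} \<times> {..<\<nu>})"
proof -
  have "x = x' \<and> y = y'"
    if "x < \<nu>" "y < \<nu>" "x' < \<nu>" "y' < \<nu>" "\<pi> ` I x \<union> \<pi> ` J y = \<pi> ` I x' \<union> \<pi> ` J y'" for x y x' y'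
  proof -
    have eq: "I x \<union> J y = I x' \<union> J y'"
      using that(5) permutes_inj[OF assms] by (simp add: image_Un[symmetric] inj_image_eq_iff)
    have ne: "I x \<noteq> {}" "J y \<noteq> {}" using block_subset_card[OF that(1)] block_subset_card[OF that(2)] ab by auto
    have "x = x'"
    proof (rule ccontr)
      assume "x \<noteq> x'"
      then have "I x \<inter> (I x' \<union> J y') = {}"
        using block_disjoint(2)[OF that(1,3)] block_disjoint(1)[OF that(1,4)] by blast
      then show False using eq ne by blast
    qed
    moreover have "y = y'"
    proof (rule ccontr)
      assume "y \<noteq> y'"
      then have "J y \<inter> (I x' \<union> J y') = {}"
        using block_disjoint(3)[OF that(2,4)] block_disjoint(1)[OF that(3,2)] by blast
      then show False using eq ne by blast
    qed
    ultimately show ?thesis by blast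
  qed
  then show ?thesis by (auto simp: inj_on_def)
qed

lemma template_matching:
  assumes \<pi>: "\<pi> permutes {1..n}" and f: "bij_betw f {..<\<nu>} {..<\<nu>}"
    and fE: "\<And>x. x < \<nu> \<Longrightarrow> \<pi> ` I x \<union> \<pi> ` J (f x) \<in> E"
  shows "perfect_matching n k E ((\<lambda>x. \<pi> ` I x \<union> \<pi> ` J (f x)) ` {..<\<nu>})"
proof -
  have fl: "f x < \<nu>" if "x < \<nu>" for x using bij_betwE[OF f] that by auto
  have inj: "inj_on (\<lambda>x. \<pi> ` I x \<union> \<pi> ` J (f x)) {..<\<nu>}"
  proof (rule inj_onI)
    fix x y assume "x \<in> {..<\<nu>}" "y \<in> {..<\<nu>}" "\<pi> ` I x \<union> \<pi> ` J (f x) = \<pi> ` I y \<union> \<pi> ` J (f y)"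
    then show "x = y" using inj_onD[OF template_edge_inj[OF \<pi>], of "(x, f x)" "(y, f y)"] fl by simp
  qed
  have disj: "(\<pi> ` I x \<union> \<pi> ` J (f x)) \<inter> (\<pi> ` I y \<union> \<pi> ` J (f y)) = {}"
    if xy: "x < \<nu>" "y < \<nu>" "x \<noteq> y" for x y
  proof -
    have "f x \<noteq> f y" using bij_betw_imp_inj_on[OF f] xy by (auto simp: inj_on_def)
    then have "J (f x) \<inter> J (f y) = {}" using block_disjoint(3)[OF fl[OF xy(1)] fl[OF xy(2)]] by simp
    then have "(I x \<union> J (f x)) \<inter> (I y \<union> J (f y)) = {}"
      using block_disjoint(2)[OF xy] block_disjoint(1)[OF xy(1) fl[OF xy(2)]]
        block_disjoint(1)[OF xy(2) fl[OF xy(1)]] by blast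
    then have "\<pi> ` ((I x \<union> J (f x)) \<inter> (I y \<union> J (f y))) = {}" by simp
    then show ?thesis using permutes_inj[OF \<pi>] by (simp add: image_Int image_Un)
  qed
  have "(\<Union>x<\<nu>. J (f x)) = (\<Union>x\<in>f ` {..<\<nu>}. J x)" by auto
  also have "\<dots> = (\<Union>x<\<nu>. J x)" using f by (simp add: bij_betw_def)
  finally have "(\<Union>x<\<nu>. I x \<union> J (f x)) = (\<Union>x<\<nu>. I x \<union> J x)" by (simp add: UN_Un_distrib)
  then have "(\<Union>x<\<nu>. I x \<union> J (f x)) = {1..n}" using bs by (simp add: block_system_def)
  then have m1: "(\<Union>x<\<nu>. \<pi> ` I x \<union> \<pi> ` J (f x)) = {1..n}"
    using permutes_image[OF \<pi>] by (metis (no_types, lifting) image_UN image_Un SUP_cong)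
  have m2: "n div k = \<nu>" using n ab by simp
  have m3: "card ((\<lambda>x. \<pi> ` I x \<union> \<pi> ` J (f x)) ` {..<\<nu>}) = \<nu>" using card_image[OF inj] by simp
  have m4: "(\<lambda>x. \<pi> ` I x \<union> \<pi> ` J (f x)) ` {..<\<nu>} \<subseteq> E" using fE by auto
  have m5: "e \<inter> e' = {}" if e: "e \<in> (\<lambda>x. \<pi> ` I x \<union> \<pi> ` J (f x)) ` {..<\<nu>}"
    and e': "e' \<in> (\<lambda>x. \<pi> ` I x \<union> \<pi> ` J (f x)) ` {..<\<nu>}" and ne: "e \<noteq> e'" for e e'
  proof -
    obtain x where x: "x < \<nu>" "e = \<pi> ` I x \<union> \<pi> ` J (f x)" using e by blast
    obtain y where y: "y < \<nu>" "e' = \<pi> ` I y \<union> \<pi> ` J (f y)" using e' by blast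
    show ?thesis unfolding x(2) y(2) using ne x y by (intro disj) auto
  qed
  show ?thesis unfolding perfect_matching_def m2 by (intro conjI ballI impI m1 m3 m4) (rule m5)
qed

text \<open>The templates covering an edge own distinct colours below \<open>\<Lambda>\<close>. Every edge takes a random
  colour and is given to the template owning it. Hence the graphs retained by different templates
  are edge-disjoint, and each of them is a random subgraph of density exactly \<open>1 / \<Lambda>\<close>.\<close>

lemma packing_from_templates:
  fixes D e \<delta> \<eta> u :: real and \<pi> :: "nat \<Rightarrow> nat \<Rightarrow> nat"
  assumes \<nu>: "\<nu> > 0" and \<pi>: "\<And>i. i < R \<Longrightarrow> \<pi> i permutes {1..n}"
    and pr: "\<And>i. i < R \<Longrightarrow> bip_pseudorandom {..<\<nu>} {..<\<nu>} (template_graph E \<nu> I J (\<pi> i)) D e"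
    and pr': "\<And>i. i < R \<Longrightarrow> bip_pseudorandom {..<\<nu>} {..<\<nu>} (template_graph E \<nu> J I (\<pi> i)) D e"
    and D: "D > 0" and e: "e \<ge> 0" "real \<nu> \<le> e * D\<^sup>2"
    and \<delta>: "64 * e \<le> \<delta>\<^sup>2" "0 < \<delta>" "\<delta> \<le> 1/8" and \<eta>: "0 < \<eta>" "\<eta> < 1" and \<Lambda>: "\<Lambda> > 0"
    and cover: "\<And>f. f \<in> E \<Longrightarrow> card {i. i < R \<and> (\<exists>x<\<nu>. \<exists>y<\<nu>. \<pi> i ` I x \<union> \<pi> i ` J y = f)} \<le> \<Lambda>"
    and u: "exp (- (\<eta>\<^sup>2 * D / (16 * real \<Lambda>))) \<le> u"
    and small: "real R * (2 * (((1 + u) ^ \<nu> - 1) * (1 + u) ^ \<nu>)) < 1"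
    and r: "real r \<le> (1 - \<eta>) * ((1 - \<delta>) * D) / real \<Lambda>"
  shows "\<exists>\<M>. (\<forall>M\<in>\<M>. perfect_matching n k E M) \<and> (\<forall>M1\<in>\<M>. \<forall>M2\<in>\<M>. M1 \<noteq> M2 \<longrightarrow> M1 \<inter> M2 = {}) \<and>
    card \<M> = R * r"
proof -
  define A where "A = {..<\<nu>}"
  define ed where "ed i = (\<lambda>(x, y). \<pi> i ` I x \<union> \<pi> i ` J y)" for i
  define G where "G i = template_graph E \<nu> I J (\<pi> i)" for i
  define Cov where "Cov f = {i. i < R \<and> f \<in> ed i ` (A \<times> A)}" for f
  have A: "finite A" "card A = \<nu>" by (auto simp: A_def)
  have L: "real \<Lambda> > 0" using \<Lambda> by simp
  have GA: "G i \<subseteq> A \<times> A" for i unfolding G_def template_graph_def A_def by auto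
  have GE: "ed i z \<in> E" if "z \<in> G i" for i z
    using that unfolding G_def template_graph_def ed_def by auto
  have inj: "inj_on (ed i) (A \<times> A)" if "i < R" for i
    unfolding ed_def A_def by (rule template_edge_inj[OF \<pi>[OF that]])
  have finE: "finite E"
    by (rule finite_subset[of _ "Pow {1..n}"]) (use E in \<open>auto simp: uniform_hypergraph_def\<close>)
  have "card (Cov f) \<le> \<Lambda>" if "f \<in> E" for f
  proof -
    have "Cov f = {i. i < R \<and> (\<exists>x<\<nu>. \<exists>y<\<nu>. \<pi> i ` I x \<union> \<pi> i ` J y = f)}"
      unfolding Cov_def ed_def A_def by (auto simp: image_iff)
    then show ?thesis using cover[OF that] by simp
  qed
  then have "\<exists>s. s ` Cov f \<subseteq> {..<\<Lambda>} \<and> inj_on s (Cov f)" if "f \<in> E" for f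
    using that by (intro card_le_inj) (auto simp: Cov_def)
  then obtain slot where slot: "\<And>f. f \<in> E \<Longrightarrow> slot f ` Cov f \<subseteq> {..<\<Lambda>} \<and> inj_on (slot f) (Cov f)"
    by metis
  define P where "P = {(S, T). S \<subseteq> A \<and> T \<subseteq> A \<and> card T < card S}"
  define K where "K = {..<R} \<times> P"
  define Fs where "Fs = (\<lambda>(i, S, T). ed i ` (G i \<inter> S \<times> (A - T)))"
  define col where "col = (\<lambda>(i, (S :: nat set), (T :: nat set)) f. slot f i)"
  have finP: "finite P"
    by (rule finite_subset[of _ "Pow A \<times> Pow A"]) (use A in \<open>auto simp: P_def\<close>)
  have cut: "(1 - \<delta>) * D * (real (card S) - real (card T)) \<le> real (card (G i \<inter> S \<times> (A - T)))"
    "D * min (card S) (card (A - T)) / 4 \<le> real (card (G i \<inter> S \<times> (A - T)))"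
    if "i < R" "(S, T) \<in> P" for i S T
  proof -
    have p1: "bip_pseudorandom A A (G i) D e" using pr[OF that(1)] unfolding A_def G_def .
    have p2: "bip_pseudorandom A A ((G i)\<inverse>) D e"
      using pr'[OF that(1)] unfolding A_def G_def template_graph_converse .
    have ST: "S \<subseteq> A" "T \<subseteq> A" "card T < card S" using that(2) by (auto simp: P_def)
    show "(1 - \<delta>) * D * (real (card S) - real (card T)) \<le> real (card (G i \<inter> S \<times> (A - T)))"
      "D * min (card S) (card (A - T)) / 4 \<le> real (card (G i \<inter> S \<times> (A - T)))"
      using pseudorandom_cut[OF A(1) A(1) A(2) A(2) \<nu> p1 p2 D e \<delta> ST] by simp_all
  qed
  have cFs: "card (Fs (i, S, T)) = card (G i \<inter> S \<times> (A - T))" if "i < R" for i S T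
    unfolding Fs_def using inj[OF that] GA by (auto intro!: card_image intro: inj_on_subset)
  have "\<exists>c. \<forall>\<kappa>\<in>K. (1 - \<eta>) * real (card (Fs \<kappa>)) / real \<Lambda> \<le> real (card {f\<in>Fs \<kappa>. c f = col \<kappa> f})"
  proof (rule exists_colouring_large_classes[OF finE \<Lambda> \<eta>(1)])
    show "finite K" unfolding K_def using finP by simp
    show "Fs \<kappa> \<subseteq> E" if "\<kappa> \<in> K" for \<kappa> unfolding Fs_def using GE by (auto split: prod.splits)
    show "col \<kappa> f < \<Lambda>" if kf: "\<kappa> \<in> K" "f \<in> Fs \<kappa>" for \<kappa> f
    proof -
      obtain i S T where \<kappa>: "\<kappa> = (i, S, T)" by (cases \<kappa>)
      have i: "i < R" using kf \<kappa> unfolding K_def by auto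
      obtain z where z: "z \<in> G i" "f = ed i z" using kf \<kappa> unfolding Fs_def by auto
      have "f \<in> E" using z GE by blast
      moreover have "i \<in> Cov f" using z GA i unfolding Cov_def by blast
      ultimately show ?thesis using slot[of f] \<kappa> unfolding col_def by auto
    qed
    \<comment> \<open>With m = min |S| |A - T|, at least D m / 4 edges make the exponent 2 m copies
      of \<eta>^2 D / (16 \<Lambda>). As |T| < |S|, the number 2 m is at least |S| + |T| when m =
      |S|, and at least |A - T| + |A - S| when m = |A - T|.\<close>
    have each: "exp (- (\<eta>\<^sup>2 * real (card (Fs (i, S, T))) / (2 * real \<Lambda>)))
        \<le> u ^ card S * u ^ card T + u ^ card (A - T) * u ^ card (A - S)"
      if i: "i < R" and ST: "(S, T) \<in> P" for i S T
    proof -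
      define w where "w = exp (- (\<eta>\<^sup>2 * D / (16 * real \<Lambda>)))"
      define m where "m = min (card S) (card (A - T))"
      have w: "0 \<le> w" "w \<le> 1" "w \<le> u" using u D L by (auto simp: w_def)
      have ST': "S \<subseteq> A" "T \<subseteq> A" "card T < card S" using ST by (auto simp: P_def)
      then have fin: "finite S" "finite T" using A finite_subset by auto
      have cST: "card (A - S) \<le> card (A - T)" using ST' fin A by (simp add: card_Diff_subset)
      have "\<eta>\<^sup>2 * (D * m / 4) / (2 * real \<Lambda>) \<le> \<eta>\<^sup>2 * real (card (Fs (i, S, T))) / (2 * real \<Lambda>)"
        using cut(2)[OF i ST] L unfolding cFs[OF i] m_def by (intro divide_right_mono mult_left_mono) auto
      then have "exp (- (\<eta>\<^sup>2 * real (card (Fs (i, S, T))) / (2 * real \<Lambda>))) \<le> exp (- (\<eta>\<^sup>2 * (D * m / 4) / (2 * real \<Lambda>)))"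
        by simp
      also have "\<dots> = w ^ (2 * m)" unfolding w_def using L
        by (simp add: exp_of_nat_mult[symmetric] field_simps)
      also have "\<dots> \<le> u ^ card S * u ^ card T + u ^ card (A - T) * u ^ card (A - S)"
      proof (cases "card S \<le> card (A - T)")
        case True
        then have "w ^ (2 * m) \<le> w ^ (card S + card T)"
          using w ST' unfolding m_def by (intro power_decreasing) auto
        also have "\<dots> \<le> u ^ (card S + card T)" using w by (intro power_mono) auto
        finally show ?thesis using w by (simp add: power_add add_increasing2)
      next
        case False
        then have "w ^ (2 * m) \<le> w ^ (card (A - T) + card (A - S))"
          using w cST unfolding m_def by (intro power_decreasing) auto
        also have "\<dots> \<le> u ^ (card (A - T) + card (A - S))" using w by (intro power_mono) auto
        finally show ?thesis using w by (simp add: power_add add_increasing)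
      qed
      finally show ?thesis .
    qed
    have u0: "u \<ge> 0" using u by (meson exp_ge_zero order_trans)
    have "(\<Sum>\<kappa>\<in>K. exp (- (\<eta>\<^sup>2 * real (card (Fs \<kappa>)) / (2 * real \<Lambda>))))
        = (\<Sum>i<R. \<Sum>(S, T)\<in>P. exp (- (\<eta>\<^sup>2 * real (card (Fs (i, S, T))) / (2 * real \<Lambda>))))"
      unfolding K_def by (simp add: sum.cartesian_product case_prod_unfold)
    also have "\<dots> \<le> (\<Sum>i<R. \<Sum>(S, T)\<in>P. u ^ card S * u ^ card T + u ^ card (A - T) * u ^ card (A - S))"
      using each by (intro sum_mono) (auto simp: case_prod_unfold)
    also have "\<dots> \<le> (\<Sum>i<R. 2 * (((1 + u) ^ \<nu> - 1) * (1 + u) ^ \<nu>))"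
      unfolding P_def by (intro sum_mono sum_cut_weights[OF u0 A])
    also have "\<dots> < 1" using small by simp
    finally show "(\<Sum>\<kappa>\<in>K. exp (- (\<eta>\<^sup>2 * real (card (Fs \<kappa>)) / (2 * real \<Lambda>)))) < 1" .
  qed
  then obtain c where c: "\<And>\<kappa>. \<kappa> \<in> K \<Longrightarrow> (1 - \<eta>) * real (card (Fs \<kappa>)) / real \<Lambda> \<le> real (card {f\<in>Fs \<kappa>. c f = col \<kappa> f})"
    by blast
  define H where "H i = {z \<in> G i. c (ed i z) = slot (ed i z) i}" for i
  have HA: "H i \<subseteq> A \<times> A" for i using GA unfolding H_def by auto
  have Hcut: "r * card S \<le> card (H i \<inter> S \<times> (A - T)) + r * card T"
    if i: "i < R" and ST: "S \<subseteq> A" "T \<subseteq> A" for i S T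
  proof (cases "card T < card S")
    case False
    then show ?thesis by (simp add: trans_le_add2)
  next
    case True
    then have P: "(S, T) \<in> P" using ST by (simp add: P_def)
    have "{f\<in>Fs (i, S, T). c f = col (i, S, T) f} = ed i ` (H i \<inter> S \<times> (A - T))"
      unfolding Fs_def col_def H_def by auto
    moreover have "inj_on (ed i) (H i \<inter> S \<times> (A - T))"
      using inj[OF i] HA by (auto intro: inj_on_subset)
    ultimately have "real (card (H i \<inter> S \<times> (A - T))) = real (card {f\<in>Fs (i, S, T). c f = col (i, S, T) f})"
      by (simp add: card_image)
    also have "\<dots> \<ge> (1 - \<eta>) * real (card (Fs (i, S, T))) / real \<Lambda>"
      using i P by (intro c) (auto simp: K_def)
    also have "(1 - \<eta>) * real (card (Fs (i, S, T))) / real \<Lambda> \<ge> (1 - \<eta>) * ((1 - \<delta>) * D * (real (card S) - real (card T))) / real \<Lambda>"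
      unfolding cFs[OF i] using cut(1)[OF i P] \<eta> L by (intro divide_right_mono mult_left_mono) auto
    also have "(1 - \<eta>) * ((1 - \<delta>) * D * (real (card S) - real (card T))) / real \<Lambda>
        = (1 - \<eta>) * ((1 - \<delta>) * D) / real \<Lambda> * (real (card S) - real (card T))" by simp
    also have "\<dots> \<ge> real r * (real (card S) - real (card T))"
      using r True by (intro mult_right_mono) auto
    finally have "real (r * card S) \<le> real (card (H i \<inter> S \<times> (A - T)) + r * card T)"
      by (simp add: right_diff_distrib)
    then show ?thesis by (simp only: of_nat_le_iff)
  qed
  define W where "W i f \<longleftrightarrow> (\<forall>l<r. bij_betw (f l) A A \<and> (\<forall>x\<in>A. (x, f l x) \<in> H i)) \<and>
      (\<forall>l<r. \<forall>l'<r. \<forall>x\<in>A. f l x = f l' x \<longrightarrow> l = l')" for i f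
  have "\<exists>f. W i f" if i: "i < R" for i
  proof -
    obtain H' where H': "H' \<subseteq> H i" "\<And>x. x \<in> A \<Longrightarrow> card {y. (x, y) \<in> H'} = r" "\<And>y. y \<in> A \<Longrightarrow> card {x. (x, y) \<in> H'} = r"
      using bipartite_factor[OF A(1) A(1) HA refl Hcut[OF i]] by blast
    have "H' \<subseteq> A \<times> A" using H'(1) HA by blast
    then obtain g where g: "\<forall>l<r. bij_betw (g l) A A \<and> (\<forall>x\<in>A. (x, g l x) \<in> H')"
        "\<forall>l<r. \<forall>l'<r. \<forall>x\<in>A. g l x = g l' x \<longrightarrow> l = l'"
      using bipartite_regular_decomposition[OF A(1) A(1) refl _ H'(2,3)] by auto
    then have "W i g" unfolding W_def using H'(1) by blast
    then show ?thesis by blast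
  qed
  then obtain f where "\<And>i. i < R \<Longrightarrow> W i (f i)" by metis
  then have f: "\<And>i l. i < R \<Longrightarrow> l < r \<Longrightarrow> bij_betw (f i l) A A"
      "\<And>i l x. i < R \<Longrightarrow> l < r \<Longrightarrow> x \<in> A \<Longrightarrow> (x, f i l x) \<in> H i"
      "\<And>i l l' x. i < R \<Longrightarrow> l < r \<Longrightarrow> l' < r \<Longrightarrow> x \<in> A \<Longrightarrow> f i l x = f i l' x \<Longrightarrow> l = l'"
    unfolding W_def by blast+
  define Mt where "Mt = (\<lambda>(i, l). (\<lambda>x. \<pi> i ` I x \<union> \<pi> i ` J (f i l x)) ` A)"
  define \<M> where "\<M> = Mt ` ({..<R} \<times> {..<r})"
  have pm: "perfect_matching n k E (Mt (i, l))" if il: "i < R" "l < r" for i l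
  proof -
    have "\<pi> i ` I x \<union> \<pi> i ` J (f i l x) \<in> E" if "x < \<nu>" for x
    proof -
      have "(x, f i l x) \<in> G i" using f(2)[OF il, of x] that unfolding H_def A_def by auto
      from GE[OF this] show ?thesis by (simp add: ed_def)
    qed
    then show ?thesis
      using template_matching[OF \<pi>[OF il(1)] f(1)[OF il, unfolded A_def]] unfolding Mt_def A_def by simp
  qed
  \<comment> \<open>A shared edge has one colour, which by injectivity of \<open>slot\<close>
    belongs to one template. Inside that template the edge determines its index pair, and the index
    pair determines the matching.\<close>
  have disj: "i = i' \<and> l = l'"
    if il: "i < R" "l < r" "i' < R" "l' < r" and g: "g \<in> Mt (i, l)" "g \<in> Mt (i', l')" for i l i' l' g
  proof -
    obtain x where x: "x \<in> A" "g = ed i (x, f i l x)" using g(1) unfolding Mt_def ed_def by auto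
    obtain x' where x': "x' \<in> A" "g = ed i' (x', f i' l' x')" using g(2) unfolding Mt_def ed_def by auto
    have h: "(x, f i l x) \<in> H i" "(x', f i' l' x') \<in> H i'" using f(2) il x x' by auto
    then have "c g = slot g i" "c g = slot g i'" using x x' unfolding H_def by auto
    moreover have "i \<in> Cov g" "i' \<in> Cov g" using h HA x x' il unfolding Cov_def by blast+
    moreover have "g \<in> E" using h(1) x GE unfolding H_def by auto
    ultimately have ii: "i = i'" using slot[of g] by (auto simp: inj_on_def)
    have "(x, f i l x) = (x', f i l' x')"
      using inj_onD[OF inj[OF il(1)], of "(x, f i l x)" "(x', f i l' x')"] x x' h HA ii by blast
    then have "f i l x = f i l' x" by auto
    then show ?thesis using f(3)[OF il(1,2,4) x(1)] ii by simp
  qed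
  \<comment> \<open>Disjoint nonempty matchings are distinct, so no two index pairs collapse and the
    family has full size \<open>R * r\<close>.\<close>
  have neM: "Mt z \<noteq> {}" for z using \<nu> unfolding Mt_def A_def by (auto split: prod.splits)
  have "inj_on Mt ({..<R} \<times> {..<r})"
  proof (rule inj_onI)
    fix z z' assume z: "z \<in> {..<R} \<times> {..<r}" "z' \<in> {..<R} \<times> {..<r}" "Mt z = Mt z'"
    obtain g where "g \<in> Mt z" using neM by blast
    then show "z = z'" using disj[of "fst z" "snd z" "fst z'" "snd z'" g] z by (auto simp: prod_eq_iff)
  qed
  then have "card \<M> = R * r" unfolding \<M>_def by (simp add: card_image)
  moreover have "\<forall>M\<in>\<M>. perfect_matching n k E M" unfolding \<M>_def using pm by auto
  moreover have "\<forall>M1\<in>\<M>. \<forall>M2\<in>\<M>. M1 \<noteq> M2 \<longrightarrow> M1 \<inter> M2 = {}"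
    unfolding \<M>_def using disj by fastforce
  ultimately show ?thesis by blast
qed

end

section \<open>Choice of parameters\<close>

lemma inverse_one_plus_le_exp:
  fixes y :: real
  assumes "0 \<le> y" "y \<le> 1"
  shows "1 / (1 + y) \<le> exp (- (y / 2))"
proof -
  have "exp (y / 2) \<le> 1 + y / 2 + (y / 2)\<^sup>2" using assms by (intro exp_bound) auto
  also have "(y / 2)\<^sup>2 \<le> y / 2"
    using mult_left_mono[of y 2 y] assms by (simp add: power2_eq_square)
  finally have "exp (y / 2) \<le> 1 + y" by simp
  then show ?thesis using assms by (simp add: exp_minus inverse_eq_divide divide_left_mono)
qed

context template_setup
begin

text \<open>Parameters: \<open>x = \<epsilon>\<^sup>1\<^sup>/\<^sup>3\<close> and \<open>\<eta> = x / 4\<close>. \<open>R\<close> is such that an edge is covered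
  \<open>\<Lambda> \<approx> 8 k L / \<eta>\<^sup>2\<close> times up to a factor \<open>1 + 3\<eta>\<close>; this is just enough for the union bound over
  all edges, and it leaves degrees \<open>D / \<Lambda>\<close> large enough for the union bound over all cuts.\<close>

lemma packing_if_log_large:
  fixes x p :: real
  defines "\<epsilon> \<equiv> x ^ 3" and "L \<equiv> ln (real n)"
  assumes x: "0 < x" "x \<le> 1 / 192" and p: "0 < p" and pE: "p = real (card E) / real (n choose k)"
    and Ra: "\<And>S. S \<subseteq> {1..n} \<Longrightarrow> card S = a \<Longrightarrow>
      real (deg n k E S) \<ge> (1 - \<epsilon>) * real ((n - a) choose b) * p"
    and Rb: "\<And>S. S \<subseteq> {1..n} \<Longrightarrow> card S = b \<Longrightarrow>
      real (deg n k E S) \<ge> (1 - \<epsilon>) * real ((n - b) choose a) * p"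
    and Re: "\<And>S1 S2. S1 \<subseteq> {1..n} \<Longrightarrow> S2 \<subseteq> {1..n} \<Longrightarrow> card S1 = a \<Longrightarrow> card S2 = a \<Longrightarrow> S1 \<inter> S2 = {} \<Longrightarrow>
      real (card (nbhd n k E S1 \<inter> nbhd n k E S2)) \<le> (1 + \<epsilon>) * real ((n - 2 * a) choose b) * p\<^sup>2"
    and Rf: "\<And>S1 S2. S1 \<subseteq> {1..n} \<Longrightarrow> S2 \<subseteq> {1..n} \<Longrightarrow> card S1 = b \<Longrightarrow> card S2 = b \<Longrightarrow> S1 \<inter> S2 = {} \<Longrightarrow>
      real (card (nbhd n k E S1 \<inter> nbhd n k E S2)) \<le> (1 + \<epsilon>) * real ((n - 2 * b) choose a) * p\<^sup>2"
    and L: "1000000 * real k \<le> L" and growth: "L ^ 5 \<le> \<epsilon> * sqrt (real n) * p\<^sup>2"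
    and \<nu>: "\<nu> \<ge> 4"
  shows "\<exists>\<M>. (\<forall>M\<in>\<M>. perfect_matching n k E M) \<and> (\<forall>M1\<in>\<M>. \<forall>M2\<in>\<M>. M1 \<noteq> M2 \<longrightarrow> M1 \<inter> M2 = {}) \<and>
    (1 - 4 * x) * real (card E) / real \<nu> \<le> real (card \<M>)"
proof -
  interpret sw: template_setup n k \<nu> b a J I E
    using bs ab n E by unfold_locales (auto intro: block_system_swap)
  define U where "U = {1..n}"
  have k2: "real k \<ge> 2" using ab by linarith
  have L1: "L \<ge> 2 * 1000000" using L k2 by linarith
  have L0: "L > 0" "1 \<le> L" using L1 by auto
  have n4: "n \<ge> 4" using n \<nu> ab by (metis One_nat_def Suc_leI add_gr_0 le_trans mult.commute mult_le_mono2 mult_1_right)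
  have n0: "real n > 0" using n4 by simp
  have expL: "exp L = real n" unfolding L_def using n0 by simp
  have nk: "real n = real k * real \<nu>" using n by simp
  have v0: "real \<nu> > 0" using \<nu> by simp
  have kn: "k \<le> n" using n \<nu> by simp
  have C0: "real (n choose k) > 0" using kn by simp
  have finE: "finite E"
    by (rule finite_subset[of _ "Pow {1..n}"]) (use E in \<open>auto simp: uniform_hypergraph_def\<close>)
  have cE: "card E \<le> n choose k"
  proof -
    have "card E \<le> card {K. K \<subseteq> {1..n} \<and> card K = k}"
      using E by (intro card_mono finite_subset[of "{K. K \<subseteq> {1..n} \<and> card K = k}" "Pow {1..n}"])
        (auto simp: uniform_hypergraph_def)
    then show ?thesis by (simp add: n_subsets)
  qed
  have p1: "p \<le> 1" using cE C0 pE by simp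
  have mE: "real (card E) = p * real (n choose k)" using pE C0 by simp
  have p2: "p\<^sup>2 \<le> p" "p\<^sup>2 > 0" "p\<^sup>2 \<le> 1" using p p1 by (simp_all add: power2_eq_square mult_left_le mult_le_one)
  have \<epsilon>: "0 < \<epsilon>" "\<epsilon> \<le> x" "\<epsilon> \<le> 1 / 2"
  proof -
    show "0 < \<epsilon>" unfolding \<epsilon>_def using x by simp
    show "\<epsilon> \<le> x" unfolding \<epsilon>_def using x power_decreasing[of 1 3 x] by simp
    then show "\<epsilon> \<le> 1 / 2" using x by linarith
  qed
  have LL: "1000000000000 * (real k)\<^sup>2 \<le> L\<^sup>2"
    using power_mono[OF L, of 2] by (simp add: power_mult_distrib)
  have sq: "sqrt (real n) \<ge> 1" "sqrt (real n) * sqrt (real n) = real n" using n4 by auto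
  have W1: "L ^ 5 * sqrt (real n) \<le> \<epsilon> * p\<^sup>2 * real n"
  proof -
    have "L ^ 5 * sqrt (real n) \<le> \<epsilon> * sqrt (real n) * p\<^sup>2 * sqrt (real n)"
      using growth by (intro mult_right_mono) auto
    also have "\<dots> = \<epsilon> * p\<^sup>2 * (sqrt (real n) * sqrt (real n))" by (simp only: mult_ac)
    finally show ?thesis unfolding sq(2) .
  qed
  have W1': "L ^ 5 \<le> \<epsilon> * p\<^sup>2 * real n"
  proof -
    have "L ^ 5 * 1 \<le> L ^ 5 * sqrt (real n)" using sq(1) L0 by (intro mult_left_mono) auto
    then show ?thesis using W1 by linarith
  qed
  \<comment> \<open>The growth condition squared, for the exponents in which \<tau>^2 n appears;
    \<open>W1'\<close> is the linear form.\<close>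
  have W2: "L ^ 10 \<le> \<epsilon>\<^sup>2 * (p\<^sup>2)\<^sup>2 * real n"
  proof -
    have "L ^ 10 = (L ^ 5)\<^sup>2" by (simp flip: power_mult)
    also have "\<dots> \<le> (\<epsilon> * sqrt (real n) * p\<^sup>2)\<^sup>2" using growth L0 by (intro power_mono) auto
    also have "\<dots> = \<epsilon>\<^sup>2 * (p\<^sup>2)\<^sup>2 * real n" using n0 by (simp add: power_mult_distrib)
    finally show ?thesis .
  qed
  define D where "D = p * real \<nu>"
  have D0: "D > 0" unfolding D_def using p v0 by simp
  define \<tau> where "\<tau> = \<epsilon> * p\<^sup>2"
  have \<tau>: "0 < \<tau>" "\<tau> \<le> 1" unfolding \<tau>_def using \<epsilon> p2 by (auto intro!: mult_le_one)
  \<comment> \<open>The largest order of moment that the tail bound admits. It yields a tail of exp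
    (-\<tau> r / 8), whose exponent is \<tau>^2 n / (256 k^2) up to rounding.\<close>
  define r where "r = nat \<lfloor>\<tau> * real \<nu> / (32 * real k)\<rfloor>"
  define t where "t = (1 / (1 + \<tau> / 4)) ^ r"
  have r_le: "32 * real k * real r \<le> \<tau> * real \<nu>"
  proof -
    have "real r \<le> \<tau> * real \<nu> / (32 * real k)" unfolding r_def using \<tau> by (intro of_nat_floor) auto
    then show ?thesis using k2 by (simp add: field_simps)
  qed
  have t_le: "t \<le> 1 / real n ^ 4"
  proof -
    have "real r \<ge> \<tau> * real \<nu> / (32 * real k) - 1"
      unfolding r_def using \<tau> by linarith
    then have "\<tau> / 8 * (\<tau> * real \<nu> / (32 * real k) - 1) \<le> \<tau> / 8 * real r" using \<tau> by (intro mult_left_mono) auto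
    moreover have "\<tau> / 8 * (\<tau> * real \<nu> / (32 * real k) - 1) = (\<tau>\<^sup>2 * real n) / (256 * (real k)\<^sup>2) - \<tau> / 8"
      unfolding nk using k2 by (simp add: field_simps power2_eq_square)
    moreover have "5 * L \<le> (\<tau>\<^sup>2 * real n) / (256 * (real k)\<^sup>2)"
    proof -
      have "5 * L * (256 * (real k)\<^sup>2) \<le> L * (1000000000000 * (real k)\<^sup>2)"
        using L0 by (simp add: mult_left_mono)
      also have "\<dots> \<le> L * L\<^sup>2" using LL L0 by (intro mult_left_mono) auto
      also have "\<dots> = L ^ 3" by (simp add: power3_eq_cube power2_eq_square)
      also have "\<dots> \<le> L ^ 10" using L0 by (intro power_increasing) auto
      also have "\<dots> \<le> \<tau>\<^sup>2 * real n" using W2 unfolding \<tau>_def by (simp add: power_mult_distrib)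
      finally show ?thesis using k2 by (simp add: field_simps)
    qed
    ultimately have "4 * L \<le> \<tau> / 8 * real r" using \<tau> L0 by linarith
    have "t \<le> exp (- (\<tau> / 4 / 2)) ^ r"
      unfolding t_def using \<tau> by (intro power_mono inverse_one_plus_le_exp) auto
    also have "\<dots> = exp (- (\<tau> / 8 * real r))" by (simp add: exp_of_nat_mult[symmetric] mult.commute)
    also have "\<dots> \<le> exp (- (4 * L))" using \<open>4 * L \<le> \<tau> / 8 * real r\<close> by simp
    also have "\<dots> = 1 / real n ^ 4"
      using exp_of_nat_mult[of 4 L] by (simp add: exp_minus expL inverse_eq_divide)
    finally show ?thesis .
  qed
  define Bad where "Bad I J = {\<pi>. \<pi> permutes U \<and>
      \<not> bip_pseudorandom {..<\<nu>} {..<\<nu>} (template_graph E \<nu> I J \<pi>) D (3 * \<epsilon>)}" for I J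
  define \<Omega> where "\<Omega> = {\<pi>. \<pi> permutes U} - Bad I J - Bad J I"
  have finperm: "finite {\<pi>. \<pi> permutes U}" unfolding U_def by (intro finite_permutations) simp
  have bad1: "real (card (Bad I J)) \<le> 2 * (real \<nu>)\<^sup>2 * (t * fact n)"
    unfolding Bad_def U_def D_def t_def \<tau>_def
    using \<epsilon> p p1 r_le \<nu> by (intro card_not_pseudorandom Ra Re) (auto simp: \<tau>_def)
  have bad2: "real (card (Bad J I)) \<le> 2 * (real \<nu>)\<^sup>2 * (t * fact n)"
    unfolding Bad_def U_def D_def t_def \<tau>_def
    using \<epsilon> p p1 r_le \<nu> by (intro sw.card_not_pseudorandom Rb Rf) (auto simp: \<tau>_def)
  \<comment> \<open>This is what t \<le> 1 / n^4 was aimed at: 4 \<nu>^2 t \<le> 1 / n \<le>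
    \<epsilon>, so the bad templates of both kinds together are at most an
    \<epsilon>-fraction.\<close>
  have "2 * (real \<nu>)\<^sup>2 * (t * fact n) \<le> \<epsilon> / 2 * fact n"
  proof -
    have "real \<nu> \<le> real n" using nk k2 v0 by (simp add: mult_le_cancel_right1)
    then have "4 * (real \<nu>)\<^sup>2 * t \<le> 4 * (real n)\<^sup>2 * (1 / real n ^ 4)"
      using t_le \<tau> by (intro mult_mono power_mono) (auto simp: t_def)
    also have "\<dots> = 4 / (real n)\<^sup>2" using n0 by (simp add: field_simps power2_eq_square power4_eq_xxxx)
    also have "\<dots> \<le> 1 / real n" using n0 n4 by (simp add: field_simps power2_eq_square)
    also have "\<dots> \<le> \<epsilon>"
    proof -
      have "1 \<le> L ^ 5" using L0 by simp
      also have "\<dots> \<le> \<epsilon> * p\<^sup>2 * real n" by (rule W1')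
      also have "\<dots> \<le> \<epsilon> * 1 * real n" using p2 \<epsilon> by (intro mult_right_mono mult_left_mono) auto
      finally show ?thesis using n0 by (simp add: field_simps)
    qed
    finally have "4 * (real \<nu>)\<^sup>2 * t * (fact n / 2) \<le> \<epsilon> * (fact n / 2)" by (intro mult_right_mono) auto
    then show ?thesis by (simp add: mult_ac)
  qed
  then have "real (card (Bad I J)) + real (card (Bad J I)) \<le> \<epsilon> * fact n" using bad1 bad2 by linarith
  moreover have "fact n \<le> real (card \<Omega>) + real (card (Bad I J)) + real (card (Bad J I))"
  proof -
    have "{\<pi>. \<pi> permutes U} \<subseteq> \<Omega> \<union> Bad I J \<union> Bad J I" unfolding \<Omega>_def by auto
    then have "card {\<pi>. \<pi> permutes U} \<le> card (\<Omega> \<union> Bad I J \<union> Bad J I)"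
      using finperm by (intro card_mono) (auto simp: \<Omega>_def Bad_def)
    also have "\<dots> \<le> card \<Omega> + card (Bad I J) + card (Bad J I)"
      by (meson add_le_mono1 card_Un_le order_trans)
    finally have "real (fact n) \<le> real (card \<Omega> + card (Bad I J) + card (Bad J I))"
      using card_permutations[OF refl, of U] unfolding U_def by (simp only: of_nat_le_iff) simp
    then show ?thesis by simp
  qed
  ultimately have \<Omega>c: "(1 - \<epsilon>) * fact n \<le> real (card \<Omega>)" by (simp add: algebra_simps)
  have "0 < (1 - \<epsilon>) * fact n" using \<epsilon> by simp
  then have \<Omega>0: "real (card \<Omega>) > 0" using \<Omega>c by linarith
  then have \<Omega>ne: "\<Omega> \<noteq> {}" by auto
  have fin\<Omega>: "finite \<Omega>" unfolding \<Omega>_def using finperm by simp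
  define Cov where "Cov f = {\<pi>. \<exists>i<\<nu>. \<exists>j<\<nu>. \<pi> ` I i \<union> \<pi> ` J j = f}" for f :: "nat set"
  \<comment> \<open>Restricting to good templates raises the covering probability by at most the
    factor 1 / (1 - \<epsilon>).\<close>
  define \<rho> where "\<rho> = (real \<nu>)\<^sup>2 / (real (n choose k) * (1 - \<epsilon>))"
  have \<rho>0: "\<rho> > 0" unfolding \<rho>_def using v0 C0 \<epsilon> by simp
  have cov: "real (card (\<Omega> \<inter> Cov f)) \<le> \<rho> * real (card \<Omega>)" if "f \<in> E" for f
  proof -
    have f: "f \<subseteq> {1..n}" "card f = k" using E that by (auto simp: uniform_hypergraph_def)
    have "card (\<Omega> \<inter> Cov f) \<le> card {\<pi>. \<pi> permutes {1..n} \<and> (\<exists>i<\<nu>. \<exists>j<\<nu>. \<pi> ` I i \<union> \<pi> ` J j = f)}"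
      by (intro card_mono finite_subset[OF _ finperm]) (auto simp: \<Omega>_def Cov_def U_def)
    then have "real (card (\<Omega> \<inter> Cov f)) * real (n choose k)
        \<le> real (card {\<pi>. \<pi> permutes {1..n} \<and> (\<exists>i<\<nu>. \<exists>j<\<nu>. \<pi> ` I i \<union> \<pi> ` J j = f)}) * real (n choose k)"
      by (intro mult_right_mono) auto
    also have "\<dots> \<le> (real \<nu>)\<^sup>2 * fact n" by (rule card_covering_templates[OF f])
    also have "\<dots> = \<rho> * ((1 - \<epsilon>) * fact n) * real (n choose k)" unfolding \<rho>_def using C0 \<epsilon> by simp
    also have "\<dots> \<le> \<rho> * real (card \<Omega>) * real (n choose k)"
      using \<Omega>c \<rho>0 by (intro mult_right_mono mult_left_mono) auto
    finally show ?thesis using C0 by simp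
  qed
  have \<nu>C: "(real \<nu>)\<^sup>2 \<le> real (n choose k)"
  proof -
    have "real \<nu> = real n / real k" using nk k2 by simp
    then have "real \<nu> ^ k \<le> real (n choose k)" using binomial_ge_n_over_k_pow_k[OF kn, where 'a = real] by simp
    moreover have "(real \<nu>)\<^sup>2 \<le> real \<nu> ^ k" using \<nu> k2 by (intro power_increasing) auto
    ultimately show ?thesis by linarith
  qed
  have \<rho>2: "\<rho> \<le> 2"
  proof -
    have "real (n choose k) * 1 \<le> real (n choose k) * (2 * (1 - \<epsilon>))" using C0 \<epsilon> by (intro mult_left_mono) auto
    then have "(real \<nu>)\<^sup>2 \<le> 2 * (real (n choose k) * (1 - \<epsilon>))" using \<nu>C by linarith
    then show ?thesis unfolding \<rho>_def using C0 \<epsilon> by (simp add: divide_le_eq)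
  qed
  define \<eta> where "\<eta> = x / 4"
  have \<eta>: "0 < \<eta>" "\<eta> \<le> 1 / 4" unfolding \<eta>_def using x by auto
  have \<eta>2: "0 < \<eta>\<^sup>2" "\<eta>\<^sup>2 \<le> \<eta>" "\<eta>\<^sup>2 \<le> 1"
    using \<eta> by (auto simp: power2_eq_square mult_left_le mult_le_one)
  \<comment> \<open>Target for the mean multiplicity \<rho> R. The union bound over at most n^k
    edges must beat exp (k L), and the exponent gained has order \<eta>^2 y; also \<eta> y \<ge> 1,
    so that rounding by 1 costs at most a relative \<eta>.\<close>
  define y where "y = 8 * real k * L / \<eta>\<^sup>2"
  have kL: "real k * L \<ge> 1" using k2 L0 mult_mono[of 1 "real k" 1 L] by simp
  have y8: "8 * (real k * L) \<le> \<eta> * y" "\<eta>\<^sup>2 * y = 8 * (real k * L)" "8 * (real k * L) \<le> y"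
  proof -
    show e: "\<eta>\<^sup>2 * y = 8 * (real k * L)" unfolding y_def using \<eta> by simp
    have y0: "y \<ge> 0" unfolding y_def using L0 by simp
    show "8 * (real k * L) \<le> \<eta> * y" using mult_right_mono[OF \<eta>2(2) y0] e by linarith
    show "8 * (real k * L) \<le> y" using mult_right_mono[OF \<eta>2(3) y0] e by linarith
  qed
  define R where "R = nat \<lceil>y / \<rho>\<rceil>"
  have y0: "y \<ge> 8" using y8 kL by linarith
  have R1: "y \<le> \<rho> * real R"
  proof -
    have "y / \<rho> \<le> real R" unfolding R_def by (rule real_nat_ceiling_ge)
    then show ?thesis using \<rho>0 by (simp add: field_simps)
  qed
  have R2: "real R \<le> y / \<rho> + 1" unfolding R_def using y0 \<rho>0 of_nat_ceiling[of "y / \<rho>"]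
    by (smt (verit) ceiling_correct divide_nonneg_pos of_nat_nat zero_le_ceiling)
  have R3: "\<rho> * real R \<le> y + 2"
  proof -
    have "\<rho> * real R \<le> \<rho> * (y / \<rho> + 1)" using R2 \<rho>0 by (intro mult_left_mono) auto
    also have "\<dots> = y + \<rho>" using \<rho>0 by (simp add: field_simps)
    finally show ?thesis using \<rho>2 by linarith
  qed
  \<comment> \<open>The factor 1 + 2 \<eta>, rather than 1 + \<eta>, is the room in which the
    exponential moment wins; rounding up costs the third \<eta>.\<close>
  define \<Lambda> where "\<Lambda> = nat \<lceil>(1 + 2 * \<eta>) * (\<rho> * real R)\<rceil>"
  have pos: "0 \<le> (1 + 2 * \<eta>) * (\<rho> * real R)" using \<eta> \<rho>0 by simp
  have \<Lambda>1: "(1 + 2 * \<eta>) * (\<rho> * real R) \<le> real \<Lambda>" unfolding \<Lambda>_def by (rule real_nat_ceiling_ge)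
  have \<Lambda>2: "real \<Lambda> \<le> (1 + 2 * \<eta>) * (\<rho> * real R) + 1"
    unfolding \<Lambda>_def using pos by linarith
  have \<Lambda>3: "real \<Lambda> \<le> (1 + 3 * \<eta>) * (\<rho> * real R)"
  proof -
    have "1 \<le> \<eta> * y" using y8 kL by linarith
    also have "\<dots> \<le> \<eta> * (\<rho> * real R)" using R1 \<eta> by (intro mult_left_mono) auto
    finally show ?thesis using \<Lambda>2 by (simp add: algebra_simps)
  qed
  have \<Lambda>y: "y \<le> real \<Lambda>"
  proof -
    have "y \<le> 1 * (\<rho> * real R)" using R1 by simp
    also have "\<dots> \<le> (1 + 2 * \<eta>) * (\<rho> * real R)" using \<eta> \<rho>0 by (intro mult_right_mono) auto
    finally show ?thesis using \<Lambda>1 by linarith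
  qed
  have \<Lambda>4: "\<eta>\<^sup>2 * real \<Lambda> \<le> 20 * (real k * L)"
  proof -
    have "real \<Lambda> \<le> (1 + 3 * \<eta>) * (\<rho> * real R)" by (rule \<Lambda>3)
    also have "\<dots> \<le> 2 * (y + 2)" using \<eta> R3 \<rho>0 by (intro mult_mono) auto
    finally have "\<eta>\<^sup>2 * real \<Lambda> \<le> \<eta>\<^sup>2 * (2 * (y + 2))" using \<eta>2 by (intro mult_left_mono) auto
    also have "\<dots> = 16 * (real k * L) + 4 * \<eta>\<^sup>2" using y8(2) by (simp add: algebra_simps)
    finally show ?thesis using kL \<eta>2 by linarith
  qed
  have \<Lambda>0: "\<Lambda> > 0" using \<Lambda>y y0 by linarith
  have nkexp: "real n ^ k = exp (real k * L)" by (simp add: exp_of_nat_mult expL)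
  have Cn: "real (n choose k) \<le> real n ^ k"
    using binomial_le_pow[OF kn] by (metis of_nat_le_iff of_nat_power)
  have sample: "real (card E) * (1 + \<eta> * \<rho>) ^ R < (1 + \<eta>) ^ Suc \<Lambda>"
  proof -
    have "(1 + \<eta> * \<rho>) ^ R \<le> exp (\<eta> * \<rho>) ^ R"
      using \<eta> \<rho>0 exp_ge_add_one_self by (intro power_mono) auto
    also have "\<dots> = exp (\<eta> * (\<rho> * real R))" by (simp add: exp_of_nat_mult[symmetric] mult_ac)
    finally have "real (card E) * (1 + \<eta> * \<rho>) ^ R \<le> exp (real k * L) * exp (\<eta> * (\<rho> * real R))"
      using cE Cn nkexp \<eta> \<rho>0 by (intro mult_mono) (auto intro: order_trans)
    also have "\<dots> = exp (real k * L + \<eta> * (\<rho> * real R))" by (simp add: exp_add)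
    also have "\<dots> < exp ((\<eta> - \<eta>\<^sup>2) * real (Suc \<Lambda>))"
    proof -
      \<comment> \<open>As ln (1 + \<eta>) \<ge> \<eta> - \<eta>^2, the allowed exponent per unit of
        \<rho> R is at least \<eta> + \<eta>^2 / 2, and the surplus \<eta>^2 / 2 times \<rho> R is
        at least 4 k L.\<close>
      have "\<eta>\<^sup>2 * \<eta> \<le> \<eta>\<^sup>2 * (1 / 4)" using \<eta> by (intro mult_left_mono) auto
      then have "\<eta> + \<eta>\<^sup>2 / 2 \<le> (\<eta> - \<eta>\<^sup>2) * (1 + 2 * \<eta>)" by (simp add: algebra_simps power2_eq_square)
      then have "(\<eta> + \<eta>\<^sup>2 / 2) * (\<rho> * real R) \<le> (\<eta> - \<eta>\<^sup>2) * (1 + 2 * \<eta>) * (\<rho> * real R)"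
        using \<rho>0 by (intro mult_right_mono) auto
      also have "\<dots> = (\<eta> - \<eta>\<^sup>2) * ((1 + 2 * \<eta>) * (\<rho> * real R))" by simp
      also have "\<dots> \<le> (\<eta> - \<eta>\<^sup>2) * real (Suc \<Lambda>)" using \<Lambda>1 \<eta>2 by (intro mult_left_mono) auto
      finally have "\<eta> * (\<rho> * real R) + \<eta>\<^sup>2 * (\<rho> * real R) / 2 \<le> (\<eta> - \<eta>\<^sup>2) * real (Suc \<Lambda>)"
        by (simp add: distrib_right)
      moreover have "8 * (real k * L) \<le> \<eta>\<^sup>2 * (\<rho> * real R)"
        using mult_left_mono[OF R1, of "\<eta>\<^sup>2"] y8(2) by simp
      ultimately have "real k * L + \<eta> * (\<rho> * real R) < (\<eta> - \<eta>\<^sup>2) * real (Suc \<Lambda>)" using kL by linarith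
      then show ?thesis by simp
    qed
    also have "\<dots> \<le> exp (ln (1 + \<eta>) * real (Suc \<Lambda>))"
      using ln_one_plus_pos_lower_bound[of \<eta>] \<eta> by (simp add: mult_right_mono del: of_nat_Suc)
    also have "\<dots> = exp (ln (1 + \<eta>)) ^ Suc \<Lambda>" by (simp add: exp_of_nat2_mult del: of_nat_Suc)
    also have "\<dots> = (1 + \<eta>) ^ Suc \<Lambda>" using \<eta> by simp
    finally show ?thesis .
  qed
  obtain g where g: "\<And>i. i < R \<Longrightarrow> g i \<in> \<Omega>" "\<And>f. f \<in> E \<Longrightarrow> card {i. i < R \<and> g i \<in> Cov f} \<le> \<Lambda>"
    using exists_sample_bounded_cover[where Cov = Cov, OF fin\<Omega> \<Omega>ne finE \<eta>(1) less_imp_le[OF \<rho>0] cov sample] by blast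
  have x3: "\<eta>\<^sup>2 * \<eta> = \<epsilon> / 64" unfolding \<eta>_def \<epsilon>_def by (simp add: power2_eq_square power3_eq_cube)
  \<comment> \<open>The thinned degree D / \<Lambda> is at least 2 / \<eta>, so rounding it down
    costs a relative \<eta> at most. Since \<eta>^2 \<Lambda> \<le> 20 k L, it is enough that
    \<eta>^3 D = \<epsilon> D / 64 is at least 40 k L.\<close>
  have \<eta>D: "2 * real \<Lambda> \<le> \<eta> * D"
  proof -
    have "40 * (real k * L) * (64 * real k) = L * (2560 * (real k)\<^sup>2)" by (simp add: power2_eq_square)
    also have "\<dots> \<le> L * (1000000000000 * (real k)\<^sup>2)" using L0 by (intro mult_left_mono mult_right_mono) auto
    also have "\<dots> \<le> L * L\<^sup>2" using LL L0 by (intro mult_left_mono) auto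
    also have "\<dots> = L ^ 3" by (simp add: power3_eq_cube power2_eq_square)
    also have "\<dots> \<le> L ^ 5" using L0 by (intro power_increasing) auto
    also have "\<dots> \<le> \<epsilon> * p\<^sup>2 * real n" by (rule W1')
    also have "\<dots> \<le> \<epsilon> * p * real n" using p2 \<epsilon> n0 by (intro mult_right_mono mult_left_mono) auto
    also have "\<dots> = \<eta>\<^sup>2 * (\<eta> * D) * (64 * real k)" using x3 unfolding D_def nk by (simp add: mult_ac)
    finally have "40 * (real k * L) \<le> \<eta>\<^sup>2 * (\<eta> * D)"
      by (rule mult_right_le_imp_le) (use k2 in auto)
    then have "\<eta>\<^sup>2 * (2 * real \<Lambda>) \<le> \<eta>\<^sup>2 * (\<eta> * D)" using \<Lambda>4 by linarith
    then show ?thesis using \<eta>2(1) by simp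
  qed
  define u where "u = exp (- (\<eta>\<^sup>2 * D / (16 * real \<Lambda>)))"
  \<comment> \<open>The exponent k + 5 pays for at most 2 n^(k + 1) templates and for a factor \<nu>
    \<le> n from the cuts, and leaves n^(-3).\<close>
  have u_le: "u \<le> 1 / real n ^ (k + 5)"
  proof -
    have lam: "real \<Lambda> > 0" using \<Lambda>0 by simp
    have "\<epsilon>\<^sup>2 \<le> 256 * (\<eta>\<^sup>2 * \<eta>\<^sup>2)"
    proof -
      have "\<epsilon>\<^sup>2 = x ^ 6" unfolding \<epsilon>_def by (simp flip: power_mult)
      also have "\<dots> \<le> x ^ 4" using x by (intro power_decreasing) auto
      also have "\<dots> = 256 * (\<eta>\<^sup>2 * \<eta>\<^sup>2)" unfolding \<eta>_def by (simp add: power2_eq_square power4_eq_xxxx)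
      finally show ?thesis .
    qed
    moreover have "(p\<^sup>2)\<^sup>2 \<le> p"
      using p2 p mult_mono[of "p\<^sup>2" p "p\<^sup>2" 1] by (simp add: power2_eq_square[of "p\<^sup>2"])
    ultimately have "\<epsilon>\<^sup>2 * (p\<^sup>2)\<^sup>2 * real n \<le> 256 * (\<eta>\<^sup>2 * \<eta>\<^sup>2) * p * real n"
      using p by (intro mult_mono) auto
    also have "\<dots> = 256 * real k * (\<eta>\<^sup>2 * (\<eta>\<^sup>2 * D))" unfolding nk D_def by (simp add: mult_ac)
    finally have 1: "L ^ 10 \<le> 256 * real k * (\<eta>\<^sup>2 * (\<eta>\<^sup>2 * D))" using W2 by linarith
    have "(real k + 5) * L * (16 * (20 * (real k * L))) * (256 * real k) = 81920 * (real k + 5) * (real k)\<^sup>2 * L\<^sup>2"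
      by (simp add: power2_eq_square)
    also have "\<dots> \<le> 81920 * (1000000 * real k) * (real k)\<^sup>2 * L\<^sup>2"
      using k2 by (intro mult_right_mono mult_left_mono) auto
    also have "\<dots> \<le> 81920 * L * (real k)\<^sup>2 * L\<^sup>2" using L by (intro mult_right_mono mult_left_mono) auto
    also have "\<dots> = L ^ 3 * (81920 * (real k)\<^sup>2)" by (simp add: power2_eq_square power3_eq_cube)
    also have "\<dots> \<le> L ^ 3 * (1000000000000 * (real k)\<^sup>2)" using L0 by (intro mult_left_mono mult_right_mono) auto
    also have "\<dots> \<le> L ^ 3 * L\<^sup>2" using LL L0 by (intro mult_left_mono) auto
    also have "\<dots> = L ^ 5" by (simp flip: power_add)
    also have "\<dots> \<le> L ^ 10" using L0 by (intro power_increasing) auto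
    also have "\<dots> \<le> \<eta>\<^sup>2 * (\<eta>\<^sup>2 * D) * (256 * real k)" using 1 by (simp add: mult_ac)
    finally have 2: "(real k + 5) * L * (16 * (20 * (real k * L))) \<le> \<eta>\<^sup>2 * (\<eta>\<^sup>2 * D)"
      by (rule mult_right_le_imp_le) (use k2 in auto)
    have "(real k + 5) * L * (16 * (\<eta>\<^sup>2 * real \<Lambda>)) \<le> (real k + 5) * L * (16 * (20 * (real k * L)))"
      using \<Lambda>4 L0 by (intro mult_left_mono) auto
    then have "\<eta>\<^sup>2 * ((real k + 5) * L * (16 * real \<Lambda>)) \<le> \<eta>\<^sup>2 * (\<eta>\<^sup>2 * D)" using 2 by (simp add: mult_ac)
    then have "(real k + 5) * L * (16 * real \<Lambda>) \<le> \<eta>\<^sup>2 * D"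
      by (rule mult_left_le_imp_le) (rule \<eta>2(1))
    then have "(real k + 5) * L \<le> \<eta>\<^sup>2 * D / (16 * real \<Lambda>)" using lam by (simp add: le_divide_eq)
    then have "u \<le> exp (- ((real k + 5) * L))" unfolding u_def by simp
    also have "\<dots> = 1 / real n ^ (k + 5)"
      using exp_of_nat_mult[of "k + 5" L] by (simp add: exp_minus expL inverse_eq_divide)
    finally show ?thesis .
  qed
  have u0: "u \<ge> 0" unfolding u_def by simp
  have small: "real R * (2 * (((1 + u) ^ \<nu> - 1) * (1 + u) ^ \<nu>)) < 1"
  proof -
    have vn: "real \<nu> \<le> real n" using nk k2 v0 by (simp add: mult_le_cancel_right1)
    have uv: "u * real \<nu> \<le> 1 / real n ^ (k + 4)"
    proof -
      have "u * real \<nu> \<le> 1 / real n ^ (k + 5) * real n" using u_le u0 vn by (intro mult_mono) auto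
      also have "\<dots> = 1 / real n ^ (k + 4)" using n0 by (simp add: field_simps eval_nat_numeral)
      finally show ?thesis .
    qed
    have "real n ^ (k + 4) \<ge> 1" using n4 by simp
    then have uv1: "u * real \<nu> \<le> 1" using uv by (smt (verit) divide_le_eq_1)
    have "(1 + u) ^ \<nu> \<le> exp u ^ \<nu>" using u0 exp_ge_add_one_self by (intro power_mono) auto
    also have "\<dots> = exp (u * real \<nu>)" by (simp add: exp_of_nat_mult[symmetric] mult.commute)
    also have "\<dots> \<le> 1 + u * real \<nu> + (u * real \<nu>)\<^sup>2" using uv1 u0 by (intro exp_bound) auto
    also have "(u * real \<nu>)\<^sup>2 \<le> u * real \<nu>" using uv1 u0 by (simp add: power2_eq_square mult_left_le)
    finally have pw: "(1 + u) ^ \<nu> \<le> 1 + 2 * (u * real \<nu>)" by simp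
    have "((1 + u) ^ \<nu> - 1) * (1 + u) ^ \<nu> \<le> 2 * (u * real \<nu>) * 3"
      using pw uv1 u0 by (intro mult_mono) (auto simp: one_le_power)
    also have "\<dots> \<le> 6 * (1 / real n ^ (k + 4))" using uv by simp
    finally have 1: "((1 + u) ^ \<nu> - 1) * (1 + u) ^ \<nu> \<le> 6 / real n ^ (k + 4)" by simp
    have yn: "y \<le> real n"
    proof -
      have "y \<le> 2 * real \<Lambda>" using \<Lambda>y y0 by linarith
      also have "\<dots> \<le> 1 * D" using \<eta>D mult_right_mono[of \<eta> 1 D] \<eta> D0 by linarith
      also have "\<dots> \<le> 1 * real \<nu>" unfolding D_def using p1 v0 by (simp add: mult_le_cancel_right1)
      finally show ?thesis using vn by simp
    qed
    have "y / \<rho> \<le> real n * real n ^ k"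
    proof -
      have "1 / \<rho> = real (n choose k) * (1 - \<epsilon>) / (real \<nu>)\<^sup>2" unfolding \<rho>_def by simp
      also have "\<dots> \<le> real (n choose k) * 1 / 1"
        using \<epsilon> \<nu> C0 by (intro frac_le mult_mono) auto
      finally have "1 / \<rho> \<le> real n ^ k" using Cn by linarith
      then have "y * (1 / \<rho>) \<le> real n * real n ^ k" using yn y0 \<rho>0 by (intro mult_mono) auto
      then show ?thesis by simp
    qed
    moreover have "1 \<le> real n * real n ^ k" using n4 one_le_power[of "real n" "Suc k"] by simp
    ultimately have "real R \<le> 2 * real n ^ (k + 1)" using R2 by simp
    then have "real R * (2 * (((1 + u) ^ \<nu> - 1) * (1 + u) ^ \<nu>)) \<le> 2 * real n ^ (k + 1) * (2 * (6 / real n ^ (k + 4)))"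
      using 1 u0 by (intro mult_mono) (auto simp: one_le_power)
    also have "\<dots> = 24 / real n ^ 3" using n0 by (simp add: field_simps eval_nat_numeral)
    also have "\<dots> < 1"
    proof -
      have "real n ^ 3 \<ge> 4 ^ 3" using n4 by (intro power_mono) auto
      then show ?thesis using n0 by simp
    qed
    finally show ?thesis .
  qed
  define r' where "r' = nat \<lfloor>(1 - \<eta>) * ((1 - x) * D) / real \<Lambda>\<rfloor>"
  have nonneg: "0 \<le> (1 - \<eta>) * ((1 - x) * D) / real \<Lambda>" using \<eta> x D0 by simp
  have r'1: "real r' \<le> (1 - \<eta>) * ((1 - x) * D) / real \<Lambda>"
    unfolding r'_def using nonneg by (rule of_nat_floor)
  have r'2: "(1 - \<eta>) * ((1 - x) * D) / real \<Lambda> - 1 \<le> real r'" unfolding r'_def using nonneg by linarith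
  have "\<exists>\<M>. (\<forall>M\<in>\<M>. perfect_matching n k E M) \<and> (\<forall>M1\<in>\<M>. \<forall>M2\<in>\<M>. M1 \<noteq> M2 \<longrightarrow> M1 \<inter> M2 = {}) \<and>
    card \<M> = R * r'"
  proof (rule packing_from_templates[where \<pi> = g and D = D and e = "3 * \<epsilon>" and \<delta> = x and \<eta> = \<eta> and u = u and \<Lambda> = \<Lambda>])
    show "g i permutes {1..n}" if "i < R" for i using g(1)[OF that] unfolding \<Omega>_def U_def by auto
    show "bip_pseudorandom {..<\<nu>} {..<\<nu>} (template_graph E \<nu> I J (g i)) D (3 * \<epsilon>)" if "i < R" for i
      using g(1)[OF that] unfolding \<Omega>_def Bad_def by auto
    show "bip_pseudorandom {..<\<nu>} {..<\<nu>} (template_graph E \<nu> J I (g i)) D (3 * \<epsilon>)" if "i < R" for i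
      using g(1)[OF that] unfolding \<Omega>_def Bad_def by auto
    show "real \<nu> \<le> 3 * \<epsilon> * D\<^sup>2"
    proof -
      have "real k * 1 \<le> L * L ^ 4" using L k2 L0 by (intro mult_mono) auto
      also have "\<dots> = L ^ 5" by (simp add: eval_nat_numeral)
      also have "\<dots> \<le> \<epsilon> * p\<^sup>2 * real n" by (rule W1')
      also have "\<dots> = real k * (\<epsilon> * p\<^sup>2 * real \<nu>)" unfolding nk by simp
      finally have "1 \<le> \<epsilon> * p\<^sup>2 * real \<nu>" using k2 by simp
      then have "1 * real \<nu> \<le> 3 * (\<epsilon> * p\<^sup>2 * real \<nu>) * real \<nu>" using v0 by (intro mult_right_mono) auto
      then show ?thesis unfolding D_def by (simp add: power2_eq_square mult_ac)
    qed
    show "64 * (3 * \<epsilon>) \<le> x\<^sup>2"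
      using mult_right_mono[of "192 * x" 1 "x\<^sup>2"] x unfolding \<epsilon>_def by (simp add: power2_eq_square power3_eq_cube)
    show "card {i. i < R \<and> (\<exists>x<\<nu>. \<exists>y<\<nu>. g i ` I x \<union> g i ` J y = f)} \<le> \<Lambda>" if "f \<in> E" for f
      using g(2)[OF that] unfolding Cov_def by simp
    show "exp (- (\<eta>\<^sup>2 * D / (16 * real \<Lambda>))) \<le> u" unfolding u_def by simp
  qed (use \<nu> D0 \<epsilon> x \<eta> \<Lambda>0 small r'1 in auto)
  then obtain \<M> where \<M>: "\<forall>M\<in>\<M>. perfect_matching n k E M" "\<forall>M1\<in>\<M>. \<forall>M2\<in>\<M>. M1 \<noteq> M2 \<longrightarrow> M1 \<inter> M2 = {}"
    "card \<M> = R * r'" by blast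
  define Z where "Z = D / real \<Lambda>"
  have lam: "real \<Lambda> > 0" using \<Lambda>0 by simp
  have R0: "real R > 0" using R1 y0 \<rho>0 by (smt (verit) mult_nonneg_nonpos)
  have m0: "real (card E) / real \<nu> \<ge> 0" by simp
  have Z: "2 \<le> \<eta> * Z" unfolding Z_def using \<eta>D lam by (simp add: le_divide_eq)
  \<comment> \<open>The multiplicity cancels up to its overshoot: R D / \<Lambda> is at least D /
    (\<rho> (1 + 3 \<eta>)), and D / \<rho> equals (1 - \<epsilon>) m / \<nu>.\<close>
  have RZ: "(1 - 3 * \<eta>) * ((1 - \<epsilon>) * (real (card E) / real \<nu>)) \<le> real R * Z"
  proof -
    have "D / \<rho> = (1 - \<epsilon>) * (real (card E) / real \<nu>)"
      unfolding D_def \<rho>_def mE using v0 C0 \<epsilon> by (simp add: field_simps power2_eq_square)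
    moreover have "real R * (D / ((1 + 3 * \<eta>) * (\<rho> * real R))) \<le> real R * Z"
      unfolding Z_def using \<Lambda>3 lam D0 by (intro mult_left_mono divide_left_mono) auto
    moreover have "real R * (D / ((1 + 3 * \<eta>) * (\<rho> * real R))) = 1 / (1 + 3 * \<eta>) * (D / \<rho>)"
      using R0 by simp
    moreover have "(1 - 3 * \<eta>) * (D / \<rho>) \<le> 1 / (1 + 3 * \<eta>) * (D / \<rho>)"
    proof (intro mult_right_mono)
      have "(1 - 3 * \<eta>) * (1 + 3 * \<eta>) \<le> 1" by (simp add: algebra_simps)
      then show "1 - 3 * \<eta> \<le> 1 / (1 + 3 * \<eta>)" using \<eta> by (simp add: le_divide_eq)
    qed (use D0 \<rho>0 in auto)
    ultimately show ?thesis by simp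
  qed
  have "(1 - 4 * x) * real (card E) / real \<nu> = (1 - 4 * x) * (real (card E) / real \<nu>)" by simp
  \<comment> \<open>Loss budget: \<eta> from the colouring, \<eta> from rounding the degree, 3
    \<eta> from \<Lambda>, \<open>x\<close> from the cuts and \<epsilon> from bad templates; with
    \<eta> = x / 4 and \<epsilon> \<le> x this is at most 13 x / 4.\<close>
  also have "\<dots> \<le> (1 - 2 * \<eta> - x) * ((1 - 3 * \<eta>) * (1 - \<epsilon>)) * (real (card E) / real \<nu>)"
  proof (intro mult_right_mono m0)
    have "1 - 3 * \<eta> - \<epsilon> \<le> (1 - 3 * \<eta>) * (1 - \<epsilon>)" using \<eta> \<epsilon> by (simp add: algebra_simps)
    then have "(1 - 2 * \<eta> - x) * (1 - 3 * \<eta> - \<epsilon>) \<le> (1 - 2 * \<eta> - x) * ((1 - 3 * \<eta>) * (1 - \<epsilon>))"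
      using x by (intro mult_left_mono) (auto simp: \<eta>_def)
    moreover have "(1 - 2 * \<eta> - x) * (1 - 3 * \<eta> - \<epsilon>) = 1 - (2 * \<eta> + x) - (3 * \<eta> + \<epsilon>) + (2 * \<eta> + x) * (3 * \<eta> + \<epsilon>)"
      by (simp add: algebra_simps)
    moreover have "0 \<le> (2 * \<eta> + x) * (3 * \<eta> + \<epsilon>)" using \<eta> x \<epsilon> by simp
    moreover have "5 * \<eta> + x + \<epsilon> \<le> 4 * x" using \<epsilon> x unfolding \<eta>_def by linarith
    ultimately show "1 - 4 * x \<le> (1 - 2 * \<eta> - x) * ((1 - 3 * \<eta>) * (1 - \<epsilon>))" by linarith
  qed
  also have "\<dots> = (1 - 2 * \<eta> - x) * ((1 - 3 * \<eta>) * ((1 - \<epsilon>) * (real (card E) / real \<nu>)))" by simp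
  also have "\<dots> \<le> (1 - 2 * \<eta> - x) * (real R * Z)"
    using RZ x by (intro mult_left_mono) (auto simp: \<eta>_def)
  also have "\<dots> = real R * ((1 - 2 * \<eta> - x) * Z)" by simp
  also have "\<dots> \<le> real R * real r'"
  proof (intro mult_left_mono)
    have "Z \<ge> 0" unfolding Z_def using D0 lam by simp
    then have "(1 - \<eta> - x) * Z \<le> (1 - \<eta>) * (1 - x) * Z"
      using \<eta> x by (intro mult_right_mono) (auto simp: algebra_simps)
    moreover have "(1 - \<eta>) * ((1 - x) * D) / real \<Lambda> = (1 - \<eta>) * (1 - x) * Z" unfolding Z_def by simp
    moreover have "(1 - 2 * \<eta> - x) * Z = (1 - \<eta> - x) * Z - \<eta> * Z" by (simp add: algebra_simps)
    ultimately show "(1 - 2 * \<eta> - x) * Z \<le> real r'" using r'2 Z by linarith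
  qed auto
  also have "\<dots> = real (card \<M>)" using \<M>(3) by simp
  finally show ?thesis using \<M>(1,2) by blast
qed

end

section \<open>From the limit hypotheses to a fixed large n\<close>

theorem theorem5:
  fixes k :: nat and p \<epsilon> :: "nat \<Rightarrow> real"
  assumes k2: "k \<ge> 2"
    and eps_lim: "((\<lambda>j. \<epsilon> (k * j)) \<longlongrightarrow> 0) sequentially"
    and growth: "filterlim (\<lambda>j. \<epsilon> (k * j) * sqrt (real (k * j)) * (p (k * j))\<^sup>2
                               / (ln (real (k * j))) ^ 5) at_top sequentially"
  shows "\<exists>N. \<forall>n \<ge> N. k dvd n \<longrightarrow>
    (\<forall>E :: nat set set.
      let kX = k div 2; kY = k - k div 2; m = card E; e = \<epsilon> n; q = p n in
      uniform_hypergraph n k E \<and>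
      q = real m / real (n choose k) \<and>
      (\<forall>S. S \<subseteq> {1..n} \<and> card S = kX \<longrightarrow>
         int (deg n k E S) \<ge> \<lceil>(1 - e) * real ((n - kX) choose kY) * q\<rceil>) \<and>
      (\<forall>S. S \<subseteq> {1..n} \<and> card S = kY \<longrightarrow>
         int (deg n k E S) \<ge> \<lceil>(1 - e) * real ((n - kY) choose kX) * q\<rceil>) \<and>
      (\<forall>S. S \<subseteq> {1..n} \<and> card S = kX + 1 \<longrightarrow>
         int (deg n k E S) \<le> \<lceil>(1 + e) * real ((n - kX - 1) choose (kY - 1)) * q\<rceil>) \<and>
      (\<forall>S. S \<subseteq> {1..n} \<and> card S = kY + 1 \<longrightarrow>
         int (deg n k E S) \<le> \<lceil>(1 + e) * real ((n - kY - 1) choose (kX - 1)) * q\<rceil>) \<and>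
      (\<forall>S1 S2. S1 \<subseteq> {1..n} \<and> S2 \<subseteq> {1..n} \<and> card S1 = kX \<and> card S2 = kX \<and> S1 \<inter> S2 = {} \<longrightarrow>
         int (card (nbhd n k E S1 \<inter> nbhd n k E S2))
           \<le> \<lfloor>(1 + e) * real ((n - 2 * kX) choose kY) * q\<^sup>2\<rfloor>) \<and>
      (\<forall>S1 S2. S1 \<subseteq> {1..n} \<and> S2 \<subseteq> {1..n} \<and> card S1 = kY \<and> card S2 = kY \<and> S1 \<inter> S2 = {} \<longrightarrow>
         int (card (nbhd n k E S1 \<inter> nbhd n k E S2))
           \<le> \<lfloor>(1 + e) * real ((n - 2 * kY) choose kX) * q\<^sup>2\<rfloor>)
      \<longrightarrow>
      (\<exists>\<M> :: nat set set set.
         (\<forall>M\<in>\<M>. perfect_matching n k E M) \<and>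
         (\<forall>M1\<in>\<M>. \<forall>M2\<in>\<M>. M1 \<noteq> M2 \<longrightarrow> M1 \<inter> M2 = {}) \<and>
         real (card \<M>) \<ge> (1 - 4 * e powr (1/3)) * real m / (real n / real k)))"
proof -
  have k0: "k > 0" using k2 by simp
  have "\<forall>\<^sub>F j in sequentially. \<epsilon> (k * j) < (1 / 192) ^ 3"
    using eps_lim by (rule order_tendstoD) simp
  \<comment> \<open>Divergence enters as an eventual lower bound 1; all constants are absorbed by
    powers of ln n, which is eventually at least 1000000 k.\<close>
  moreover have "\<forall>\<^sub>F j in sequentially.
      1 \<le> \<epsilon> (k * j) * sqrt (real (k * j)) * (p (k * j))\<^sup>2 / (ln (real (k * j))) ^ 5"
    using growth by (simp add: filterlim_at_top)
  moreover have "\<forall>\<^sub>F j in sequentially. 1000000 * real k \<le> ln (real (k * j))"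
  proof -
    have "filterlim (\<lambda>j. real k * real j) at_top sequentially"
      using k0 by (intro filterlim_tendsto_pos_mult_at_top[OF tendsto_const] filterlim_real_sequentially) auto
    then have "filterlim (\<lambda>j. ln (real (k * j))) at_top sequentially"
      by (intro filterlim_compose[OF ln_at_top]) simp
    then show ?thesis by (simp add: filterlim_at_top)
  qed
  moreover have "\<forall>\<^sub>F j in sequentially. 4 \<le> j" by (rule eventually_ge_at_top)
  ultimately have "\<forall>\<^sub>F j in sequentially. \<epsilon> (k * j) < (1 / 192) ^ 3 \<and>
      1 \<le> \<epsilon> (k * j) * sqrt (real (k * j)) * (p (k * j))\<^sup>2 / (ln (real (k * j))) ^ 5 \<and>
      1000000 * real k \<le> ln (real (k * j)) \<and> 4 \<le> j"
    by eventually_elim simp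
  \<comment> \<open>The threshold depends on \<epsilon>, \<open>p\<close> and \<open>k\<close>
    alone, hence serves all hypergraphs on \<open>n\<close> vertices at once.\<close>
  then obtain j0 where j0: "\<And>j. j \<ge> j0 \<Longrightarrow> \<epsilon> (k * j) < (1 / 192) ^ 3 \<and>
      1 \<le> \<epsilon> (k * j) * sqrt (real (k * j)) * (p (k * j))\<^sup>2 / (ln (real (k * j))) ^ 5 \<and>
      1000000 * real k \<le> ln (real (k * j)) \<and> 4 \<le> j"
    unfolding eventually_sequentially by blast
  define kX where "kX = k div 2"
  define kY where "kY = k - k div 2"
  have kXY: "kX + kY = k" "kX > 0" "kY > 0" unfolding kX_def kY_def using k2 by auto
  have main: "\<exists>\<M> :: nat set set set. (\<forall>M\<in>\<M>. perfect_matching n k E M) \<and>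
      (\<forall>M1\<in>\<M>. \<forall>M2\<in>\<M>. M1 \<noteq> M2 \<longrightarrow> M1 \<inter> M2 = {}) \<and>
      real (card \<M>) \<ge> (1 - 4 * \<epsilon> n powr (1/3)) * real (card E) / (real n / real k)"
    if n: "n \<ge> k * j0" "k dvd n" and E: "uniform_hypergraph n k E" and q: "p n = real (card E) / real (n choose k)"
      and Ra: "\<And>S. S \<subseteq> {1..n} \<Longrightarrow> card S = kX \<Longrightarrow>
        int (deg n k E S) \<ge> \<lceil>(1 - \<epsilon> n) * real ((n - kX) choose kY) * p n\<rceil>"
      and Rb: "\<And>S. S \<subseteq> {1..n} \<Longrightarrow> card S = kY \<Longrightarrow>
        int (deg n k E S) \<ge> \<lceil>(1 - \<epsilon> n) * real ((n - kY) choose kX) * p n\<rceil>"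
      and Re: "\<And>S1 S2. S1 \<subseteq> {1..n} \<Longrightarrow> S2 \<subseteq> {1..n} \<Longrightarrow> card S1 = kX \<Longrightarrow> card S2 = kX \<Longrightarrow> S1 \<inter> S2 = {} \<Longrightarrow>
        int (card (nbhd n k E S1 \<inter> nbhd n k E S2)) \<le> \<lfloor>(1 + \<epsilon> n) * real ((n - 2 * kX) choose kY) * (p n)\<^sup>2\<rfloor>"
      and Rf: "\<And>S1 S2. S1 \<subseteq> {1..n} \<Longrightarrow> S2 \<subseteq> {1..n} \<Longrightarrow> card S1 = kY \<Longrightarrow> card S2 = kY \<Longrightarrow> S1 \<inter> S2 = {} \<Longrightarrow>
        int (card (nbhd n k E S1 \<inter> nbhd n k E S2)) \<le> \<lfloor>(1 + \<epsilon> n) * real ((n - 2 * kY) choose kX) * (p n)\<^sup>2\<rfloor>"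
    for n :: nat and E :: "nat set set"
  proof -
    obtain \<nu> where \<nu>: "n = k * \<nu>" using n(2) by blast
    have "\<nu> \<ge> j0" using n(1) k0 unfolding \<nu> by simp
    note J = j0[OF this, folded \<nu>]
    have "1000000 * real k \<le> ln (real n)" using J by blast
    moreover have "real k \<ge> 2" using k2 by simp
    ultimately have lnpos: "ln (real n) > 0" by linarith
    have gr: "ln (real n) ^ 5 \<le> \<epsilon> n * sqrt (real n) * (p n)\<^sup>2"
      using J lnpos by (simp add: le_divide_eq)
    \<comment> \<open>Positivity of \<epsilon> and \<open>p\<close> is not assumed but follows: the
      growth bound has a positive left-hand side, and \<open>p\<close> is a ratio of
      cardinalities.\<close>
    have "0 < \<epsilon> n * (sqrt (real n) * (p n)\<^sup>2)"
      using gr zero_less_power[OF lnpos, of 5] unfolding mult.assoc by (rule less_le_trans[rotated])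
    then have \<epsilon>0: "\<epsilon> n > 0" and pn: "p n \<noteq> 0"
      by (auto simp: zero_less_mult_iff mult_less_0_iff)
    have "p n \<ge> 0" unfolding q by simp
    then have p0: "p n > 0" using pn by simp
    define x where "x = \<epsilon> n powr (1/3)"
    have x3: "x ^ 3 = \<epsilon> n"
      unfolding x_def using \<epsilon>0 by (simp add: powr_realpow[symmetric] powr_powr)
    have x0: "x > 0" unfolding x_def using \<epsilon>0 by simp
    have "x ^ 3 < (1 / 192) ^ 3" using J unfolding x3 by blast
    then have x1: "x \<le> 1 / 192" using power_less_imp_less_base[of x 3 "1 / 192"] by simp
    obtain I K where IK: "block_system {1..(kX + kY) * \<nu>} \<nu> kX kY I K"
      using block_system_exists[OF kXY(2,3)] by blast
    interpret template_setup n k \<nu> kX kY I K E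
      using IK kXY E \<nu> by unfold_locales auto
    have "\<exists>\<M>. (\<forall>M\<in>\<M>. perfect_matching n k E M) \<and> (\<forall>M1\<in>\<M>. \<forall>M2\<in>\<M>. M1 \<noteq> M2 \<longrightarrow> M1 \<inter> M2 = {}) \<and>
      (1 - 4 * x) * real (card E) / real \<nu> \<le> real (card \<M>)"
    proof (rule packing_if_log_large[where p = "p n" and x = x, unfolded x3])
      \<comment> \<open>For an integer quantity, the ceiling in a lower bound and the floor in an
        upper bound change nothing.\<close>
      show "(1 - \<epsilon> n) * real ((n - kX) choose kY) * p n \<le> real (deg n k E S)"
        if "S \<subseteq> {1..n}" "card S = kX" for S using Ra[OF that] by (simp add: ceiling_le_iff)
      show "(1 - \<epsilon> n) * real ((n - kY) choose kX) * p n \<le> real (deg n k E S)"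
        if "S \<subseteq> {1..n}" "card S = kY" for S using Rb[OF that] by (simp add: ceiling_le_iff)
      show "real (card (nbhd n k E S1 \<inter> nbhd n k E S2)) \<le> (1 + \<epsilon> n) * real ((n - 2 * kX) choose kY) * (p n)\<^sup>2"
        if "S1 \<subseteq> {1..n}" "S2 \<subseteq> {1..n}" "card S1 = kX" "card S2 = kX" "S1 \<inter> S2 = {}" for S1 S2
        using Re[OF that] by (simp add: le_floor_iff)
      show "real (card (nbhd n k E S1 \<inter> nbhd n k E S2)) \<le> (1 + \<epsilon> n) * real ((n - 2 * kY) choose kX) * (p n)\<^sup>2"
        if "S1 \<subseteq> {1..n}" "S2 \<subseteq> {1..n}" "card S1 = kY" "card S2 = kY" "S1 \<inter> S2 = {}" for S1 S2
        using Rf[OF that] by (simp add: le_floor_iff)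
    qed (use x0 x1 p0 q J gr in auto)
    moreover have "real \<nu> = real n / real k" unfolding \<nu> using k0 by simp
    ultimately show ?thesis unfolding x_def by simp
  qed
  show ?thesis
    unfolding Let_def
    by (intro exI[of _ "k * j0"] allI impI, elim conjE, rule main[unfolded kX_def kY_def]) (simp_all)
qed

end
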